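(* Assume that the system $g(p,x)\in C$ enjoys Robinson stability at $(\bar p,\bar x)$, and that either ${\cal P}=P$ or the cone $K$ is polyhedral. Then $$T_{\operatorname{gph}\Psi}(\bar p,\bar x,\bar x^* )=\Big\{(q,u,u^* )\ \Big|\ \exists\,z^*\in N_{T_{\operatorname{gph}\Gamma}(\bar z)}(q,u)\text{ with }\pi_{X^*}(z^* )=\bar x^*,\ \exists\,\hat\lambda\in\Lambda(\bar z,z^*;(q,u))\text{ such that } u^*\in\big(\nabla(\nabla_xg(\cdot)^*\hat\lambda)(\bar z)+{\cal H}_{\hat\lambda}\big)(q,u)+\pi_{X^*}\big(N_{{\cal K}_{\operatorname{gph}\Gamma}(\bar z,z^* )}(q,u)\big)\Big\}.$$ Consequently, for all $v=(q,u)\in Z$, $$D\Psi(\bar p,\bar x,\bar x^* )(v)=\bigcup\Big\{\big(\nabla(\nabla_xg(\cdot)^*\hat\lambda)(\bar z)+{\cal H}_{\hat\lambda}\big)v+\pi_{X^*}\big(N_{{\cal K}_{\operatorname{gph}\Gamma}(\bar z,z^* )}(v)\big)\ \Big|\ z^*\in N_{T_{\operatorname{gph}\Gamma}(\bar z)}(v),\ \pi_{X^*}(z^* )=\bar x^*,\ \hat\lambda\in\Lambda(\bar z,z^*;v)\Big\}.$$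
   Context: Notation: $X=\mathbb R^n$, $P=\mathbb R^m$, $Y=\mathbb R^l$, $Z:=P\times X$, and $E$ is finite-dimensional. Dual spaces are distinguished from primal ones, $Z^*=P^*\times X^*$, and $\pi_{X^*}(p^*,x^* ):=x^*$. $A^*$ denotes the adjoint of a linear map $A$, and $\operatorname{rge}A$ its range. For $\lambda\in Y^*$, $\nabla(\nabla_xg(\cdot)^*\lambda)(\bar z)v\in X^*$ is the derivative at $\bar z$ of $z\mapsto\nabla_xg(z)^*\lambda$, applied to $v$. For a cone $A$, $A^*:=\{a^*:\langle a^*,a\rangle\le0\ \forall a\in A\}$ is its polar, and for a closed convex cone $K$, $\operatorname{lin}K:=K\cap(-K)$. For a closed set $\Omega$ and $\bar z\in\Omega$: the tangent cone is $T_\Omega(\bar z):=\{w:\exists\, t_k\downarrow0,\ w_k\to w \text{ with } \bar z+t_kw_k\in\Omega\}$; the regular normal cone is $N_\Omega(\bar z):=\{z^*:\limsup_{z\to\bar z,\,z\in\Omega}\langle z^*,z-\bar z\rangle/\|z-\bar z\|\le0\}$ (for convex sets, this is the normal cone of convex analysis); and, for $z^*\in N_\Omega(\bar z)$, the critical cone is ${\cal K}_\Omega(\bar z,z^* ):=T_\Omega(\bar z)\cap\{z^*\}^\perp$. For a set-valued map $\Phi$, the graphical derivative is $D\Phi(\bar z,\bar u)(w):=\{v:(w,v)\in T_{\operatorname{gph}\Phi}(\bar z,\bar u)\}$. Setting: $g\colon P\times X\to Y$ is $C^2$ around $\bar z=(\bar p,\bar x)$. The set $C\subset Y$ is closed and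 $C^2$-cone reducible at $g(\bar z)$ to a closed convex cone $K\subset E$: there exist a neighborhood $V$ of $g(\bar z)$ and a $C^2$ map $h\colon V\to E$ with $h(g(\bar z))=0$, $\nabla h(g(\bar z))$ surjective, and $C\cap V=\{y\in V:h(y)\in K\}$. Set $\Gamma(p):=\{x:g(p,x)\in C\}$ with $\bar x\in\Gamma(\bar p)$, $\Psi(p,x):=N_{\Gamma(p)}(x)$, and fix $\bar x^*\in N_{\Gamma(\bar p)}(\bar x)$. Let $G:=h\circ g$ near $\bar z$. The system $g(p,x)\in C$ enjoys Robinson stability at $(\bar p,\bar x)$ if there are $\kappa\ge0$ and neighborhoods $W$ of $\bar p$ and $U$ of $\bar x$ with ${\rm dist}(x;\Gamma(p))\le\kappa\,{\rm dist}(g(p,x);C)$ for all $(p,x)\in W\times U$. The characteristic subspace is ${\cal P}:=\{q\in P:\nabla_pG(\bar z)q\in\operatorname{rge}\nabla_xG(\bar z)+\operatorname{lin}K\}$. Multipliers: for $\lambda\in N_C(g(\bar z))$, let $(\nabla h(g(\bar z))^* )^{-1}\lambda$ denote the unique $\mu\in E^*$ with $\nabla h(g(\bar z))^*\mu=\lambda$. For $z^*\in N_{\operatorname{gph}\Gamma}(\bar z)$, set $\Lambda(\bar z,z^* ):=\{\lambda\in N_C(g(\bar z)):\nabla g(\bar z)^*\lambda=z^*\}$, and for $v\in{\cal K}_{\operatorname{gph}\Gamma}(\bar z,z^* )$, $$\Lambda(\bar z,z^*;v):=\arg\max_{\lambda\in\Lambda(\bar z,z^* )}\Big(\langle\lambda,\nabla^2g(\bar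 z)(v,v)\rangle+\nabla^2\big\langle(\nabla h(g(\bar z))^* )^{-1}\lambda,h(\cdot)\big\rangle(g(\bar z))\big(\nabla g(\bar z)v,\nabla g(\bar z)v\big)\Big).$$ For $\lambda\in N_C(g(\bar z))$, the linear map ${\cal H}_\lambda\colon Z\to X^*$ is ${\cal H}_\lambda v:=\nabla_xg(\bar z)^*\nabla^2\langle(\nabla h(g(\bar z))^* )^{-1}\lambda,h(\cdot)\rangle(g(\bar z))\nabla g(\bar z)v$, where $\nabla^2\langle\mu,h(\cdot)\rangle(y)$ is the Hessian of $y\mapsto\langle\mu,h(y)\rangle$, viewed as a linear map $Y\to Y^*$. *)

theory Defs
  imports "HOL-Analysis.Analysis"
begin

(* Dual spaces are identified with the primal spaces via the inner product. *)

definition tangent_cone :: "'a::real_normed_vector set \<Rightarrow> 'a \<Rightarrow> 'a set" where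
  "tangent_cone \<Omega> zb = {w. \<exists>t :: nat \<Rightarrow> real. \<exists>ws :: nat \<Rightarrow> 'a.
      (\<forall>k. t k > 0) \<and> t \<longlonglongrightarrow> 0 \<and> ws \<longlonglongrightarrow> w \<and> (\<forall>k. zb + t k *\<^sub>R ws k \<in> \<Omega>)}"

text \<open>Regular (Frechet) normal cone; limsup condition written out with epsilon-delta;
  empty if the base point is not in the set.\<close>
definition reg_normal_cone :: "'a::real_inner set \<Rightarrow> 'a \<Rightarrow> 'a set" where
  "reg_normal_cone \<Omega> zb = {zs. zb \<in> \<Omega> \<and>
      (\<forall>\<epsilon>>0. \<exists>\<delta>>0. \<forall>z\<in>\<Omega>. norm (z - zb) < \<delta> \<longrightarrow> zs \<bullet> (z - zb) \<le> \<epsilon> * norm (z - zb))}"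

definition critical_cone :: "'a::real_inner set \<Rightarrow> 'a \<Rightarrow> 'a \<Rightarrow> 'a set" where
  "critical_cone \<Omega> zb zs = tangent_cone \<Omega> zb \<inter> {w. zs \<bullet> w = 0}"

definition graph :: "('a \<Rightarrow> 'b set) \<Rightarrow> ('a \<times> 'b) set" where
  "graph \<Phi> = {(z, u). u \<in> \<Phi> z}"

definition graphical_derivative ::
  "('a::real_normed_vector \<Rightarrow> 'b::real_normed_vector set) \<Rightarrow> 'a \<Rightarrow> 'b \<Rightarrow> 'a \<Rightarrow> 'b set" where
  "graphical_derivative \<Phi> zb ub w = {v. (w, v) \<in> tangent_cone (graph \<Phi>) (zb, ub)}"

definition Gamma :: "('p \<times> 'x \<Rightarrow> 'y) \<Rightarrow> 'y set \<Rightarrow> 'p \<Rightarrow> 'x set" where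
  "Gamma g C p = {x. g (p, x) \<in> C}"

definition gphGamma :: "('p \<times> 'x \<Rightarrow> 'y) \<Rightarrow> 'y set \<Rightarrow> ('p \<times> 'x) set" where
  "gphGamma g C = {z. g z \<in> C}"

definition Psi :: "('p \<times> 'x::real_inner \<Rightarrow> 'y) \<Rightarrow> 'y set \<Rightarrow> 'p \<times> 'x \<Rightarrow> 'x set" where
  "Psi g C z = reg_normal_cone (Gamma g C (fst z)) (snd z)"

definition edist_set :: "'a::metric_space \<Rightarrow> 'a set \<Rightarrow> ereal" where
  "edist_set x A = (if A = {} then \<infinity> else ereal (infdist x A))"

definition robinson_stable :: "('p::metric_space \<times> 'x::metric_space \<Rightarrow> 'y::metric_space) \<Rightarrow> 'y set \<Rightarrow> 'p \<Rightarrow> 'x \<Rightarrow> bool" where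
  "robinson_stable g C pb xb \<longleftrightarrow> (\<exists>\<kappa>\<ge>0. \<exists>W U. open W \<and> pb \<in> W \<and> open U \<and> xb \<in> U \<and>
      (\<forall>p\<in>W. \<forall>x\<in>U. edist_set x (Gamma g C p) \<le> ereal \<kappa> * edist_set (g (p, x)) C))"

definition dx :: "('p::real_normed_vector \<times> 'x::real_normed_vector) \<Rightarrow>\<^sub>L 'y::real_normed_vector \<Rightarrow> 'x \<Rightarrow> 'y" where
  "dx A u = blinfun_apply A (0, u)"

definition dp :: "('p::real_normed_vector \<times> 'x::real_normed_vector) \<Rightarrow>\<^sub>L 'y::real_normed_vector \<Rightarrow> 'p \<Rightarrow> 'y" where
  "dp A q = blinfun_apply A (q, 0)"

text \<open>Characteristic subspace; DGz = nabla G(zbar) = nabla h(g zbar) o nabla g(zbar).\<close>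
definition char_subspace :: "(('p::real_normed_vector \<times> 'x::real_normed_vector) \<Rightarrow>\<^sub>L 'e::real_normed_vector) \<Rightarrow> 'e set \<Rightarrow> 'p set" where
  "char_subspace DGz K = {q. \<exists>a b. dp DGz q = a + b \<and> a \<in> range (dx DGz) \<and> b \<in> K \<inter> uminus ` K}"

definition inv_adj :: "('y::real_inner \<Rightarrow>\<^sub>L 'e::real_inner) \<Rightarrow> 'y \<Rightarrow> 'e" where
  "inv_adj A lam = (THE \<mu>. adjoint (blinfun_apply A) \<mu> = lam)"

text \<open>Lambda(zbar, z*), with y0 = g(zbar), Dgz = nabla g(zbar).\<close>
definition Lambda_set :: "'y::real_inner set \<Rightarrow> 'y \<Rightarrow> ('z::real_inner \<Rightarrow>\<^sub>L 'y) \<Rightarrow> 'z \<Rightarrow> 'y set" where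
  "Lambda_set C y0 Dgz zs = {lam \<in> reg_normal_cone C y0. adjoint (blinfun_apply Dgz) lam = zs}"

definition mult_obj :: "('z::real_inner \<Rightarrow>\<^sub>L 'y::real_inner) \<Rightarrow> ('z \<Rightarrow>\<^sub>L ('z \<Rightarrow>\<^sub>L 'y))
     \<Rightarrow> ('y \<Rightarrow>\<^sub>L 'e::real_inner) \<Rightarrow> ('y \<Rightarrow>\<^sub>L ('y \<Rightarrow>\<^sub>L 'e)) \<Rightarrow> 'z \<Rightarrow> 'y \<Rightarrow> real" where
  "mult_obj Dgz D2gz Dhy D2hy v lam =
     lam \<bullet> blinfun_apply (blinfun_apply D2gz v) v
     + inv_adj Dhy lam \<bullet> blinfun_apply (blinfun_apply D2hy (blinfun_apply Dgz v)) (blinfun_apply Dgz v)"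

definition Lambda_crit :: "'y::real_inner set \<Rightarrow> 'y \<Rightarrow> ('z::real_inner \<Rightarrow>\<^sub>L 'y) \<Rightarrow> ('z \<Rightarrow>\<^sub>L ('z \<Rightarrow>\<^sub>L 'y))
     \<Rightarrow> ('y \<Rightarrow>\<^sub>L 'e::real_inner) \<Rightarrow> ('y \<Rightarrow>\<^sub>L ('y \<Rightarrow>\<^sub>L 'e)) \<Rightarrow> 'z \<Rightarrow> 'z \<Rightarrow> 'y set" where
  "Lambda_crit C y0 Dgz D2gz Dhy D2hy zs v =
     {lam \<in> Lambda_set C y0 Dgz zs. \<forall>lam' \<in> Lambda_set C y0 Dgz zs.
        mult_obj Dgz D2gz Dhy D2hy v lam' \<le> mult_obj Dgz D2gz Dhy D2hy v lam}"

text \<open>nabla(nabla_x g(.)^* lambda)(zbar) v: the element w of X* with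
  <w,u> = <lambda, nabla^2 g(zbar)(v,(0,u))>, i.e. the derivative of
  z |-> nabla_x g(z)^* lambda at zbar in direction v.\<close>
definition grad_adj :: "('p::real_inner \<times> 'x::real_inner) \<Rightarrow>\<^sub>L ((('p \<times> 'x) \<Rightarrow>\<^sub>L 'y::real_inner))
     \<Rightarrow> 'y \<Rightarrow> 'p \<times> 'x \<Rightarrow> 'x" where
  "grad_adj D2gz lam v = adjoint (dx (blinfun_apply D2gz v)) lam"

text \<open>H_lambda v = nabla_x g(zbar)^* nabla^2<mu,h>(g zbar) nabla g(zbar) v, mu = (nabla h^* )^{-1} lambda.\<close>
definition H_op :: "(('p::real_inner \<times> 'x::real_inner) \<Rightarrow>\<^sub>L 'y::real_inner) \<Rightarrow> ('y \<Rightarrow>\<^sub>L 'e::real_inner)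
     \<Rightarrow> ('y \<Rightarrow>\<^sub>L ('y \<Rightarrow>\<^sub>L 'e)) \<Rightarrow> 'y \<Rightarrow> 'p \<times> 'x \<Rightarrow> 'x" where
  "H_op Dgz Dhy D2hy lam v =
     adjoint (dx Dgz) (adjoint (blinfun_apply (blinfun_apply D2hy (blinfun_apply Dgz v))) (inv_adj Dhy lam))"

end

theory Submission
  imports Defs
begin

text \<open>Put \<open>G = h \<circ> g\<close>, \<open>A = \<nabla>G(zb)\<close> and \<open>B = \<nabla>\<^sup>2G(zb)\<close>; since \<open>\<nabla>h\<close> is onto, everything can be expressed
  by multipliers \<open>m\<close> in the polar of \<open>K\<close>, with \<open>\<lambda> = \<nabla>h\<^sup>* m\<close>. Robinson stability represents normals to
  \<open>\<Gamma>(p)\<close> by multipliers of proportionally bounded norm.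

  A tangent to the graph of \<open>\<Psi>\<close> comes with points \<open>z\<^sub>k\<close> and multipliers \<open>m\<^sub>k\<close> that
  subconverge to some \<open>\<mu>\<close>. Expanding \<open>(m' - m\<^sub>k) \<bullet> G(z\<^sub>k) \<le> 0\<close> to second order gives the
  maximality of \<open>\<mu>\<close>. If the characteristic subspace is everything, the adjoint of \<open>A\<close> on the polar
  cone is a linear function of its \<open>x\<close>-part, so the difference quotients of the adjoint images
  converge; if \<open>K\<close> is polyhedral, all \<open>m\<^sub>k\<close> may be taken in one face of the polar cone.

  Conversely, given the data of the right-hand side, perturb the parameter to second order so that
  the given multiplier becomes maximal over all multipliers of \<open>xbs\<close>, and minimize
  \<open>\<rho>/2 |x - xb - t u|\<^sup>2 - (xbs + t us) \<bullet> x\<close> over the feasible set. First-order optimality yields a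
  point in the graph, the first inclusion describes its limit, and hypomonotonicity of the right-hand
  side for large \<open>\<rho>\<close> forces the minimizers to be \<open>xb + t u + o(t)\<close>.\<close>

section \<open>Polar and polyhedral cones\<close>

text \<open>A normal to \<open>\<Gamma> p\<close> fixes only the x-part of a multiplier's image
  under the adjoint \<open>Ad\<close> of \<open>A\<close>, whereas the right-hand side maximizes
  over a whole fibre of \<open>Ad\<close>. The two alternative hypotheses bridge this gap: the first
  makes the x-part determine the image; under the second, linear images of the cones involved are
  closed, so limits of image quotients can be lifted even if the multiplier quotients diverge. In
  the converse the minimizers are a priori only \<open>O(t)\<close> away, and their rescaled offset
  may tend to some \<open>yh \<noteq> 0\<close>, with a new multiplier \<open>\<mu>\<close>. The
  cross term \<open>(\<mu> - m) \<bullet> B v (0, yh)\<close> is linear in \<open>yh\<close>, so no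
  choice of \<open>\<rho>\<close> dominates it. It is controlled by playing the maximality of
  \<open>m\<close> against that of \<open>\<mu>\<close>; the parameter perturbation enters both
  inequalities with the same term, which cancels. What remains is quadratic in \<open>yh\<close>,
  with a coefficient bounded independently of \<open>\<rho>\<close> because
  \<open>norm \<mu> \<le> \<kappa> * norm xbs\<close>.\<close>

definition polar_cone :: "'a::real_inner set \<Rightarrow> 'a set" where
  "polar_cone K = {y. \<forall>x\<in>K. y \<bullet> x \<le> 0}"

lemma polar_coneD: "y \<in> polar_cone K \<Longrightarrow> x \<in> K \<Longrightarrow> y \<bullet> x \<le> 0"
  by (simp add: polar_cone_def)

lemma convex_cone_polar: "convex_cone (polar_cone K)"
  by (auto simp: convex_cone_iff polar_cone_def inner_add_left add_nonpos_nonpos mult_nonneg_nonpos)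

lemma closed_polar: "closed (polar_cone K)"
proof -
  have "polar_cone K = (\<Inter>x\<in>K. {y. x \<bullet> y \<le> 0})"
    by (auto simp: polar_cone_def inner_commute)
  then show ?thesis by (simp add: closed_INT closed_halfspace_le)
qed

lemma bipolar:
  fixes K :: "'a::euclidean_space set"
  assumes "closed K" "convex_cone K"
  shows "polar_cone (polar_cone K) = K"
proof
  show "K \<subseteq> polar_cone (polar_cone K)"
    by (auto simp: polar_cone_def inner_commute)
  show "polar_cone (polar_cone K) \<subseteq> K"
  proof
    fix x assume x: "x \<in> polar_cone (polar_cone K)"
    show "x \<in> K"
    proof (rule ccontr)
      assume "x \<notin> K"
      moreover have "convex K" using assms(2) by (simp add: convex_cone_def)
      ultimately obtain a b where ab: "a \<bullet> x < b" "\<forall>k\<in>K. a \<bullet> k > b"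
        using separating_hyperplane_closed_point[of K x] assms(1) by auto
      have "b < 0" using ab(2) convex_cone_contains_0[OF assms(2)] by force
      have "a \<bullet> k \<ge> 0" if k: "k \<in> K" for k
      proof (rule ccontr)
        assume n: "\<not> a \<bullet> k \<ge> 0"
        define c where "c = b / (a \<bullet> k)"
        have "c \<ge> 0" using n \<open>b < 0\<close> by (simp add: c_def divide_nonpos_neg)
        then have "c *\<^sub>R k \<in> K" using convex_cone_scaleR[OF assms(2)] k by auto
        then have "a \<bullet> (c *\<^sub>R k) > b" using ab(2) by blast
        then show False using n by (simp add: c_def)
      qed
      then have "- a \<in> polar_cone K" by (simp add: polar_cone_def)
      then have "(- a) \<bullet> x \<le> 0" using x by (metis polar_coneD inner_commute)
      then show False using ab(1) \<open>b < 0\<close> by simp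
    qed
  qed
qed

lemma polar_convex_cone_hull: "polar_cone (convex_cone hull F) = {y. \<forall>x\<in>F. y \<bullet> x \<le> 0}"
proof
  show "polar_cone (convex_cone hull F) \<subseteq> {y. \<forall>x\<in>F. y \<bullet> x \<le> 0}"
    by (auto simp: polar_cone_def hull_inc)
  show "{y. \<forall>x\<in>F. y \<bullet> x \<le> 0} \<subseteq> polar_cone (convex_cone hull F)"
  proof
    fix y assume y: "y \<in> {y. \<forall>x\<in>F. y \<bullet> x \<le> 0}"
    have "convex_cone hull F \<subseteq> {x. y \<bullet> x \<le> 0}"
      using y by (intro hull_minimal convex_cone_halfspace_le) auto
    then show "y \<in> polar_cone (convex_cone hull F)"
      by (auto simp: polar_cone_def)
  qed
qed

text \<open>A cone homogenizes its describing inequalities \<open>a \<bullet> x \<le> b\<close>: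
  \<open>0 \<in> S\<close> forces \<open>b \<ge> 0\<close>, and a point with
  \<open>a \<bullet> x > 0\<close> could be scaled past \<open>b\<close>. The set \<open>F\<close>
  consists of the normals \<open>a\<close>.\<close>

lemma polyhedral_cone_eq_polar:
  assumes "polyhedron S" "convex_cone S"
  obtains F where "finite F" "S = polar_cone (convex_cone hull F)"
proof -
  from assms(1) obtain H where H: "finite H" "S = \<Inter>H" 
      "\<forall>h\<in>H. \<exists>a b. a \<noteq> 0 \<and> h = {x. a \<bullet> x \<le> b}"
    unfolding polyhedron_def by auto
  then obtain a b where ab: "\<And>h. h \<in> H \<Longrightarrow> h = {x. a h \<bullet> x \<le> b h}"
    by metis
  have "S = {y. \<forall>x\<in>a ` H. y \<bullet> x \<le> 0}"
  proof (intro set_eqI iffI)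
    fix x assume x: "x \<in> S"
    have "a h \<bullet> x \<le> 0" if h: "h \<in> H" for h
    proof (rule ccontr)
      assume n: "\<not> a h \<bullet> x \<le> 0"
      define c where "c = (\<bar>b h\<bar> + 1) / (a h \<bullet> x)"
      have "c \<ge> 0" using n by (simp add: c_def)
      then have "c *\<^sub>R x \<in> S" using convex_cone_scaleR[OF assms(2)] x by auto
      then have "a h \<bullet> (c *\<^sub>R x) \<le> b h" using H(2) ab h by blast
      then show False using n by (simp add: c_def)
    qed
    then show "x \<in> {y. \<forall>x\<in>a ` H. y \<bullet> x \<le> 0}" by (auto simp: inner_commute)
  next
    fix x assume x: "x \<in> {y. \<forall>x\<in>a ` H. y \<bullet> x \<le> 0}"
    have "x \<in> h" if h: "h \<in> H" for h
    proof -
      have "0 \<in> h" using convex_cone_contains_0[OF assms(2)] H(2) h by auto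
      then have "b h \<ge> 0" by (subst (asm) ab[OF h]) simp
      moreover have "a h \<bullet> x \<le> 0" using x h by (auto simp: inner_commute)
      ultimately show ?thesis by (subst ab[OF h]) simp
    qed
    then show "x \<in> S" using H(2) by auto
  qed
  then show thesis
    using that[of "a ` H"] H(1) by (simp add: polar_convex_cone_hull)
qed

lemma bipolar_convex_cone_hull:
  fixes F :: "'a::euclidean_space set"
  assumes "finite F"
  shows "polar_cone (polar_cone (convex_cone hull F)) = convex_cone hull F"
  by (intro bipolar polyhedron_imp_closed polyhedron_convex_cone_hull assms convex_cone_convex_cone_hull)

text \<open>Minkowski-Weyl by dualizing twice: the cone generated by the normals of \<open>S\<close>
  is itself polyhedral, hence the polar of a second finitely generated cone, which equals
  \<open>S\<close> by the bipolar theorem.\<close>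

lemma polyhedral_cone_finitely_generated:
  fixes S :: "'a::euclidean_space set"
  assumes "polyhedron S" "convex_cone S"
  obtains F where "finite F" "S = convex_cone hull F"
proof -
  obtain F where F: "finite F" "S = polar_cone (convex_cone hull F)"
    using polyhedral_cone_eq_polar[OF assms] .
  obtain F2 where F2: "finite F2" "convex_cone hull F = polar_cone (convex_cone hull F2)"
    using polyhedral_cone_eq_polar[OF polyhedron_convex_cone_hull[OF F(1)] convex_cone_convex_cone_hull] .
  have "S = convex_cone hull F2"
    using F(2) F2 bipolar_convex_cone_hull[OF F2(1)] by simp
  then show thesis using that F2(1) by blast
qed

lemma polyhedron_polar_cone:
  fixes S :: "'a::euclidean_space set"
  assumes "polyhedron S" "convex_cone S"
  shows "polyhedron (polar_cone S)"
proof -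
  obtain F where F: "finite F" "S = polar_cone (convex_cone hull F)"
    using polyhedral_cone_eq_polar[OF assms] .
  then show ?thesis
    using bipolar_convex_cone_hull[OF F(1)] polyhedron_convex_cone_hull[OF F(1)] by simp
qed

text \<open>What polyhedrality buys: a linear image of a closed convex cone may fail to be closed,
  but generators are mapped to generators.\<close>

lemma polyhedron_linear_image_cone:
  fixes S :: "'a::euclidean_space set" and f :: "'a \<Rightarrow> 'b::euclidean_space"
  assumes "polyhedron S" "convex_cone S" "linear f"
  shows "polyhedron (f ` S)"
proof -
  obtain F where "finite F" "S = convex_cone hull F"
    using polyhedral_cone_finitely_generated[OF assms(1,2)] .
  then show ?thesis
    using convex_cone_hull_linear_image[OF assms(3), of F] polyhedron_convex_cone_hull[of "f ` F"]
    by simp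
qed

text \<open>Adding the line amounts to adding the generators \<open>m\<close> and \<open>-m\<close>.
  The result contains all differences \<open>c *\<^sub>R (n - m)\<close> with
  \<open>n \<in> S\<close> and \<open>c \<ge> 0\<close>, that is, the difference quotients of
  multipliers that occur later.\<close>

lemma polyhedral_cone_add_line:
  fixes S :: "'a::euclidean_space set"
  assumes "polyhedron S" "convex_cone S"
  shows "polyhedron {n + c *\<^sub>R m | n c. n \<in> S}" "convex_cone {n + c *\<^sub>R m | n c. n \<in> S}"
proof -
  obtain F where F: "finite F" "S = convex_cone hull F"
    using polyhedral_cone_finitely_generated[OF assms(1,2)] .
  have line: "convex_cone hull {m, -m} = range (\<lambda>c. c *\<^sub>R m)"
  proof
    show "convex_cone hull {m, -m} \<subseteq> range (\<lambda>c. c *\<^sub>R m)"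
    proof (rule hull_minimal)
      show "{m, -m} \<subseteq> range (\<lambda>c. c *\<^sub>R m)"
        by (auto intro: image_eqI[where x=1] image_eqI[where x="-1"])
      show "convex_cone (range (\<lambda>c. c *\<^sub>R m))"
        using subspace_imp_convex_cone[OF subspace_span[of "{m}"]] by (simp add: span_singleton)
    qed
    show "range (\<lambda>c. c *\<^sub>R m) \<subseteq> convex_cone hull {m, -m}"
    proof clarify
      fix c :: real
      show "c *\<^sub>R m \<in> convex_cone hull {m, -m}"
      proof (cases "c \<ge> 0")
        case True
        then show ?thesis by (intro convex_cone_hull_mul hull_inc) auto
      next
        case False
        then have "(-c) *\<^sub>R (-m) \<in> convex_cone hull {m, -m}"
          by (intro convex_cone_hull_mul hull_inc) auto
        then show ?thesis by simp
      qed
    qed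
  qed
  have "{n + c *\<^sub>R m | n c. n \<in> S} = convex_cone hull (F \<union> {m, -m})"
    unfolding convex_cone_hull_Un F(2)[symmetric] line by blast
  then show "polyhedron {n + c *\<^sub>R m | n c. n \<in> S}" "convex_cone {n + c *\<^sub>R m | n c. n \<in> S}"
    using polyhedron_convex_cone_hull[of "F \<union> {m, -m}"] F(1) convex_cone_convex_cone_hull
    by auto
qed

text \<open>Multipliers complementary to \<open>y\<close> form a face of the polar cone; for
  polyhedral \<open>K\<close> there are finitely many faces, which permits a pigeonhole argument
  along a sequence.\<close>

lemma polar_hyperplane_exposed_face:
  assumes "y \<in> K"
  shows "(polar_cone K \<inter> {m. m \<bullet> y = 0}) exposed_face_of polar_cone K"
proof -
  have "polar_cone K \<inter> {x. y \<bullet> x = 0} exposed_face_of polar_cone K"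
    using assms convex_cone_polar[of K]
    by (intro exposed_face_of_Int_supporting_hyperplane_le)
       (auto simp: convex_cone_def polar_cone_def inner_commute)
  then show ?thesis by (simp add: inner_commute)
qed

text \<open>Duality with a norm bound: the adjoint images of the elements of
  \<open>polar_cone D\<close> of norm at most \<open>R\<close> form a compact convex set whose
  support function at \<open>u\<close> is \<open>R\<close> times the distance of \<open>f u\<close>
  to \<open>D\<close>.\<close>

lemma bounded_multiplier_exists:
  fixes f :: "'x::euclidean_space \<Rightarrow> 'e::euclidean_space"
  assumes lin: "linear f" and D: "convex_cone D" and R: "0 \<le> R"
    and le: "\<And>u d. d \<in> D \<Longrightarrow> xs \<bullet> u \<le> R * norm (f u - d)"
  obtains m where "m \<in> polar_cone D" "norm m \<le> R" "adjoint f m = xs"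
proof -
  define Q where "Q = adjoint f ` (polar_cone D \<inter> cball 0 R)"
  have la: "linear (adjoint f)" by (rule adjoint_linear[OF lin])
  have cc: "convex (polar_cone D)" using convex_cone_polar by (auto simp: convex_cone_def)
  have cQ: "compact Q" unfolding Q_def
    using la by (intro compact_continuous_image linear_continuous_on closed_Int_compact closed_polar)
      (auto simp: linear_conv_bounded_linear)
  have vQ: "convex Q" unfolding Q_def
    by (intro convex_linear_image la convex_Int cc convex_cball)
  have "xs \<in> Q"
  proof (rule ccontr)
    assume "xs \<notin> Q"
    then obtain a b where ab: "a \<bullet> xs < b" "\<forall>x\<in>Q. a \<bullet> x > b"
      using separating_hyperplane_closed_point[OF vQ compact_imp_closed[OF cQ]] by blast
    \<comment> \<open>Separation puts the compact set where \<open>a\<close> is large, so the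
      violated support inequality is the one in direction \<open>-a\<close>.\<close>
    define u where "u = - a"
    define e where "e = f u"
    define CD where "CD = closure D"
    have CD: "closed CD" "convex CD" "CD \<noteq> {}" "convex_cone CD"
      using D convex_closure[of D] conic_closure[of D] closure_subset[of D]
      by (auto simp: CD_def convex_cone_def)
    define d where "d = closest_point CD e"
    have dC: "d \<in> CD" unfolding d_def using closest_point_in_set CD by blast
    have dot: "(e - d) \<bullet> (x - d) \<le> 0" if "x \<in> CD" for x
      unfolding d_def using closest_point_dot[OF CD(2,1) that] .
    have "(e - d) \<bullet> d = 0"
    proof -
      have "2 *\<^sub>R d \<in> CD" using convex_cone_scaleR[OF CD(4), of 2] dC by auto
      from dot[OF this] have "(e - d) \<bullet> d \<le> 0" by (simp add: scaleR_2)
      moreover have "0 \<in> CD" using convex_cone_contains_0[OF CD(4)] .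
      from dot[OF this] have "(e - d) \<bullet> d \<ge> 0" by simp
      ultimately show ?thesis by simp
    qed
    have pol: "e - d \<in> polar_cone D"
      unfolding polar_cone_def
    proof (safe)
      fix x assume "x \<in> D"
      then have "x \<in> CD" unfolding CD_def using closure_subset by blast
      from dot[OF this] show "(e - d) \<bullet> x \<le> 0" using \<open>(e - d) \<bullet> d = 0\<close> by (simp add: inner_diff_right)
    qed
    \<comment> \<open>The projection residual, scaled to norm \<open>R\<close>, attains the support
      function. For \<open>e = d\<close> the quotient is \<open>R / 0 = 0\<close>, and
      \<open>m = 0\<close> still qualifies.\<close>
    define m where "m = (R / norm (e - d)) *\<^sub>R (e - d)"
    have mp: "m \<in> polar_cone D" unfolding m_def
      using convex_cone_scaleR[OF convex_cone_polar _ pol] R by simp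
    have "norm m \<le> R" unfolding m_def using R by simp
    then have "adjoint f m \<in> Q" unfolding Q_def using mp by auto
    then have "a \<bullet> adjoint f m > b" using ab(2) by blast
    then have "xs \<bullet> u > u \<bullet> adjoint f m" using ab(1) by (simp add: u_def inner_commute)
    also have "u \<bullet> adjoint f m = e \<bullet> m" by (simp add: adjoint_works[OF lin] e_def)
    also have "e \<bullet> m = R * norm (e - d)"
    proof (cases "e = d")
      case False
      have "e \<bullet> (e - d) = (e - d) \<bullet> (e - d)" using \<open>(e - d) \<bullet> d = 0\<close> 
        by (simp add: inner_diff_left inner_diff_right inner_commute)
      then show ?thesis using False by (simp add: m_def power2_norm_eq_inner[symmetric] power2_eq_square)
    qed (simp add: m_def)
    finally have gt: "xs \<bullet> u > R * norm (e - d)" .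
    from dC obtain ds where ds: "\<And>n. ds n \<in> D" "ds \<longlonglongrightarrow> d"
      unfolding CD_def closure_sequential by blast
    have "(\<lambda>n. R * norm (e - ds n)) \<longlonglongrightarrow> R * norm (e - d)"
      by (intro tendsto_intros ds)
    then have "xs \<bullet> u \<le> R * norm (e - d)"
      by (rule LIMSEQ_le_const) (use le[OF ds(1)] e_def in auto)
    then show False using gt by simp
  qed
  then show thesis using that by (auto simp: Q_def)
qed

section \<open>Second-order expansions\<close>

lemma has_derivative_atE:
  assumes "(f has_derivative F) (at a)" "0 < \<epsilon>"
  obtains \<delta> where "\<delta> > 0" "\<And>w. norm w < \<delta> \<Longrightarrow> norm (f (a + w) - f a - F w) \<le> \<epsilon> * norm w"
proof -
  from assms obtain \<delta> where "\<delta> > 0" 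
    "\<And>y. norm (y - a) < \<delta> \<Longrightarrow> norm (f y - f a - F (y - a)) \<le> \<epsilon> * norm (y - a)"
    unfolding has_derivative_at_alt by blast
  then show thesis using that[of \<delta>] by (metis add_diff_cancel_left')
qed

text \<open>\<open>Df\<close> is differentiable at the point \<open>a\<close> only, so the mean
  value inequality is applied to the whole remainder along the segment: its derivative
  \<open>(Df (a + s *\<^sub>R w) - Df a - B (s *\<^sub>R w)) w\<close> is already of order
  \<open>\<epsilon> * (norm w)\<^sup>2\<close>.\<close>

lemma second_order_taylor:
  fixes f :: "'a::real_normed_vector \<Rightarrow> 'b::real_normed_vector"
    and Df :: "'a \<Rightarrow> 'a \<Rightarrow>\<^sub>L 'b"
  assumes U: "open U" "a \<in> U"
    and der: "\<And>z. z \<in> U \<Longrightarrow> (f has_derivative blinfun_apply (Df z)) (at z)"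
    and der2: "(Df has_derivative B) (at a)" and e: "0 < \<epsilon>"
  obtains \<delta> where "\<delta> > 0" "\<And>w. norm w < \<delta> \<Longrightarrow> a + w \<in> U"
    "\<And>w. norm w < \<delta> \<Longrightarrow> norm (f (a + w) - f a - Df a w - (1/2) *\<^sub>R B w w) \<le> \<epsilon> * (norm w)\<^sup>2"
proof -
  obtain \<delta>1 where d1: "\<delta>1 > 0" "\<And>w. norm w < \<delta>1 \<Longrightarrow> norm (Df (a + w) - Df a - B w) \<le> \<epsilon> * norm w"
    using has_derivative_atE[OF der2 e] by blast
  obtain \<delta>2 where d2: "\<delta>2 > 0" "ball a \<delta>2 \<subseteq> U" using U open_contains_ball by blast
  interpret B: bounded_linear B using der2 has_derivative_bounded_linear by blast
  have inU: "a + w \<in> U" if "norm w < min \<delta>1 \<delta>2" for w using d2(2) that by (auto simp: dist_norm)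
  have "norm (f (a + w) - f a - Df a w - (1/2) *\<^sub>R B w w) \<le> \<epsilon> * (norm w)\<^sup>2" if w: "norm w < min \<delta>1 \<delta>2" for w
  proof -
    define \<phi> where "\<phi> = (\<lambda>s. f (a + s *\<^sub>R w) - s *\<^sub>R Df a w - (s\<^sup>2 / 2) *\<^sub>R B w w)"
    have small: "norm (s *\<^sub>R w) < min \<delta>1 \<delta>2" if "s \<in> {0..1}" for s
      using w that mult_right_mono[of s 1 "norm w"] by auto
    have d: "(\<phi> has_derivative (\<lambda>r. r *\<^sub>R ((Df (a + s *\<^sub>R w) - Df a - B (s *\<^sub>R w)) w))) (at s within {0..1})"
      if s: "s \<in> {0..1}" for s
    proof -
      have "((\<lambda>s. a + s *\<^sub>R w) has_derivative (\<lambda>r. r *\<^sub>R w)) (at s)"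
        by (auto intro!: derivative_eq_intros)
      from has_derivative_compose[OF this der[OF inU[OF small[OF s]]]]
      have "((\<lambda>s. f (a + s *\<^sub>R w)) has_derivative (\<lambda>r. r *\<^sub>R (Df (a + s *\<^sub>R w) w))) (at s)"
        by (simp add: blinfun.scaleR_right)
      then have "(\<phi> has_derivative (\<lambda>r. r *\<^sub>R Df (a + s *\<^sub>R w) w - r *\<^sub>R Df a w - (r * s) *\<^sub>R B w w)) (at s)"
        unfolding \<phi>_def by (auto intro!: derivative_eq_intros simp: power2_eq_square)
      then show ?thesis
        by (rule has_derivative_at_withinI[THEN has_derivative_eq_rhs])
           (simp add: blinfun.diff_left B.scaleR blinfun.scaleR_left scaleR_diff_right)
    qed
    have on: "onorm (\<lambda>r. r *\<^sub>R ((Df (a + s *\<^sub>R w) - Df a - B (s *\<^sub>R w)) w)) \<le> \<epsilon> * (norm w)\<^sup>2"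
      if s: "s \<in> {0..1}" for s
    proof (rule onorm_le)
      fix r :: real
      have "norm ((Df (a + s *\<^sub>R w) - Df a - B (s *\<^sub>R w)) w) \<le> norm (Df (a + s *\<^sub>R w) - Df a - B (s *\<^sub>R w)) * norm w"
        by (rule norm_blinfun)
      also have "\<dots> \<le> (\<epsilon> * norm (s *\<^sub>R w)) * norm w"
        using d1(2)[of "s *\<^sub>R w"] small[OF s] by (intro mult_right_mono) (simp_all only: min_less_iff_conj norm_ge_zero)
      also have "\<dots> \<le> (\<epsilon> * norm w) * norm w"
        using s e by (intro mult_right_mono mult_left_mono) (auto intro: mult_left_le_one_le)
      finally show "norm (r *\<^sub>R ((Df (a + s *\<^sub>R w) - Df a - B (s *\<^sub>R w)) w)) \<le> \<epsilon> * (norm w)\<^sup>2 * norm r"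
        using mult_left_mono[OF _ norm_ge_zero[of r]] by (simp add: power2_eq_square mult.commute[of _ "\<bar>r\<bar>"] mult.assoc)
    qed
    have "norm (\<phi> 1 - \<phi> 0) \<le> \<epsilon> * (norm w)\<^sup>2 * norm (1 - 0 :: real)"
      by (rule differentiable_bound[OF _ d on]) auto
    then show ?thesis by (simp add: \<phi>_def algebra_simps)
  qed
  then show thesis using that[of "min \<delta>1 \<delta>2"] d1 d2 inU by auto
qed

text \<open>The mean value inequality is applied to the difference of \<open>f\<close> along two
  parallel segments shifted by \<open>v\<close>; the gap between their derivatives is
  \<open>B v\<close> up to a small error.\<close>

lemma second_difference_bound:
  fixes f :: "'a::real_normed_vector \<Rightarrow> 'b::real_normed_vector"
    and Df :: "'a \<Rightarrow> 'a \<Rightarrow>\<^sub>L 'b"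
  assumes U: "open U" "a \<in> U"
    and der: "\<And>z. z \<in> U \<Longrightarrow> (f has_derivative blinfun_apply (Df z)) (at z)"
    and der2: "(Df has_derivative B) (at a)" and e: "0 < \<epsilon>"
  obtains \<delta> where "\<delta> > 0" "\<And>v w. norm v + norm w < \<delta> \<Longrightarrow>
     norm (f (a + v + w) - f (a + v) - f (a + w) + f a - B v w) \<le> \<epsilon> * (norm v + norm w)\<^sup>2"
proof -
  have e2: "0 < \<epsilon> / 2" using e by simp
  obtain \<delta>1 where d1: "\<delta>1 > 0" "\<And>w. norm w < \<delta>1 \<Longrightarrow> norm (Df (a + w) - Df a - B w) \<le> \<epsilon> / 2 * norm w"
    using has_derivative_atE[OF der2 e2] by blast
  obtain \<delta>2 where d2: "\<delta>2 > 0" "ball a \<delta>2 \<subseteq> U" using U open_contains_ball by blast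
  interpret B: bounded_linear B using der2 has_derivative_bounded_linear by blast
  have inU: "a + w \<in> U" if "norm w < min \<delta>1 \<delta>2" for w using d2(2) that by (auto simp: dist_norm)
  have "norm (f (a + v + w) - f (a + v) - f (a + w) + f a - B v w) \<le> \<epsilon> * (norm v + norm w)\<^sup>2"
    if vw: "norm v + norm w < min \<delta>1 \<delta>2" for v w
  proof -
    define \<phi> where "\<phi> = (\<lambda>s. f (a + (v + s *\<^sub>R w)) - f (a + s *\<^sub>R w) - s *\<^sub>R B v w)"
    have sw: "norm (s *\<^sub>R w) \<le> norm w" if "s \<in> {0..1}" for s
      using that by (auto intro: mult_left_le_one_le)
    have vsw: "norm (v + s *\<^sub>R w) \<le> norm v + norm w" if "s \<in> {0..1}" for s
      using sw[OF that] norm_triangle_ineq[of v "s *\<^sub>R w"] by linarith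
    have sm1: "norm (s *\<^sub>R w) < min \<delta>1 \<delta>2" if "s \<in> {0..1}" for s
      using sw[OF that] vw norm_ge_zero[of v] by linarith
    have sm2: "norm (v + s *\<^sub>R w) < min \<delta>1 \<delta>2" if "s \<in> {0..1}" for s
      using vsw[OF that] vw by linarith
    define \<Delta> where "\<Delta> = (\<lambda>s. Df (a + (v + s *\<^sub>R w)) - Df (a + s *\<^sub>R w) - B v)"
    have d: "(\<phi> has_derivative (\<lambda>r. r *\<^sub>R (\<Delta> s w))) (at s within {0..1})" if s: "s \<in> {0..1}" for s
    proof -
      have "((\<lambda>s. a + s *\<^sub>R w) has_derivative (\<lambda>r. r *\<^sub>R w)) (at s)"
        by (auto intro!: derivative_eq_intros)
      from has_derivative_compose[OF this der[OF inU[OF sm1[OF s]]]]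
      have 1: "((\<lambda>s. f (a + s *\<^sub>R w)) has_derivative (\<lambda>r. r *\<^sub>R (Df (a + s *\<^sub>R w) w))) (at s)"
        by (simp add: blinfun.scaleR_right)
      have "((\<lambda>s. a + (v + s *\<^sub>R w)) has_derivative (\<lambda>r. r *\<^sub>R w)) (at s)"
        by (auto intro!: derivative_eq_intros)
      from has_derivative_compose[OF this der[OF inU[OF sm2[OF s]]]]
      have "((\<lambda>s. f (a + (v + s *\<^sub>R w))) has_derivative (\<lambda>r. r *\<^sub>R (Df (a + (v + s *\<^sub>R w)) w))) (at s)"
        by (simp add: blinfun.scaleR_right)
      with 1 have "(\<phi> has_derivative (\<lambda>r. r *\<^sub>R Df (a + (v + s *\<^sub>R w)) w - r *\<^sub>R Df (a + s *\<^sub>R w) w - r *\<^sub>R B v w)) (at s)"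
        unfolding \<phi>_def by (auto intro!: derivative_eq_intros)
      then show ?thesis
        by (rule has_derivative_at_withinI[THEN has_derivative_eq_rhs])
           (simp add: \<Delta>_def blinfun.diff_left scaleR_diff_right)
    qed
    have on: "onorm (\<lambda>r. r *\<^sub>R (\<Delta> s w)) \<le> \<epsilon> * (norm v + norm w)\<^sup>2"
      if s: "s \<in> {0..1}" for s
    proof (rule onorm_le)
      fix r :: real
      have "\<Delta> s = (Df (a + (v + s *\<^sub>R w)) - Df a - B (v + s *\<^sub>R w)) - (Df (a + s *\<^sub>R w) - Df a - B (s *\<^sub>R w))"
        by (simp add: \<Delta>_def B.add)
      then have "norm (\<Delta> s) \<le> norm (Df (a + (v + s *\<^sub>R w)) - Df a - B (v + s *\<^sub>R w)) + norm (Df (a + s *\<^sub>R w) - Df a - B (s *\<^sub>R w))"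
        by (metis norm_triangle_ineq4)
      also have "\<dots> \<le> \<epsilon> / 2 * norm (v + s *\<^sub>R w) + \<epsilon> / 2 * norm (s *\<^sub>R w)"
        using d1(2)[OF min_less_iff_conj[THEN iffD1, THEN conjunct1, OF sm1[OF s]]]
          d1(2)[OF min_less_iff_conj[THEN iffD1, THEN conjunct1, OF sm2[OF s]]] by (rule add_mono[rotated])
      also have "\<dots> \<le> \<epsilon> / 2 * (norm v + norm w) + \<epsilon> / 2 * (norm v + norm w)"
        using e vsw[OF s] sw[OF s] norm_ge_zero[of v] by (intro add_mono mult_left_mono) linarith+
      finally have D: "norm (\<Delta> s) \<le> \<epsilon> * (norm v + norm w)" by (simp add: field_simps)
      have "norm (\<Delta> s w) \<le> norm (\<Delta> s) * norm w" by (rule norm_blinfun)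
      also have "\<dots> \<le> \<epsilon> * (norm v + norm w) * (norm v + norm w)"
        using D e by (intro mult_mono) auto
      finally show "norm (r *\<^sub>R (\<Delta> s w)) \<le> \<epsilon> * (norm v + norm w)\<^sup>2 * norm r"
        using mult_left_mono[OF _ norm_ge_zero[of r]] by (simp add: power2_eq_square mult.commute[of _ "\<bar>r\<bar>"] mult.assoc)
    qed
    have "norm (\<phi> 1 - \<phi> 0) \<le> \<epsilon> * (norm v + norm w)\<^sup>2 * norm (1 - 0 :: real)"
      by (rule differentiable_bound[OF _ d on]) auto
    then show ?thesis by (simp add: \<phi>_def algebra_simps)
  qed
  then show thesis using that[of "min \<delta>1 \<delta>2"] d1 d2 by auto
qed

text \<open>The second difference is symmetric in \<open>v\<close> and \<open>w\<close> and
  approximates both \<open>B v w\<close> and \<open>B w v\<close>; scaling both vectors by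
  \<open>s\<close> and dividing by \<open>s\<^sup>2\<close> leaves an arbitrarily small gap.\<close>

lemma second_derivative_symmetric:
  fixes f :: "'a::real_normed_vector \<Rightarrow> 'b::real_normed_vector"
    and Df :: "'a \<Rightarrow> 'a \<Rightarrow>\<^sub>L 'b"
  assumes U: "open U" "a \<in> U"
    and der: "\<And>z. z \<in> U \<Longrightarrow> (f has_derivative blinfun_apply (Df z)) (at z)"
    and der2: "(Df has_derivative B) (at a)"
  shows "B v w = B w v"
proof -
  interpret B: bounded_linear B using der2 has_derivative_bounded_linear by blast
  define M where "M = (norm v + norm w)\<^sup>2"
  have "norm (B v w - B w v) \<le> 0 + \<epsilon>" if e: "\<epsilon> > 0" for \<epsilon>
  proof -
    define \<eta> where "\<eta> = \<epsilon> / (2 * (M + 1))"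
    have M0: "M \<ge> 0" by (simp add: M_def)
    have \<eta>: "\<eta> > 0" using e M0 by (simp add: \<eta>_def)
    obtain \<delta> where d: "\<delta> > 0" "\<And>v w. norm v + norm w < \<delta> \<Longrightarrow>
       norm (f (a + v + w) - f (a + v) - f (a + w) + f a - B v w) \<le> \<eta> * (norm v + norm w)\<^sup>2"
      using second_difference_bound[OF U der der2 \<eta>] by blast
    define s where "s = \<delta> / (2 * (norm v + norm w + 1))"
    have s0: "s > 0" using d(1) by (simp add: s_def add_nonneg_pos)
    have "s * (norm v + norm w) \<le> s * (norm v + norm w + 1)" using s0 by simp
    also have "s * (norm v + norm w + 1) = \<delta> / 2"
    proof -
      have "norm v + norm w + 1 > 0" by (simp add: add_nonneg_pos)
      then show ?thesis unfolding s_def by (simp add: field_simps del: distrib_left_numeral)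
    qed
    finally have sm: "norm (s *\<^sub>R v) + norm (s *\<^sub>R w) < \<delta>" using s0 d(1) by (simp add: distrib_left)
    have sq: "(norm (s *\<^sub>R v) + norm (s *\<^sub>R w))\<^sup>2 = s\<^sup>2 * M"
      using s0 by (simp add: M_def distrib_left[symmetric] power_mult_distrib)
    define \<Delta> where "\<Delta> = f (a + s *\<^sub>R v + s *\<^sub>R w) - f (a + s *\<^sub>R v) - f (a + s *\<^sub>R w) + f a"
    have 1: "norm (\<Delta> - s\<^sup>2 *\<^sub>R B v w) \<le> \<eta> * (s\<^sup>2 * M)"
      using d(2)[OF sm] sq by (simp add: \<Delta>_def B.scaleR blinfun.scaleR_left blinfun.scaleR_right power2_eq_square)
    have 2: "norm (\<Delta> - s\<^sup>2 *\<^sub>R B w v) \<le> \<eta> * (s\<^sup>2 * M)"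
    proof -
      have "norm (s *\<^sub>R w) + norm (s *\<^sub>R v) < \<delta>" using sm by simp
      from d(2)[OF this] have "norm (f (a + s *\<^sub>R w + s *\<^sub>R v) - f (a + s *\<^sub>R w) - f (a + s *\<^sub>R v) + f a - B (s *\<^sub>R w) (s *\<^sub>R v)) \<le> \<eta> * (s\<^sup>2 * M)"
        using sq by (simp add: add.commute)
      moreover have "f (a + s *\<^sub>R w + s *\<^sub>R v) - f (a + s *\<^sub>R w) - f (a + s *\<^sub>R v) + f a = \<Delta>"
        by (simp add: \<Delta>_def add_ac)
      ultimately show ?thesis
        by (simp add: B.scaleR blinfun.scaleR_left blinfun.scaleR_right power2_eq_square)
    qed
    have "s\<^sup>2 *\<^sub>R (B v w - B w v) = (\<Delta> - s\<^sup>2 *\<^sub>R B w v) - (\<Delta> - s\<^sup>2 *\<^sub>R B v w)"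
      by (simp add: algebra_simps)
    then have "norm (s\<^sup>2 *\<^sub>R (B v w - B w v)) \<le> s\<^sup>2 * (2 * \<eta> * M)"
      using norm_triangle_ineq4[of "\<Delta> - s\<^sup>2 *\<^sub>R B w v" "\<Delta> - s\<^sup>2 *\<^sub>R B v w"] 1 2 by (simp add: algebra_simps)
    then have "s\<^sup>2 * norm (B v w - B w v) \<le> s\<^sup>2 * (2 * \<eta> * M)" by simp
    then have "norm (B v w - B w v) \<le> 2 * \<eta> * M" using s0 by (simp add: mult_le_cancel_left)
    also have "2 * \<eta> * M \<le> \<epsilon>" using e M0 by (simp add: \<eta>_def field_simps)
    finally show ?thesis by simp
  qed
  then have "norm (B v w - B w v) \<le> 0" by (rule field_le_epsilon)
  then show ?thesis by simp
qed

lemma has_derivative_difference_quotient: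
  fixes f :: "'a::real_normed_vector \<Rightarrow> 'b::real_normed_vector"
  assumes der: "(f has_derivative F) (at a)"
    and t: "\<And>k. t k > 0" "t \<longlonglongrightarrow> 0" and v: "v \<longlonglongrightarrow> v0"
  shows "(\<lambda>k. (1 / t k) *\<^sub>R (f (a + t k *\<^sub>R v k) - f a)) \<longlonglongrightarrow> F v0"
proof -
  interpret F: bounded_linear F using der has_derivative_bounded_linear by blast
  have Fv: "(\<lambda>k. F (v k)) \<longlonglongrightarrow> F v0" by (rule F.tendsto[OF v])
  have tv: "(\<lambda>k. t k *\<^sub>R v k) \<longlonglongrightarrow> 0" using tendsto_scaleR[OF t(2) v] by simp
  have "(\<lambda>k. (1 / t k) *\<^sub>R (f (a + t k *\<^sub>R v k) - f a) - F (v k)) \<longlonglongrightarrow> 0"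
  proof (rule tendstoI)
    fix e :: real assume e: "e > 0"
    obtain M where M: "M > 0" "\<And>k. norm (v k) \<le> M"
      using convergent_imp_Bseq[OF convergentI[OF v]] by (auto elim: BseqE)
    have "e / (2 * M) > 0" using e M by simp
    from has_derivative_atE[OF der this] obtain \<delta> where d: "\<delta> > 0"
      "\<And>w. norm w < \<delta> \<Longrightarrow> norm (f (a + w) - f a - F w) \<le> e / (2 * M) * norm w" by blast
    have "\<forall>\<^sub>F k in sequentially. norm (t k *\<^sub>R v k) < \<delta>" using tendstoD[OF tv d(1)] by simp
    then show "\<forall>\<^sub>F k in sequentially. dist ((1 / t k) *\<^sub>R (f (a + t k *\<^sub>R v k) - f a) - F (v k)) 0 < e"
    proof (eventually_elim)
      case (elim k)
      have "(1 / t k) *\<^sub>R (f (a + t k *\<^sub>R v k) - f a) - F (v k) = (1 / t k) *\<^sub>R (f (a + t k *\<^sub>R v k) - f a - F (t k *\<^sub>R v k))"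
        using t(1)[of k] by (simp add: F.scaleR scaleR_diff_right)
      then have "norm ((1 / t k) *\<^sub>R (f (a + t k *\<^sub>R v k) - f a) - F (v k)) = norm (f (a + t k *\<^sub>R v k) - f a - F (t k *\<^sub>R v k)) / t k"
        using t(1)[of k] by simp
      also have "\<dots> \<le> e / (2 * M) * norm (t k *\<^sub>R v k) / t k"
        using d(2)[OF elim] t(1)[of k] by (intro divide_right_mono) auto
      also have "\<dots> = e / (2 * M) * norm (v k)" using t(1)[of k] by simp
      also have "\<dots> \<le> e / (2 * M) * M" using M e by (intro mult_left_mono) auto
      also have "\<dots> < e" using M e by simp
      finally show ?case by simp
    qed
  qed
  from tendsto_add[OF this Fv] show ?thesis by simp
qed

text \<open>The linear term is taken at the moving direction \<open>v k\<close>: as \<open>v\<close>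
  converges without a rate, \<open>Df a (v k - v0)\<close> divided by \<open>t k\<close> could be
  unbounded.\<close>

lemma second_order_difference_quotient:
  fixes f :: "'a::real_normed_vector \<Rightarrow> 'b::real_normed_vector"
    and Df :: "'a \<Rightarrow> 'a \<Rightarrow>\<^sub>L 'b"
  assumes U: "open U" "a \<in> U"
    and der: "\<And>z. z \<in> U \<Longrightarrow> (f has_derivative blinfun_apply (Df z)) (at z)"
    and der2: "(Df has_derivative B) (at a)"
    and t: "\<And>k. t k > 0" "t \<longlonglongrightarrow> 0" and v: "v \<longlonglongrightarrow> v0"
  shows "(\<lambda>k. (1 / (t k)\<^sup>2) *\<^sub>R (f (a + t k *\<^sub>R v k) - f a - t k *\<^sub>R Df a (v k))) \<longlonglongrightarrow> (1/2) *\<^sub>R B v0 v0"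
proof -
  interpret B: bounded_linear B using der2 has_derivative_bounded_linear by blast
  have Bv: "(\<lambda>k. (1/2) *\<^sub>R B (v k) (v k)) \<longlonglongrightarrow> (1/2) *\<^sub>R B v0 v0" 
    by (intro tendsto_intros B.tendsto v)
  have tv: "(\<lambda>k. t k *\<^sub>R v k) \<longlonglongrightarrow> 0" using tendsto_scaleR[OF t(2) v] by simp
  have "(\<lambda>k. (1 / (t k)\<^sup>2) *\<^sub>R (f (a + t k *\<^sub>R v k) - f a - t k *\<^sub>R Df a (v k)) - (1/2) *\<^sub>R B (v k) (v k)) \<longlonglongrightarrow> 0"
  proof (rule tendstoI)
    fix e :: real assume e: "e > 0"
    obtain M where M: "M > 0" "\<And>k. norm (v k) \<le> M"
      using convergent_imp_Bseq[OF convergentI[OF v]] by (auto elim: BseqE)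
    have "e / (2 * M\<^sup>2) > 0" using e M by simp
    from second_order_taylor[OF U der der2 this] obtain \<delta> where d: "\<delta> > 0"
      "\<And>w. norm w < \<delta> \<Longrightarrow> norm (f (a + w) - f a - Df a w - (1/2) *\<^sub>R B w w) \<le> e / (2 * M\<^sup>2) * (norm w)\<^sup>2" by metis
    have "\<forall>\<^sub>F k in sequentially. norm (t k *\<^sub>R v k) < \<delta>" using tendstoD[OF tv d(1)] by simp
    then show "\<forall>\<^sub>F k in sequentially. dist ((1 / (t k)\<^sup>2) *\<^sub>R (f (a + t k *\<^sub>R v k) - f a - t k *\<^sub>R Df a (v k)) - (1/2) *\<^sub>R B (v k) (v k)) 0 < e"
    proof (eventually_elim)
      case (elim k)
      define w where "w = t k *\<^sub>R v k"
      have "(1 / (t k)\<^sup>2) *\<^sub>R (f (a + t k *\<^sub>R v k) - f a - t k *\<^sub>R Df a (v k)) - (1/2) *\<^sub>R B (v k) (v k)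
          = (1 / (t k)\<^sup>2) *\<^sub>R (f (a + w) - f a - Df a w - (1/2) *\<^sub>R B w w)"
        using t(1)[of k] by (simp add: w_def B.scaleR blinfun.scaleR_left blinfun.scaleR_right scaleR_diff_right power2_eq_square)
      then have "norm ((1 / (t k)\<^sup>2) *\<^sub>R (f (a + t k *\<^sub>R v k) - f a - t k *\<^sub>R Df a (v k)) - (1/2) *\<^sub>R B (v k) (v k)) 
          = norm (f (a + w) - f a - Df a w - (1/2) *\<^sub>R B w w) / (t k)\<^sup>2"
        by simp
      also have "\<dots> \<le> e / (2 * M\<^sup>2) * (norm w)\<^sup>2 / (t k)\<^sup>2"
        using d(2)[of w] elim by (intro divide_right_mono) (auto simp: w_def)
      also have "\<dots> = e / (2 * M\<^sup>2) * (norm (v k))\<^sup>2" using t(1)[of k] by (simp add: w_def power_mult_distrib)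
      also have "\<dots> \<le> e / (2 * M\<^sup>2) * M\<^sup>2" using M e by (intro mult_left_mono power_mono) auto
      also have "\<dots> < e" using M e by simp
      finally show ?case by simp
    qed
  qed
  from tendsto_add[OF this Bv] show ?thesis by simp
qed

lemma infdist_approx:
  assumes "S \<noteq> {}" "0 < \<eta>"
  obtains a where "a \<in> S" "dist x a < infdist x S + \<eta>"
proof -
  have "\<exists>a\<in>S. dist x a < infdist x S + \<eta>"
    using assms cINF_less_iff[of S "dist x" "infdist x S + \<eta>"]
    by (auto simp: infdist_def intro: bdd_belowI2[where m=0])
  then show thesis using that by blast
qed

lemma norm_Pair0: "norm (0, u) = norm u" "norm (u, 0) = norm u" 
  by (simp_all add: norm_Pair)

section \<open>Robinson stability and submersions\<close>

text \<open>Newton's method with the derivative frozen at \<open>y0\<close>: for a right inverse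
  \<open>R\<close> of \<open>Dh y0\<close> the map \<open>T\<close> below is a contraction with
  factor 1/2, and its fixed point solves \<open>h (y + R e) = k\<close>.\<close>

lemma submersion_solve:
  fixes h :: "'y::euclidean_space \<Rightarrow> 'e::euclidean_space" and Dh :: "'y \<Rightarrow> 'y \<Rightarrow>\<^sub>L 'e"
  assumes V: "open V" "y0 \<in> V"
    and der: "\<And>y. y \<in> V \<Longrightarrow> (h has_derivative blinfun_apply (Dh y)) (at y)"
    and cont: "isCont Dh y0"
    and surj: "surj (blinfun_apply (Dh y0))"
  obtains c r where "c \<ge> 0" "r > 0"
    "\<And>y k. dist y y0 < r \<Longrightarrow> norm (h y - k) < r \<Longrightarrow> 
        \<exists>y'\<in>V. h y' = k \<and> norm (y' - y) \<le> c * norm (h y - k)"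
proof -
  obtain R where R: "linear R" "blinfun_apply (Dh y0) \<circ> R = id"
    using linear_surjective_right_inverse[OF bounded_linear.linear[OF blinfun.bounded_linear_right] surj] by blast
  have DR: "Dh y0 (R e) = e" for e using R(2) by (metis comp_apply id_apply)
  have bR: "bounded_linear R" using R(1) by (simp add: linear_conv_bounded_linear)
  obtain M where M: "M > 0" "\<And>e. norm (R e) \<le> norm e * M"
    using bounded_linear.pos_bounded[OF bR] by blast
  have "\<forall>\<^sub>F y in nhds y0. y \<in> V \<and> norm (Dh y - Dh y0) < 1 / (2 * M)"
  proof (intro eventually_conj eventually_nhds_in_open V)
    have "(Dh \<longlongrightarrow> Dh y0) (nhds y0)"
      using cont by (simp add: isCont_def tendsto_at_iff_tendsto_nhds)
    from tendstoD[OF this, of "1 / (2 * M)"] 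
    show "\<forall>\<^sub>F y in nhds y0. norm (Dh y - Dh y0) < 1 / (2 * M)" using M(1) by (simp add: dist_norm)
  qed
  then obtain s where s: "s > 0" "\<And>y. dist y y0 < s \<Longrightarrow> y \<in> V \<and> norm (Dh y - Dh y0) < 1 / (2 * M)"
    by (auto simp: eventually_nhds_metric)
  \<comment> \<open>\<open>y\<close> uses up half of the radius \<open>s\<close>. The correction
    \<open>R e\<close> with \<open>norm e \<le> 2 * \<delta>\<close> has norm at most
    \<open>2 * \<delta> * M\<close>, less than the other half when
    \<open>\<delta> < s / (4 * M)\<close>.\<close>
  define r where "r = min (s / 2) (s / (4 * M))"
  have "r > 0" using s(1) M(1) by (simp add: r_def)
  moreover have "\<exists>y'\<in>V. h y' = k \<and> norm (y' - y) \<le> 2 * M * norm (h y - k)" 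
    if y: "dist y y0 < r" and k: "norm (h y - k) < r" for y k
  proof -
    define \<delta> where "\<delta> = norm (h y - k)"
    define T where "T = (\<lambda>e. e - (h (y + R e) - k))"
    have near: "dist (y + R e) y0 < s" if "e \<in> cball 0 (2 * \<delta>)" for e
    proof -
      have "norm (R e) \<le> 2 * \<delta> * M" using M(2)[of e] that M(1) 
        by (smt (verit) mem_cball_0 mult_right_mono)
      moreover have "\<delta> < s / (4 * M)" using k by (simp add: \<delta>_def r_def)
      then have "2 * \<delta> * M < s / 2" using M(1) by (simp add: field_simps)
      moreover have "dist (y + R e) y0 \<le> dist y y0 + norm (R e)" 
        by (metis add.commute add_diff_cancel_left' dist_norm dist_triangle2 dist_commute)
      ultimately show ?thesis using y by (simp add: r_def)
    qed
    have derT: "(T has_derivative (\<lambda>d. d - Dh (y + R e) (R d))) (at e within cball 0 (2 * \<delta>))"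
      if e: "e \<in> cball 0 (2 * \<delta>)" for e
    proof -
      have "((\<lambda>e. y + R e) has_derivative R) (at e)"
        using bounded_linear_imp_has_derivative[OF bR] by (auto intro!: derivative_eq_intros)
      moreover have "(h has_derivative blinfun_apply (Dh (y + R e))) (at (y + R e))"
        using der s(2)[OF near[OF e]] by blast
      ultimately have "((\<lambda>e. h (y + R e)) has_derivative (\<lambda>d. Dh (y + R e) (R d))) (at e)"
        by (rule has_derivative_compose)
      then show ?thesis unfolding T_def 
        by (auto intro!: derivative_eq_intros intro: has_derivative_at_withinI)
    qed
    have onT: "onorm (\<lambda>d. d - Dh (y + R e) (R d)) \<le> 1 / 2" if e: "e \<in> cball 0 (2 * \<delta>)" for e
    proof (rule onorm_le)
      fix d
      have "d - Dh (y + R e) (R d) = - (Dh (y + R e) - Dh y0) (R d)"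
        by (simp add: blinfun.diff_left DR)
      then have "norm (d - Dh (y + R e) (R d)) \<le> norm (Dh (y + R e) - Dh y0) * norm (R d)"
        by (metis norm_blinfun norm_minus_cancel)
      also have "\<dots> \<le> (1 / (2 * M)) * (norm d * M)"
        using s(2)[OF near[OF e]] M by (intro mult_mono) auto
      finally show "norm (d - Dh (y + R e) (R d)) \<le> 1 / 2 * norm d" using M(1) by simp
    qed
    have lip: "norm (T a - T b) \<le> 1 / 2 * norm (a - b)" 
      if "a \<in> cball 0 (2 * \<delta>)" "b \<in> cball 0 (2 * \<delta>)" for a b
      using differentiable_bound[OF convex_cball derT onT that] .
    have "\<delta> \<ge> 0" by (simp add: \<delta>_def)
    have R0: "R 0 = 0" using linear_0[OF R(1)] .
    have maps: "T ` cball 0 (2 * \<delta>) \<subseteq> cball 0 (2 * \<delta>)"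
    proof clarify
      fix e :: 'e assume e: "e \<in> cball 0 (2 * \<delta>)"
      have "norm (T e - T 0) \<le> 1 / 2 * norm (e - 0)" using lip[OF e, of 0] \<open>\<delta> \<ge> 0\<close> by simp
      moreover have "norm (T 0) = \<delta>" by (simp add: T_def R0 \<delta>_def norm_minus_commute)
      moreover have "norm (T e) \<le> norm (T e - T 0) + norm (T 0)"
        by (metis diff_add_cancel norm_triangle_ineq)
      ultimately show "T e \<in> cball 0 (2 * \<delta>)" using e by simp
    qed
    have "\<exists>!e\<in>cball 0 (2 * \<delta>). T e = e"
    proof (rule Banach_fix[where c="1/2"])
      show "cball (0::'e) (2 * \<delta>) \<noteq> {}" using \<open>\<delta> \<ge> 0\<close> by simp
    qed (use maps lip in \<open>auto simp: dist_norm complete_eq_closed\<close>)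
    then obtain e where e: "e \<in> cball 0 (2 * \<delta>)" "T e = e" by blast
    have "h (y + R e) = k" using e(2) by (simp add: T_def)
    moreover have "y + R e \<in> V" using s(2)[OF near[OF e(1)]] by blast
    moreover have "norm (y + R e - y) \<le> 2 * M * norm (h y - k)"
      using order_trans[OF M(2)[of e] mult_right_mono[of "norm e" "2 * \<delta>" M]] e(1) M(1)
      by (simp add: \<delta>_def mult_ac)
    ultimately show ?thesis by blast
  qed
  ultimately show thesis using M(1) by (intro that[of "2 * M" r]) auto
qed

text \<open>A point of \<open>B\<close> makes the right-hand side finite, so \<open>A\<close> cannot
  be empty, where \<open>edist_set\<close> is \<infinity>. Nonemptiness has to be recorded here
  because \<open>infdist\<close> to the empty set is 0.\<close>

lemma edist_set_le_ereal_mult: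
  assumes le: "edist_set x A \<le> ereal \<kappa> * edist_set y B" and B: "b \<in> B" and k: "0 \<le> \<kappa>"
  shows "A \<noteq> {} \<and> infdist x A \<le> \<kappa> * dist y b"
proof -
  have "B \<noteq> {}" using B by auto
  then have *: "edist_set x A \<le> ereal (\<kappa> * infdist y B)" using le by (simp add: edist_set_def)
  then have A: "A \<noteq> {}" by (auto simp: edist_set_def)
  moreover have "infdist x A \<le> \<kappa> * infdist y B" using * A by (simp add: edist_set_def)
  moreover have "\<kappa> * infdist y B \<le> \<kappa> * dist y b"
    using infdist_le[OF B] k by (intro mult_left_mono) auto
  ultimately show ?thesis by linarith
qed

text \<open>Since \<open>h\<close> is a submersion, each \<open>k \<in> K\<close> near
  \<open>h (g z)\<close> lifts to a point of \<open>C\<close> at comparable distance from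
  \<open>g z\<close>; stability with respect to \<open>C\<close> becomes stability with respect to
  \<open>K\<close>.\<close>

lemma robinson_stable_reduced:
  fixes g :: "'p::euclidean_space \<times> 'x::euclidean_space \<Rightarrow> 'y::euclidean_space"
    and h :: "'y \<Rightarrow> 'e::euclidean_space" and Dh :: "'y \<Rightarrow> 'y \<Rightarrow>\<^sub>L 'e"
  assumes RS: "robinson_stable g C pb xb"
    and contg: "isCont g (pb, xb)"
    and V: "open V" "g (pb, xb) \<in> V"
    and der: "\<And>y. y \<in> V \<Longrightarrow> (h has_derivative blinfun_apply (Dh y)) (at y)"
    and cont: "isCont Dh (g (pb, xb))"
    and surj: "surj (blinfun_apply (Dh (g (pb, xb))))"
    and h0: "h (g (pb, xb)) = 0" and K0: "0 \<in> K"
    and CV: "C \<inter> V = {y \<in> V. h y \<in> K}"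
  obtains \<kappa> W where "\<kappa> \<ge> 0" "open W" "(pb, xb) \<in> W" "g ` W \<subseteq> V"
    "\<And>z k. z \<in> W \<Longrightarrow> k \<in> K \<Longrightarrow> Gamma g C (fst z) \<noteq> {} \<and> 
        infdist (snd z) (Gamma g C (fst z)) \<le> \<kappa> * norm (h (g z) - k)"
proof -
  define y0 where "y0 = g (pb, xb)"
  obtain c r where cr: "c \<ge> 0" "r > 0"
    "\<And>y k. dist y y0 < r \<Longrightarrow> norm (h y - k) < r \<Longrightarrow> 
        \<exists>y'\<in>V. h y' = k \<and> norm (y' - y) \<le> c * norm (h y - k)"
    using submersion_solve[OF V der cont surj] unfolding y0_def by metis
  obtain \<kappa> Wp Ux where RS': "\<kappa> \<ge> 0" "open Wp" "pb \<in> Wp" "open Ux" "xb \<in> Ux"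
    "\<And>p x. p \<in> Wp \<Longrightarrow> x \<in> Ux \<Longrightarrow> edist_set x (Gamma g C p) \<le> ereal \<kappa> * edist_set (g (p, x)) C"
    using RS unfolding robinson_stable_def by blast
  have tg: "(g \<longlongrightarrow> y0) (nhds (pb, xb))"
    using contg by (simp add: isCont_def tendsto_at_iff_tendsto_nhds y0_def)
  have conth: "isCont h y0" using der[OF V(2)] has_derivative_continuous y0_def by blast
  have th: "((\<lambda>z. h (g z)) \<longlongrightarrow> 0) (nhds (pb, xb))"
    using isCont_tendsto_compose[OF conth tg] h0 y0_def by simp
  have "\<forall>\<^sub>F z in nhds (pb, xb). z \<in> Wp \<times> Ux \<and> g z \<in> V \<and> dist (g z) y0 < r \<and> norm (h (g z)) < r"
  proof (intro eventually_conj)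
    show "\<forall>\<^sub>F z in nhds (pb, xb). z \<in> Wp \<times> Ux"
      using RS' by (intro eventually_nhds_in_open open_Times) auto
    show "\<forall>\<^sub>F z in nhds (pb, xb). g z \<in> V"
      using topological_tendstoD[OF tg V(1)] V(2) y0_def by blast
    show "\<forall>\<^sub>F z in nhds (pb, xb). dist (g z) y0 < r"
      using tendstoD[OF tg cr(2)] .
    show "\<forall>\<^sub>F z in nhds (pb, xb). norm (h (g z)) < r"
      using tendstoD[OF th cr(2)] by simp
  qed
  then obtain W where W: "open W" "(pb, xb) \<in> W" 
     "\<And>z. z \<in> W \<Longrightarrow> z \<in> Wp \<times> Ux \<and> g z \<in> V \<and> dist (g z) y0 < r \<and> norm (h (g z)) < r"
    unfolding eventually_nhds by blast
  show thesis
  proof (rule that[of "\<kappa> * c" W])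
    fix z k assume z: "z \<in> W" and k: "k \<in> K"
    have "\<exists>y'\<in>C. norm (y' - g z) \<le> c * norm (h (g z) - k)"
    proof (cases "norm (h (g z) - k) < r")
      case True
      then obtain y' where "y' \<in> V" "h y' = k" "norm (y' - g z) \<le> c * norm (h (g z) - k)"
        using cr(3) W(3)[OF z] by blast
      then show ?thesis using CV k by blast
    next
      case False
      \<comment> \<open>For \<open>k\<close> far from \<open>h (g z)\<close> the point
        \<open>0 \<in> K\<close> does better:
        \<open>norm (h (g z)) < r \<le> norm (h (g z) - k)\<close>.\<close>
      obtain y' where y': "y' \<in> V" "h y' = 0" "norm (y' - g z) \<le> c * norm (h (g z) - 0)"
        using cr(3)[of "g z" 0] W(3)[OF z] by auto
      have "c * norm (h (g z) - 0) \<le> c * norm (h (g z) - k)"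
        using False W(3)[OF z] cr(1) by (intro mult_left_mono) auto
      then show ?thesis using y' CV K0 by force
    qed
    then obtain y' where y': "y' \<in> C" "norm (y' - g z) \<le> c * norm (h (g z) - k)" by blast
    have "edist_set (snd z) (Gamma g C (fst z)) \<le> ereal \<kappa> * edist_set (g z) C"
      using RS'(6)[of "fst z" "snd z"] W(3)[OF z] by auto
    from edist_set_le_ereal_mult[OF this y'(1) RS'(1)]
    have "Gamma g C (fst z) \<noteq> {}" "infdist (snd z) (Gamma g C (fst z)) \<le> \<kappa> * dist (g z) y'" by auto
    moreover have "\<kappa> * dist (g z) y' \<le> \<kappa> * (c * norm (h (g z) - k))"
      using y'(2) RS'(1) by (intro mult_left_mono) (auto simp: dist_norm norm_minus_commute)
    ultimately show "Gamma g C (fst z) \<noteq> {} \<and> 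
        infdist (snd z) (Gamma g C (fst z)) \<le> \<kappa> * c * norm (h (g z) - k)"
      by (simp add: mult.assoc)
  qed (use RS'(1) cr(1) W in auto)
qed

section \<open>Bounded multipliers for the reduced system\<close>

locale reduced_system =
  fixes G :: "'p::euclidean_space \<times> 'x::euclidean_space \<Rightarrow> 'e::euclidean_space"
    and DG :: "'p \<times> 'x \<Rightarrow> ('p \<times> 'x) \<Rightarrow>\<^sub>L 'e"
    and B :: "'p \<times> 'x \<Rightarrow> ('p \<times> 'x) \<Rightarrow>\<^sub>L 'e"
    and U :: "('p \<times> 'x) set" and K :: "'e set" and zb :: "'p \<times> 'x"
    and \<Gamma> :: "'p \<Rightarrow> 'x set" and \<kappa> :: real
  assumes open_U: "open U" and zb_U: "zb \<in> U"
    and derG: "\<And>z. z \<in> U \<Longrightarrow> (G has_derivative blinfun_apply (DG z)) (at z)"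
    and derDG: "(DG has_derivative B) (at zb)"
    and G_zb: "G zb = 0"
    and closed_K: "closed K" and cone_K: "convex_cone K"
    and feasible_iff: "\<And>z. z \<in> U \<Longrightarrow> snd z \<in> \<Gamma> (fst z) \<longleftrightarrow> G z \<in> K"
    and kappa_nonneg: "0 \<le> \<kappa>"
    and robinson_nonempty: "\<And>z. z \<in> U \<Longrightarrow> \<Gamma> (fst z) \<noteq> {}"
    and robinson: "\<And>z k. z \<in> U \<Longrightarrow> k \<in> K \<Longrightarrow> infdist (snd z) (\<Gamma> (fst z)) \<le> \<kappa> * norm (G z - k)"
begin

text \<open>Step from \<open>z\<close> by \<open>s\<close> in direction \<open>u\<close>. By
  convexity \<open>G z + s *\<^sub>R d\<close> stays in \<open>K\<close> once
  \<open>s * c \<le> 1\<close>, so Robinson stability supplies a feasible point within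
  \<open>s * \<kappa> * norm (e - d)\<close>, up to \<open>O(s \<epsilon>)\<close>, of the moved
  point. Normality handles the feasible step, Cauchy-Schwarz the rest.\<close>

lemma normal_le_robinson:
  assumes z: "z \<in> U" and xs: "xs \<in> reg_normal_cone (\<Gamma> (fst z)) (snd z)"
    and k: "k \<in> K" and c: "0 \<le> c"
  shows "xs \<bullet> u \<le> (\<kappa> * norm xs) * norm (DG z (0, u) - (k - c *\<^sub>R G z))"
proof -
  define e where "e = DG z (0, u)"
  define d where "d = k - c *\<^sub>R G z"
  \<comment> \<open>\<open>s * R\<close> will bound the length of the feasible step, and
    \<open>M\<close> collects the coefficients of \<open>\<epsilon>\<close>.\<close>
  define R where "R = norm u + \<kappa> * norm (e - d) + \<kappa> + 1"
  define M where "M = norm xs * (\<kappa> + 1) + R"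
  have R: "R \<ge> norm u" "R > 0" "R \<ge> 0"
    using kappa_nonneg by (auto simp: R_def add_nonneg_pos)
  have M: "M > 0" using kappa_nonneg R by (simp add: M_def add_nonneg_pos)
  have x: "snd z \<in> \<Gamma> (fst z)" using xs by (simp add: reg_normal_cone_def)
  have GzK: "G z \<in> K" using feasible_iff[OF z] x by simp
  have bound: "xs \<bullet> u \<le> \<kappa> * norm xs * norm (e - d) + \<epsilon> * M" if eps: "0 < \<epsilon>" "\<epsilon> < 1" for \<epsilon>
  proof -
    obtain \<delta>1 where d1: "\<delta>1 > 0" "\<And>y. y \<in> \<Gamma> (fst z) \<Longrightarrow> norm (y - snd z) < \<delta>1 \<Longrightarrow> xs \<bullet> (y - snd z) \<le> \<epsilon> * norm (y - snd z)"
      using xs eps unfolding reg_normal_cone_def by blast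
    have "\<epsilon> / R > 0" using eps R by simp
    from has_derivative_atE[OF derG[OF z] this] obtain \<delta>2 where d2: "\<delta>2 > 0"
      "\<And>w. norm w < \<delta>2 \<Longrightarrow> norm (G (z + w) - G z - DG z w) \<le> \<epsilon> / R * norm w" by blast
    obtain \<delta>3 where d3: "\<delta>3 > 0" "ball z \<delta>3 \<subseteq> U" using open_U z open_contains_ball by blast
    define \<delta> where "\<delta> = min \<delta>1 (min \<delta>2 \<delta>3)"
    have \<delta>: "\<delta> > 0" using d1 d2 d3 by (simp add: \<delta>_def)
    define s where "s = min (1 / (c + 1)) (\<delta> / (2 * R))"
    have s0: "s > 0" using c \<delta> R by (simp add: s_def)
    have sc: "s * c \<le> 1"
    proof -
      have "s * c \<le> 1 / (c + 1) * c" using c by (intro mult_right_mono) (auto simp: s_def)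
      also have "\<dots> \<le> 1" using c by simp
      finally show ?thesis .
    qed
    have sR: "s * R < \<delta>"
    proof -
      have "s * R \<le> \<delta> / (2 * R) * R" using R by (intro mult_right_mono) (auto simp: s_def)
      also have "\<dots> < \<delta>" using R \<delta> by simp
      finally show ?thesis .
    qed
    have su: "s * norm u \<le> s * R" using s0 R by simp
    define w where "w = (0::'p, s *\<^sub>R u)"
    have nw: "norm w = s * norm u" using s0 by (simp add: w_def norm_Pair0)
    have zwU: "z + w \<in> U" using d3 nw su sR by (auto simp: dist_norm \<delta>_def)
    have kK: "G z + s *\<^sub>R d \<in> K"
    proof -
      have "G z + s *\<^sub>R d = (1 - s * c) *\<^sub>R G z + s *\<^sub>R k" by (simp add: d_def algebra_simps)
      also have "\<dots> \<in> K" using sc s0 k GzK by (intro convex_cone_add[OF cone_K] convex_cone_scaleR[OF cone_K]) auto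
      finally show ?thesis .
    qed
    have "norm (G (z + w) - G z - DG z w) \<le> \<epsilon> / R * norm w"
      using d2(2)[of w] nw su sR by (simp add: \<delta>_def)
    also have "\<dots> \<le> \<epsilon> / R * (s * R)" using su eps R nw by (intro mult_left_mono) auto
    finally have T: "norm (G (z + w) - G z - DG z w) \<le> \<epsilon> * s" using R by simp
    have DGw: "DG z w = s *\<^sub>R e" unfolding w_def e_def 
      using blinfun.scaleR_right[of "DG z" s "(0, u)"] by simp
    have n0: "norm (G (z + w) - (G z + s *\<^sub>R d)) \<le> norm (G (z + w) - G z - DG z w) + norm (s *\<^sub>R (e - d))"
      using norm_triangle_ineq[of "G (z + w) - G z - DG z w" "s *\<^sub>R (e - d)"] by (simp add: DGw algebra_simps)
    have n1: "norm (G (z + w) - (G z + s *\<^sub>R d)) \<le> s * (\<epsilon> + norm (e - d))"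
    proof -
      have "norm (s *\<^sub>R (e - d)) = s * norm (e - d)" using s0 by simp
      moreover have "s * (\<epsilon> + norm (e - d)) = \<epsilon> * s + s * norm (e - d)" by (simp add: algebra_simps)
      ultimately show ?thesis using T n0 by linarith
    qed
    have "infdist (snd (z + w)) (\<Gamma> (fst (z + w))) \<le> \<kappa> * (s * (\<epsilon> + norm (e - d)))"
      using robinson[OF zwU kK] n1 kappa_nonneg by (meson mult_left_mono order_trans)
    moreover obtain y where y: "y \<in> \<Gamma> (fst (z + w))" "dist (snd (z + w)) y < infdist (snd (z + w)) (\<Gamma> (fst (z + w))) + \<epsilon> * s"
      using infdist_approx[OF robinson_nonempty[OF zwU]] eps s0 by (metis mult_pos_pos)
    ultimately have yd: "norm (snd z + s *\<^sub>R u - y) \<le> s * (\<kappa> * norm (e - d) + \<epsilon> * (\<kappa> + 1))"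
      by (simp add: w_def dist_norm algebra_simps)
    have yG: "y \<in> \<Gamma> (fst z)" using y by (simp add: w_def)
    have "norm (y - snd z) \<le> norm (snd z + s *\<^sub>R u - y) + norm (s *\<^sub>R u)"
      using norm_triangle_ineq4[of "s *\<^sub>R u" "snd z + s *\<^sub>R u - y"] by (simp add: algebra_simps)
    also have "\<dots> \<le> s * (\<kappa> * norm (e - d) + \<epsilon> * (\<kappa> + 1)) + s * norm u" using yd s0 by simp
    also have "\<dots> \<le> s * R"
    proof -
      have "\<epsilon> * (\<kappa> + 1) \<le> 1 * (\<kappa> + 1)" using eps kappa_nonneg by (intro mult_right_mono) auto
      then show ?thesis using s0 by (simp add: R_def distrib_left[symmetric])
    qed
    finally have yz: "norm (y - snd z) \<le> s * R" .
    then have n2: "xs \<bullet> (y - snd z) \<le> \<epsilon> * (s * R)"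
      using d1(2)[OF yG] sR eps by (smt (verit) \<delta>_def mult_left_mono)
    have "s * (xs \<bullet> u) = xs \<bullet> (snd z + s *\<^sub>R u - y) + xs \<bullet> (y - snd z)"
      by (simp add: inner_add_right inner_diff_right)
    also have "\<dots> \<le> norm xs * (s * (\<kappa> * norm (e - d) + \<epsilon> * (\<kappa> + 1))) + \<epsilon> * (s * R)"
      using norm_cauchy_schwarz[of xs "snd z + s *\<^sub>R u - y"] mult_left_mono[OF yd norm_ge_zero[of xs]] n2
      by linarith
    also have "\<dots> = s * (\<kappa> * norm xs * norm (e - d) + \<epsilon> * M)" by (simp add: M_def algebra_simps)
    finally show ?thesis using s0 by simp
  qed
  have "xs \<bullet> u \<le> \<kappa> * norm xs * norm (e - d)"
  proof (rule field_le_epsilon)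
    fix \<epsilon> :: real assume "\<epsilon> > 0"
    define \<eta> where "\<eta> = min (1/2) (\<epsilon> / M)"
    have "0 < \<eta>" "\<eta> < 1" using \<open>\<epsilon> > 0\<close> M by (auto simp: \<eta>_def)
    from bound[OF this] have "xs \<bullet> u \<le> \<kappa> * norm xs * norm (e - d) + \<eta> * M" .
    moreover have "\<eta> * M \<le> \<epsilon> / M * M" using M by (intro mult_right_mono) (auto simp: \<eta>_def)
    ultimately show "xs \<bullet> u \<le> \<kappa> * norm xs * norm (e - d) + \<epsilon>" using M by simp
  qed
  then show ?thesis by (simp add: e_def d_def)
qed

end

lemma adjoint_blinfun_inner:
  fixes T :: "'a::euclidean_space \<Rightarrow>\<^sub>L 'b::euclidean_space"
  shows "adjoint (blinfun_apply T) m \<bullet> x = m \<bullet> T x"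
  by (simp add: adjoint_clauses bounded_linear.linear blinfun.bounded_linear_right)

lemma linear_adjoint_blinfun:
  fixes T :: "'a::euclidean_space \<Rightarrow>\<^sub>L 'b::euclidean_space"
  shows "linear (adjoint (blinfun_apply T))"
  by (simp add: adjoint_linear bounded_linear.linear blinfun.bounded_linear_right)

lemma tendsto_adjoint_blinfun:
  fixes T :: "nat \<Rightarrow> 'a::euclidean_space \<Rightarrow>\<^sub>L 'b::euclidean_space"
  assumes "T \<longlonglongrightarrow> T0" "m \<longlonglongrightarrow> m0"
  shows "(\<lambda>k. adjoint (blinfun_apply (T k)) (m k)) \<longlonglongrightarrow> adjoint (blinfun_apply T0) m0"
  by (subst tendsto_componentwise_iff) (auto simp: adjoint_blinfun_inner intro!: tendsto_intros assms)

lemma snd_adjoint_inner: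
  fixes T :: "('p::euclidean_space \<times> 'x::euclidean_space) \<Rightarrow>\<^sub>L 'e::euclidean_space"
  shows "snd (adjoint (blinfun_apply T) m) \<bullet> u = m \<bullet> T (0, u)"
  using adjoint_blinfun_inner[of T m "(0, u)"] by (simp add: inner_prod_def)

context reduced_system
begin

abbreviation A where "A \<equiv> DG zb"
abbreviation Ad where "Ad \<equiv> adjoint (blinfun_apply A)"

text \<open>Duality is applied to the cone \<open>D\<close> generated by \<open>K\<close> and
  \<open>- G z\<close>: being polar to \<open>- G z\<close> and also to \<open>G z \<in> K\<close>
  forces the complementarity.\<close>

lemma normal_multiplier:
  assumes z: "z \<in> U" and xs: "xs \<in> reg_normal_cone (\<Gamma> (fst z)) (snd z)"
  obtains m where "m \<in> polar_cone K" "m \<bullet> G z = 0" "norm m \<le> \<kappa> * norm xs"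
    "snd (adjoint (blinfun_apply (DG z)) m) = xs"
proof -
  define D where "D = {k - c *\<^sub>R G z | k c. k \<in> K \<and> 0 \<le> c}"
  define f where "f = (\<lambda>u. DG z (0, u))"
  have "bounded_linear (\<lambda>u::'x. (0::'p, u))"
    by (intro bounded_linear_Pair bounded_linear_zero bounded_linear_ident)
  from bounded_linear_compose[OF blinfun.bounded_linear_right[of "DG z"] this]
  have lin: "linear f" unfolding f_def by (rule bounded_linear.linear)
  have K0: "0 \<in> K" using convex_cone_contains_0[OF cone_K] .
  have D: "convex_cone D"
    unfolding convex_cone_iff
  proof (intro conjI ballI allI impI)
    show "0 \<in> D" unfolding D_def using K0 by force
  next
    fix x y assume "x \<in> D" "y \<in> D"
    then obtain k c k' c' where "x = k - c *\<^sub>R G z" "y = k' - c' *\<^sub>R G z" "k \<in> K" "k' \<in> K" "0 \<le> c" "0 \<le> c'"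
      by (auto simp: D_def)
    then have "x + y = (k + k') - (c + c') *\<^sub>R G z \<and> k + k' \<in> K \<and> 0 \<le> c + c'"
      using convex_cone_add[OF cone_K] by (auto simp: algebra_simps)
    then show "x + y \<in> D" unfolding D_def by blast
  next
    fix x and a :: real assume "x \<in> D" "0 \<le> a"
    then obtain k c where "x = k - c *\<^sub>R G z" "k \<in> K" "0 \<le> c"
      by (auto simp: D_def)
    then have "a *\<^sub>R x = a *\<^sub>R k - (a * c) *\<^sub>R G z \<and> a *\<^sub>R k \<in> K \<and> 0 \<le> a * c"
      using convex_cone_scaleR[OF cone_K] \<open>0 \<le> a\<close> by (auto simp: algebra_simps)
    then show "a *\<^sub>R x \<in> D" unfolding D_def by blast
  qed
  have le: "xs \<bullet> u \<le> (\<kappa> * norm xs) * norm (f u - d)" if "d \<in> D" for u d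
    using that normal_le_robinson[OF z xs] by (auto simp: D_def f_def)
  obtain m where m: "m \<in> polar_cone D" "norm m \<le> \<kappa> * norm xs" "adjoint f m = xs"
    using bounded_multiplier_exists[OF lin D _ le] kappa_nonneg by (metis mult_nonneg_nonneg norm_ge_zero)
  have "k \<in> D" if "k \<in> K" for k
    using that unfolding D_def by (intro CollectI exI[of _ k] exI[of _ 0]) auto
  then have mK: "m \<in> polar_cone K" using m(1) by (auto simp: polar_cone_def)
  have GzK: "G z \<in> K" using feasible_iff[OF z] xs by (simp add: reg_normal_cone_def)
  have "- G z \<in> D" unfolding D_def using K0 by (intro CollectI exI[of _ 0] exI[of _ 1]) auto
  then have "m \<bullet> G z = 0"
    using polar_coneD[OF m(1)] polar_coneD[OF mK GzK] by force
  moreover have "snd (adjoint (blinfun_apply (DG z)) m) = xs"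
  proof -
    have "snd (adjoint (blinfun_apply (DG z)) m) \<bullet> u = adjoint f m \<bullet> u" for u
      unfolding snd_adjoint_inner adjoint_clauses(2)[OF lin] by (simp add: f_def)
    then show ?thesis using m(3) vector_eq_rdot by blast
  qed
  ultimately show thesis using that mK m(2) by blast
qed

end

section \<open>Limits of multipliers along a sequence tangent to the normal graph\<close>

locale critical_sequence = reduced_system +
  fixes xbs us0 :: 'b and v0 :: "'a \<times> 'b" and t :: "nat \<Rightarrow> real"
    and v :: "nat \<Rightarrow> 'a \<times> 'b" and us :: "nat \<Rightarrow> 'b" and m :: "nat \<Rightarrow> 'c" and \<mu> :: 'c
  assumes t_pos: "\<And>k. t k > 0" and t_lim: "t \<longlonglongrightarrow> 0" and v_lim: "v \<longlonglongrightarrow> v0" and us_lim: "us \<longlonglongrightarrow> us0"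
    and zU: "\<And>k. zb + t k *\<^sub>R v k \<in> U" and zK: "\<And>k. G (zb + t k *\<^sub>R v k) \<in> K"
    and m_polar: "\<And>k. m k \<in> polar_cone K" and m_compl: "\<And>k. m k \<bullet> G (zb + t k *\<^sub>R v k) = 0"
    and m_normal: "\<And>k. snd (adjoint (blinfun_apply (DG (zb + t k *\<^sub>R v k))) (m k)) = xbs + t k *\<^sub>R us k"
    and m_lim: "m \<longlonglongrightarrow> \<mu>"
begin

lemma G_quotient: "(\<lambda>k. (1 / t k) *\<^sub>R G (zb + t k *\<^sub>R v k)) \<longlonglongrightarrow> A v0"
  using has_derivative_difference_quotient[OF derG[OF zb_U] t_pos t_lim v_lim] by (simp add: G_zb)

lemma A_v0: "A v0 \<in> K"
proof (rule closed_sequentially[OF closed_K _ G_quotient])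
  show "(1 / t k) *\<^sub>R G (zb + t k *\<^sub>R v k) \<in> K" for k
    using t_pos[of k] zK by (intro convex_cone_scaleR[OF cone_K]) auto
qed

lemma mu_polar: "\<mu> \<in> polar_cone K"
  using closed_sequentially[OF closed_polar m_polar m_lim] .

lemma mu_v0: "\<mu> \<bullet> A v0 = 0"
proof -
  have "(\<lambda>k. m k \<bullet> ((1 / t k) *\<^sub>R G (zb + t k *\<^sub>R v k))) \<longlonglongrightarrow> \<mu> \<bullet> A v0"
    by (intro tendsto_intros m_lim G_quotient)
  then show ?thesis using m_compl by (simp add: LIMSEQ_const_iff)
qed

lemma DG_quotient: "(\<lambda>k. (1 / t k) *\<^sub>R (DG (zb + t k *\<^sub>R v k) - A)) \<longlonglongrightarrow> B v0"
  using has_derivative_difference_quotient[OF derDG t_pos t_lim v_lim] .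

text \<open>Although \<open>m\<close> converges without a rate, the x-part of
  \<open>Ad (m k)\<close> approaches \<open>xbs\<close> at rate \<open>t k\<close>: the equation
  defining \<open>m k\<close> is exact at the moved point, and replacing the derivative there by
  \<open>A\<close> costs \<open>t k *\<^sub>R B v0\<close> to first order.\<close>

lemma adjoint_quotient:
  "(\<lambda>k. (1 / t k) *\<^sub>R (xbs - snd (Ad (m k)))) \<longlonglongrightarrow> snd (adjoint (blinfun_apply (B v0)) \<mu>) - us0"
proof -
  have eq: "(1 / t k) *\<^sub>R (xbs - snd (Ad (m k))) 
     = snd (adjoint (blinfun_apply ((1 / t k) *\<^sub>R (DG (zb + t k *\<^sub>R v k) - A))) (m k)) - us k" for k
  proof -
    have "((1 / t k) *\<^sub>R (xbs - snd (Ad (m k)))) \<bullet> u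
       = (snd (adjoint (blinfun_apply ((1 / t k) *\<^sub>R (DG (zb + t k *\<^sub>R v k) - A))) (m k)) - us k) \<bullet> u" for u
    proof -
      have "m k \<bullet> DG (zb + t k *\<^sub>R v k) (0, u) = xbs \<bullet> u + t k * (us k \<bullet> u)"
        using snd_adjoint_inner[of "DG (zb + t k *\<^sub>R v k)" "m k" u] m_normal[of k] by (simp add: inner_add_left)
      then show ?thesis
        using t_pos[of k] by (simp add: snd_adjoint_inner inner_diff_left inner_diff_right blinfun.diff_left blinfun.scaleR_left field_simps)
    qed
    then show ?thesis using vector_eq_rdot by blast
  qed
  show ?thesis unfolding eq
    by (intro tendsto_intros tendsto_adjoint_blinfun DG_quotient m_lim us_lim)
qed

lemma snd_Ad_mu: "snd (Ad \<mu>) = xbs"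
proof -
  have "(\<lambda>k. t k *\<^sub>R ((1 / t k) *\<^sub>R (xbs - snd (Ad (m k))))) \<longlonglongrightarrow> 0 *\<^sub>R (snd (adjoint (blinfun_apply (B v0)) \<mu>) - us0)"
    by (intro tendsto_intros adjoint_quotient t_lim)
  moreover have "t k *\<^sub>R ((1 / t k) *\<^sub>R (xbs - snd (Ad (m k)))) = xbs - snd (Ad (m k))" for k
    using t_pos[of k] by simp
  ultimately have "(\<lambda>k. xbs - snd (Ad (m k))) \<longlonglongrightarrow> 0" by simp
  moreover have "(\<lambda>k. xbs - snd (Ad (m k))) \<longlonglongrightarrow> xbs - snd (Ad \<mu>)"
    by (intro tendsto_intros tendsto_adjoint_blinfun m_lim)
  ultimately show ?thesis using LIMSEQ_unique by fastforce
qed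

lemma G_second_order:
  "(\<lambda>k. (1 / (t k)\<^sup>2) *\<^sub>R (G (zb + t k *\<^sub>R v k) - t k *\<^sub>R A (v k))) \<longlonglongrightarrow> (1/2) *\<^sub>R B v0 v0"
  using second_order_difference_quotient[OF open_U zb_U derG derDG t_pos t_lim v_lim] by (simp add: G_zb)

text \<open>The expansion of \<open>n k \<bullet> G\<close> is divided by
  \<open>(t k)\<^sup>2\<close>; the first-order part keeps its own limit \<open>c\<close>. Used with
  the moving \<open>m' - m k\<close> and, in the polyhedral case, with the constant
  \<open>m' - \<mu>\<close>.\<close>

lemma second_order_le:
  assumes n_lim: "n \<longlonglongrightarrow> \<nu>" and le: "\<And>k. n k \<bullet> G (zb + t k *\<^sub>R v k) \<le> 0"
    and c: "(\<lambda>k. (1 / t k) * (n k \<bullet> A (v k))) \<longlonglongrightarrow> c"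
  shows "c + (1/2) * (\<nu> \<bullet> B v0 v0) \<le> 0"
proof -
  have "(\<lambda>k. (1 / t k) * (n k \<bullet> A (v k)) + n k \<bullet> ((1 / (t k)\<^sup>2) *\<^sub>R (G (zb + t k *\<^sub>R v k) - t k *\<^sub>R A (v k))))
     \<longlonglongrightarrow> c + \<nu> \<bullet> ((1/2) *\<^sub>R B v0 v0)"
    by (intro tendsto_add c tendsto_inner n_lim G_second_order)
  moreover have "(1 / t k) * (n k \<bullet> A (v k)) + n k \<bullet> ((1 / (t k)\<^sup>2) *\<^sub>R (G (zb + t k *\<^sub>R v k) - t k *\<^sub>R A (v k)))
     = (1 / (t k)\<^sup>2) * (n k \<bullet> G (zb + t k *\<^sub>R v k))" for k
    using t_pos[of k] by (simp add: inner_diff_right field_simps power2_eq_square)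
  moreover have "(1 / (t k)\<^sup>2) * (n k \<bullet> G (zb + t k *\<^sub>R v k)) \<le> 0" for k
    using le[of k] by (simp add: divide_nonpos_nonneg)
  ultimately show ?thesis using LIMSEQ_le_const2[of _ "c + \<nu> \<bullet> ((1/2) *\<^sub>R B v0 v0)" 0] by auto
qed

text \<open>\<open>L\<close> lifts the rate \<open>t k\<close> from the x-part of
  \<open>Ad (m k)\<close> to the whole image, so the quotients of \<open>Ad (m' - m k)\<close> by
  \<open>t k\<close> converge; the negative of their limit is the required \<open>w\<close>.\<close>

lemma limit_conditions_full:
  assumes L: "bounded_linear L" "\<And>m. m \<in> polar_cone K \<Longrightarrow> Ad m = L (snd (Ad m))"
  shows "\<And>m' c. m' \<in> polar_cone K \<Longrightarrow> snd (Ad m') = xbs \<Longrightarrow> 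
      (\<lambda>k. (1 / t k) * ((m' - \<mu>) \<bullet> A (v k))) \<longlonglongrightarrow> c \<Longrightarrow> c + (1/2) * ((m' - \<mu>) \<bullet> B v0 v0) \<le> 0"
    and "\<exists>w. snd w = us0 - snd (adjoint (blinfun_apply (B v0)) \<mu>) \<and> w \<bullet> v0 = 0 \<and> 
        (\<forall>y. A y \<in> K \<longrightarrow> \<mu> \<bullet> A y = 0 \<longrightarrow> w \<bullet> y \<le> 0)"
proof -
  interpret L: bounded_linear L by fact
  define \<eta> where "\<eta> = snd (adjoint (blinfun_apply (B v0)) \<mu>) - us0"
  define w where "w = - L \<eta>"
  have diff: "Ad (m' - m k) = L (xbs - snd (Ad (m k)))" if "m' \<in> polar_cone K" "snd (Ad m') = xbs" for m' k
    using L(2)[OF that(1)] L(2)[OF m_polar[of k]] that(2) 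
    by (simp add: linear_diff[OF linear_adjoint_blinfun] L.diff)
  have lim: "(\<lambda>k. (1 / t k) *\<^sub>R Ad (m' - m k)) \<longlonglongrightarrow> L \<eta>" if "m' \<in> polar_cone K" "snd (Ad m') = xbs" for m'
    unfolding diff[OF that] L.scaleR[symmetric] \<eta>_def by (intro L.tendsto adjoint_quotient)
  have lim_mu: "(\<lambda>k. (1 / t k) *\<^sub>R Ad (\<mu> - m k)) \<longlonglongrightarrow> L \<eta>"
    by (rule lim[OF mu_polar snd_Ad_mu])
  have sndL: "snd (L \<eta>) = \<eta>"
  proof -
    have "(\<lambda>k. snd ((1 / t k) *\<^sub>R Ad (\<mu> - m k))) \<longlonglongrightarrow> snd (L \<eta>)"
      by (intro tendsto_intros lim_mu)
    moreover have "snd ((1 / t k) *\<^sub>R Ad (\<mu> - m k)) = (1 / t k) *\<^sub>R (xbs - snd (Ad (m k)))" for k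
      by (simp add: linear_diff[OF linear_adjoint_blinfun] snd_Ad_mu)
    ultimately have "(\<lambda>k. (1 / t k) *\<^sub>R (xbs - snd (Ad (m k)))) \<longlonglongrightarrow> snd (L \<eta>)" by (simp only:)
    from LIMSEQ_unique[OF this adjoint_quotient] show ?thesis by (simp add: \<eta>_def)
  qed
  have pol: "w \<bullet> y \<le> 0" if y: "A y \<in> K" "\<mu> \<bullet> A y = 0" for y
  proof -
    have "(\<lambda>k. ((1 / t k) *\<^sub>R Ad (\<mu> - m k)) \<bullet> y) \<longlonglongrightarrow> L \<eta> \<bullet> y"
      by (intro tendsto_intros lim_mu)
    moreover have "((1 / t k) *\<^sub>R Ad (\<mu> - m k)) \<bullet> y \<ge> 0" for k
      using t_pos[of k] polar_coneD[OF m_polar[of k] y(1)] y(2) 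
      by (simp add: adjoint_blinfun_inner inner_diff_left divide_nonpos_pos)
    ultimately have "L \<eta> \<bullet> y \<ge> 0" using LIMSEQ_le_const by blast
    then show ?thesis by (simp add: w_def)
  qed
  have lec: "L \<eta> \<bullet> v0 + (1/2) * ((m' - \<mu>) \<bullet> B v0 v0) \<le> 0"
    if m': "m' \<in> polar_cone K" "snd (Ad m') = xbs" for m'
  proof (rule second_order_le)
    show "(\<lambda>k. m' - m k) \<longlonglongrightarrow> m' - \<mu>" by (intro tendsto_intros m_lim)
    show "(m' - m k) \<bullet> G (zb + t k *\<^sub>R v k) \<le> 0" for k
      using polar_coneD[OF m'(1) zK[of k]] m_compl[of k] by (simp add: inner_diff_left)
    have "(\<lambda>k. ((1 / t k) *\<^sub>R Ad (m' - m k)) \<bullet> v k) \<longlonglongrightarrow> L \<eta> \<bullet> v0"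
      by (intro tendsto_intros lim[OF m'] v_lim)
    then show "(\<lambda>k. 1 / t k * ((m' - m k) \<bullet> A (v k))) \<longlonglongrightarrow> L \<eta> \<bullet> v0"
      by (simp add: adjoint_blinfun_inner)
  qed
  \<comment> \<open>Polarity at the critical vector \<open>v0\<close> gives
    \<open>w \<bullet> v0 \<le> 0\<close>; the second-order inequality with
    \<open>m' = \<mu>\<close> gives the reverse.\<close>
  have wv: "w \<bullet> v0 = 0"
    using lec[OF mu_polar snd_Ad_mu] pol[OF A_v0 mu_v0] by (simp add: w_def)
  show "\<exists>w. snd w = us0 - snd (adjoint (blinfun_apply (B v0)) \<mu>) \<and> w \<bullet> v0 = 0 \<and> 
        (\<forall>y. A y \<in> K \<longrightarrow> \<mu> \<bullet> A y = 0 \<longrightarrow> w \<bullet> y \<le> 0)"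
    using pol wv sndL by (intro exI[of _ w]) (auto simp: w_def \<eta>_def)
  fix m' c assume m': "m' \<in> polar_cone K" "snd (Ad m') = xbs"
    and c: "(\<lambda>k. (1 / t k) * ((m' - \<mu>) \<bullet> A (v k))) \<longlonglongrightarrow> c"
  \<comment> \<open>All multipliers of \<open>xbs\<close> share one image under \<open>Ad\<close>,
    so the first-order limit \<open>c\<close> vanishes.\<close>
  have "Ad m' = Ad \<mu>" using L(2)[OF m'(1)] L(2)[OF mu_polar] m'(2) snd_Ad_mu by simp
  then have "Ad (m' - \<mu>) = 0" by (simp add: linear_diff[OF linear_adjoint_blinfun])
  then have "(m' - \<mu>) \<bullet> A y = 0" for y by (metis adjoint_blinfun_inner inner_zero_left)
  then have "c = 0" using c by (simp add: LIMSEQ_const_iff)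
  then show "c + (1/2) * ((m' - \<mu>) \<bullet> B v0 v0) \<le> 0" using lec[OF m'] wv by (simp add: w_def)
qed

lemma constant_normal_face:
  assumes "polyhedron K"
  obtains r N where "strict_mono (r :: nat \<Rightarrow> nat)"
    "\<And>k. polar_cone K \<inter> {n. n \<bullet> G (zb + t (r k) *\<^sub>R v (r k)) = 0} = N"
proof -
  define F where "F = (\<lambda>k. polar_cone K \<inter> {n. n \<bullet> G (zb + t k *\<^sub>R v k) = 0})"
  have "range F \<subseteq> {N. N exposed_face_of polar_cone K}"
    using polar_hyperplane_exposed_face[OF zK] by (auto simp: F_def)
  moreover have "finite {N. N exposed_face_of polar_cone K}"
    by (rule finite_polyhedron_exposed_faces[OF polyhedron_polar_cone[OF assms cone_K]])
  ultimately have fin: "finite (range F)" by (rule finite_subset)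
  obtain k0 where inf: "infinite {k. F k = F k0}"
    using pigeonhole_infinite[OF infinite_UNIV_nat fin] by auto
  obtain r :: "nat \<Rightarrow> nat" where "strict_mono r" "\<And>k. r k \<in> {k. F k = F k0}"
    using infinite_enumerate[OF inf] by blast
  then show thesis using that[of r "F k0"] by (auto simp: F_def)
qed

text \<open>The quotients of \<open>m k - \<mu>\<close> by \<open>t k\<close> may diverge, but along
  a subsequence with one common face \<open>N\<close> they stay in the polyhedral cone
  \<open>T\<close>. The x-parts of their images converge and the image of \<open>T\<close> is
  closed, so the limit has a preimage in \<open>T\<close>, whose full image under \<open>Ad\<close>
  serves as \<open>w\<close>.\<close>

lemma limit_conditions_polyhedral:
  assumes poly: "polyhedron K"
  shows "\<And>m' c. m' \<in> polar_cone K \<Longrightarrow> snd (Ad m') = xbs \<Longrightarrow> 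
      (\<lambda>k. (1 / t k) * ((m' - \<mu>) \<bullet> A (v k))) \<longlonglongrightarrow> c \<Longrightarrow> c + (1/2) * ((m' - \<mu>) \<bullet> B v0 v0) \<le> 0"
    and "\<exists>w. snd w = us0 - snd (adjoint (blinfun_apply (B v0)) \<mu>) \<and> w \<bullet> v0 = 0 \<and> 
        (\<forall>y. A y \<in> K \<longrightarrow> \<mu> \<bullet> A y = 0 \<longrightarrow> w \<bullet> y \<le> 0)"
proof -
  obtain r N where r: "strict_mono (r :: nat \<Rightarrow> nat)"
    "\<And>k. polar_cone K \<inter> {n. n \<bullet> G (zb + t (r k) *\<^sub>R v (r k)) = 0} = N"
    using constant_normal_face[OF poly] by blast
  interpret S: critical_sequence G DG B U K zb \<Gamma> \<kappa> xbs us0 v0 "t \<circ> r" "v \<circ> r" "us \<circ> r" "m \<circ> r" \<mu>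
    using t_pos zU zK m_polar m_compl m_normal
    by unfold_locales (auto intro!: LIMSEQ_subseq_LIMSEQ r(1) t_lim v_lim us_lim m_lim)
  have mN: "m (r k) \<in> N" for k using r(2)[of k] m_polar m_compl by blast
  have Npoly: "polyhedron N"
    unfolding r(2)[of 0, symmetric]
    using polyhedron_hyperplane[of "G (zb + t (r 0) *\<^sub>R v (r 0))" 0]
    by (intro polyhedron_Int polyhedron_polar_cone poly cone_K) (simp add: inner_commute)
  have Ncone: "convex_cone N"
    unfolding r(2)[of 0, symmetric] using convex_cone_polar[of K]
    by (auto simp: convex_cone_iff inner_add_left)
  have muN: "\<mu> \<in> N"
    using closed_sequentially[OF polyhedron_imp_closed[OF Npoly] _ S.m_lim] mN by simp
  have Ncompl: "n \<bullet> G (zb + t (r k) *\<^sub>R v (r k)) = 0" if "n \<in> N" for n k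
    using r(2)[of k] that by blast
  define T where "T = {n + c *\<^sub>R \<mu> | n c. n \<in> N}"
  have T: "polyhedron T" "convex_cone T" unfolding T_def by (rule polyhedral_cone_add_line[OF Npoly Ncone])+
  have lin: "linear (\<lambda>n. snd (Ad n))"
    using linear_compose[OF linear_adjoint_blinfun linear_snd] by (simp add: o_def)
  have cl: "closed ((\<lambda>n. snd (Ad n)) ` T)"
    by (rule polyhedron_imp_closed[OF polyhedron_linear_image_cone[OF T lin]])
  have "us0 - snd (adjoint (blinfun_apply (B v0)) \<mu>) \<in> (\<lambda>n. snd (Ad n)) ` T"
  proof (rule closed_sequentially[OF cl])
    show "(\<lambda>k. - ((1 / (t \<circ> r) k) *\<^sub>R (xbs - snd (Ad ((m \<circ> r) k))))) \<longlonglongrightarrow> us0 - snd (adjoint (blinfun_apply (B v0)) \<mu>)"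
      using tendsto_minus[OF S.adjoint_quotient] by simp
    show "- ((1 / (t \<circ> r) k) *\<^sub>R (xbs - snd (Ad ((m \<circ> r) k)))) \<in> (\<lambda>n. snd (Ad n)) ` T" for k
    proof
      let ?n = "(1 / t (r k)) *\<^sub>R m (r k) + (- 1 / t (r k)) *\<^sub>R \<mu>"
      show "- ((1 / (t \<circ> r) k) *\<^sub>R (xbs - snd (Ad ((m \<circ> r) k)))) = snd (Ad ?n)"
        by (simp add: linear_diff[OF linear_adjoint_blinfun] linear_add[OF linear_adjoint_blinfun]
            linear_scale[OF linear_adjoint_blinfun] snd_Ad_mu scaleR_diff_right)
      show "?n \<in> T" unfolding T_def
        using convex_cone_scaleR[OF Ncone _ mN[of k], of "1 / t (r k)"] t_pos[of "r k"] by fastforce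
    qed
  qed
  then obtain n c where n: "n \<in> N" "us0 - snd (adjoint (blinfun_apply (B v0)) \<mu>) = snd (Ad (n + c *\<^sub>R \<mu>))"
    by (auto simp: T_def)
  \<comment> \<open>Elements of \<open>N\<close> are orthogonal to all values of \<open>G\<close>
    along the subsequence, hence to the limit \<open>A v0\<close> of their quotients.\<close>
  have nv0: "n \<bullet> A v0 = 0"
  proof -
    have "(\<lambda>k. n \<bullet> ((1 / (t \<circ> r) k) *\<^sub>R G (zb + (t \<circ> r) k *\<^sub>R (v \<circ> r) k))) \<longlonglongrightarrow> n \<bullet> A v0"
      by (intro tendsto_intros S.G_quotient)
    then show ?thesis using Ncompl[OF n(1)] by (simp add: LIMSEQ_const_iff)
  qed
  have nK: "n \<in> polar_cone K" using n(1) r(2)[of 0] by blast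
  show "\<exists>w. snd w = us0 - snd (adjoint (blinfun_apply (B v0)) \<mu>) \<and> w \<bullet> v0 = 0 \<and> 
        (\<forall>y. A y \<in> K \<longrightarrow> \<mu> \<bullet> A y = 0 \<longrightarrow> w \<bullet> y \<le> 0)"
    using n(2) nv0 mu_v0 polar_coneD[OF nK]
    by (intro exI[of _ "Ad (n + c *\<^sub>R \<mu>)"]) (auto simp: adjoint_blinfun_inner inner_add_left)
  fix m' c' assume m': "m' \<in> polar_cone K" "snd (Ad m') = xbs"
    and c: "(\<lambda>k. (1 / t k) * ((m' - \<mu>) \<bullet> A (v k))) \<longlonglongrightarrow> c'"
  show "c' + (1/2) * ((m' - \<mu>) \<bullet> B v0 v0) \<le> 0"
  \<comment> \<open>As a member of \<open>N\<close>, \<open>\<mu>\<close> is itself complementary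
    along the subsequence, so the fixed \<open>m' - \<mu>\<close> can replace
    \<open>m' - m k\<close>.\<close>
  proof (rule S.second_order_le[OF tendsto_const])
    show "(m' - \<mu>) \<bullet> G (zb + (t \<circ> r) k *\<^sub>R (v \<circ> r) k) \<le> 0" for k
      using polar_coneD[OF m'(1) zK[of "r k"]] Ncompl[OF muN, of k] by (simp add: inner_diff_left)
    show "(\<lambda>k. 1 / (t \<circ> r) k * ((m' - \<mu>) \<bullet> A ((v \<circ> r) k))) \<longlonglongrightarrow> c'"
      using LIMSEQ_subseq_LIMSEQ[OF c r(1)] by (simp add: o_def)
  qed
qed

end

section \<open>The graphical derivative of the normal cone mapping\<close>

text \<open>Up to a lineality vector of \<open>K\<close>, which polar elements annihilate, every
  parameter direction acts like an x-direction. Hence the p-part of the adjoint image can be read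
  off from the x-part.\<close>

lemma char_subspace_UNIV_adjoint:
  fixes T :: "('p::euclidean_space \<times> 'x::euclidean_space) \<Rightarrow>\<^sub>L 'e::euclidean_space"
  assumes "char_subspace T K = UNIV"
  obtains L where "bounded_linear L" 
    "\<And>m. m \<in> polar_cone K \<Longrightarrow> adjoint (blinfun_apply T) m = L (snd (adjoint (blinfun_apply T) m))"
proof -
  have "\<exists>y. \<forall>m\<in>polar_cone K. m \<bullet> T (q, 0) = m \<bullet> T (0, y)" for q
  proof -
    have "q \<in> char_subspace T K" using assms by simp
    then obtain b y where b: "T (q, 0) = T (0, y) + b" "b \<in> K" "- b \<in> K"
      by (force simp: char_subspace_def dp_def dx_def)
    have "m \<bullet> b = 0" if "m \<in> polar_cone K" for m
      using polar_coneD[OF that b(2)] polar_coneD[OF that b(3)] by simp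
    then show ?thesis using b(1) by (auto simp: inner_add_right)
  qed
  then obtain Y where Y: "\<And>q m. m \<in> polar_cone K \<Longrightarrow> m \<bullet> T (q, 0) = m \<bullet> T (0, Y q)" by metis
  \<comment> \<open>\<open>Y\<close> comes from choice and need not be linear; using only its values
    on basis vectors makes \<open>L\<close> linear.\<close>
  define L :: "'x \<Rightarrow> 'p \<times> 'x" where "L = (\<lambda>\<xi>. (\<Sum>b\<in>Basis. (\<xi> \<bullet> Y b) *\<^sub>R b, \<xi>))"
  have "bounded_linear L" unfolding L_def
    by (intro bounded_linear_Pair bounded_linear_sum bounded_linear_scaleR_const bounded_linear_inner_left bounded_linear_ident)
  moreover have "adjoint (blinfun_apply T) m = L (snd (adjoint (blinfun_apply T) m))" if m: "m \<in> polar_cone K" for m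
  proof -
    have "fst (adjoint (blinfun_apply T) m) = (\<Sum>b\<in>Basis. (fst (adjoint (blinfun_apply T) m) \<bullet> b) *\<^sub>R b)"
      by (simp add: euclidean_representation)
    also have "\<dots> = (\<Sum>b\<in>Basis. (snd (adjoint (blinfun_apply T) m) \<bullet> Y b) *\<^sub>R b)"
    proof (intro sum.cong refl)
      fix b :: 'p
      have "fst (adjoint (blinfun_apply T) m) \<bullet> b = m \<bullet> T (b, 0)"
        using adjoint_blinfun_inner[of T m "(b, 0)"] by (simp add: inner_prod_def)
      then show "(fst (adjoint (blinfun_apply T) m) \<bullet> b) *\<^sub>R b = (snd (adjoint (blinfun_apply T) m) \<bullet> Y b) *\<^sub>R b"
        by (simp add: Y[OF m] snd_adjoint_inner)
    qed
    finally show ?thesis by (simp add: L_def prod_eq_iff)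
  qed
  ultimately show thesis by (rule that)
qed

context reduced_system
begin

definition dual_factorization :: bool where
  "dual_factorization \<longleftrightarrow> (\<exists>L. bounded_linear L \<and> (\<forall>m\<in>polar_cone K. Ad m = L (snd (Ad m))))"

text \<open>The right-hand side of the theorem for a multiplier \<open>m\<close> of the reduced
  system: \<open>Ad m\<close> plays the role of \<open>z*\<close>, so \<open>z* \<bullet> y\<close>
  reads \<open>m \<bullet> A y\<close>, and \<open>w\<close> is a normal to the critical cone at
  \<open>v\<close>.\<close>

definition graph_derivative_rel :: "'x \<Rightarrow> 'p \<times> 'x \<Rightarrow> 'x \<Rightarrow> 'e \<Rightarrow> bool" where
  "graph_derivative_rel xbs v us m \<longleftrightarrow> m \<in> polar_cone K \<and> A v \<in> K \<and> m \<bullet> A v = 0 \<and> snd (Ad m) = xbs \<and>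
     (\<forall>m'\<in>polar_cone K. Ad m' = Ad m \<longrightarrow> m' \<bullet> B v v \<le> m \<bullet> B v v) \<and>
     (\<exists>w. w \<bullet> v = 0 \<and> (\<forall>y. A y \<in> K \<longrightarrow> m \<bullet> A y = 0 \<longrightarrow> w \<bullet> y \<le> 0) \<and>
        us = snd (adjoint (blinfun_apply (B v)) m) + snd w)"

abbreviation normal_graph :: "(('p \<times> 'x) \<times> 'x) set" where
  "normal_graph \<equiv> {(z, xs). xs \<in> reg_normal_cone (\<Gamma> (fst z)) (snd z)}"

end

text \<open>\<open>c\<close> stays a free limit: it is 0 when \<open>m'\<close> and
  \<open>\<mu>\<close> have equal images under \<open>Ad\<close>, but in the converse the perturbed
  parameter contributes to it.\<close>

lemma (in critical_sequence) limit_conditions: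
  assumes alt: "dual_factorization \<or> polyhedron K"
  shows "\<And>m' c. m' \<in> polar_cone K \<Longrightarrow> snd (Ad m') = xbs \<Longrightarrow> 
      (\<lambda>k. (1 / t k) * ((m' - \<mu>) \<bullet> A (v k))) \<longlonglongrightarrow> c \<Longrightarrow> c + (1/2) * ((m' - \<mu>) \<bullet> B v0 v0) \<le> 0"
    and "\<exists>w. snd w = us0 - snd (adjoint (blinfun_apply (B v0)) \<mu>) \<and> w \<bullet> v0 = 0 \<and> 
        (\<forall>y. A y \<in> K \<longrightarrow> \<mu> \<bullet> A y = 0 \<longrightarrow> w \<bullet> y \<le> 0)"
proof -
  have "(\<forall>m' c. m' \<in> polar_cone K \<longrightarrow> snd (Ad m') = xbs \<longrightarrow>
      (\<lambda>k. (1 / t k) * ((m' - \<mu>) \<bullet> A (v k))) \<longlonglongrightarrow> c \<longrightarrow> c + (1/2) * ((m' - \<mu>) \<bullet> B v0 v0) \<le> 0) \<and>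
     (\<exists>w. snd w = us0 - snd (adjoint (blinfun_apply (B v0)) \<mu>) \<and> w \<bullet> v0 = 0 \<and> 
        (\<forall>y. A y \<in> K \<longrightarrow> \<mu> \<bullet> A y = 0 \<longrightarrow> w \<bullet> y \<le> 0))" for c
    using alt
  proof
    assume dual_factorization
    then obtain L where L: "bounded_linear L" "\<And>m. m \<in> polar_cone K \<Longrightarrow> Ad m = L (snd (Ad m))"
      unfolding dual_factorization_def by blast
    show ?thesis using limit_conditions_full[OF L] by (intro conjI allI impI)
  next
    assume poly: "polyhedron K"
    show ?thesis using limit_conditions_polyhedral[OF poly] by (intro conjI allI impI)
  qed
  then show "\<And>m' c. m' \<in> polar_cone K \<Longrightarrow> snd (Ad m') = xbs \<Longrightarrow> 
      (\<lambda>k. (1 / t k) * ((m' - \<mu>) \<bullet> A (v k))) \<longlonglongrightarrow> c \<Longrightarrow> c + (1/2) * ((m' - \<mu>) \<bullet> B v0 v0) \<le> 0"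
    and "\<exists>w. snd w = us0 - snd (adjoint (blinfun_apply (B v0)) \<mu>) \<and> w \<bullet> v0 = 0 \<and> 
        (\<forall>y. A y \<in> K \<longrightarrow> \<mu> \<bullet> A y = 0 \<longrightarrow> w \<bullet> y \<le> 0)"
    by simp_all
qed

section \<open>First inclusion, and perturbation of the multiplier problem\<close>

context reduced_system
begin

text \<open>Robinson stability bounds the multipliers, whence compactness. The bound on
  \<open>\<mu>\<close> is exported because it does not involve \<open>us\<close>, and therefore not
  the \<open>\<rho>\<close> chosen in the converse.\<close>

lemma critical_subsequence:
  assumes t: "\<And>k. t k > 0" "t \<longlonglongrightarrow> 0" and v: "v \<longlonglongrightarrow> v0" and us: "us \<longlonglongrightarrow> us0"
    and nor: "\<And>k. (zb + t k *\<^sub>R v k, xbs + t k *\<^sub>R us k) \<in> normal_graph"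
  obtains r m \<mu> where "strict_mono r" "norm \<mu> \<le> \<kappa> * norm xbs"
    "critical_sequence G DG B U K zb \<Gamma> \<kappa> xbs us0 v0 (t \<circ> r) (v \<circ> r) (us \<circ> r) m \<mu>"
proof -
  have "(\<lambda>k. zb + t k *\<^sub>R v k) \<longlonglongrightarrow> zb + 0 *\<^sub>R v0" by (intro tendsto_intros t v)
  then have "\<forall>\<^sub>F k in sequentially. zb + t k *\<^sub>R v k \<in> U"
    using topological_tendstoD[OF _ open_U] zb_U by simp
  then obtain N where N: "\<And>k. k \<ge> N \<Longrightarrow> zb + t k *\<^sub>R v k \<in> U" by (auto simp: eventually_sequentially)
  \<comment> \<open>Shifting by \<open>N\<close> puts every point into \<open>U\<close>, where the
    local hypotheses hold.\<close>
  define z where "z = (\<lambda>k. zb + t (k + N) *\<^sub>R v (k + N))"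
  define xs where "xs = (\<lambda>k. xbs + t (k + N) *\<^sub>R us (k + N))"
  have zU: "z k \<in> U" for k using N by (simp add: z_def)
  have nor': "xs k \<in> reg_normal_cone (\<Gamma> (fst (z k))) (snd (z k))" for k using nor[of "k + N"] by (simp add: z_def xs_def)
  have "\<exists>m. m \<in> polar_cone K \<and> m \<bullet> G (z k) = 0 \<and> norm m \<le> \<kappa> * norm (xs k) \<and> snd (adjoint (blinfun_apply (DG (z k))) m) = xs k" for k
    using normal_multiplier[OF zU nor'] by metis
  then obtain m where m: "\<And>k. m k \<in> polar_cone K" "\<And>k. m k \<bullet> G (z k) = 0"
     "\<And>k. norm (m k) \<le> \<kappa> * norm (xs k)" "\<And>k. snd (adjoint (blinfun_apply (DG (z k))) (m k)) = xs k" by metis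
  have "xs \<longlonglongrightarrow> xbs + 0 *\<^sub>R us0" unfolding xs_def
    by (intro tendsto_intros LIMSEQ_ignore_initial_segment t us)
  then have xs_lim: "(\<lambda>k. \<kappa> * norm (xs k)) \<longlonglongrightarrow> \<kappa> * norm xbs" by (auto intro!: tendsto_intros)
  obtain M where M: "\<forall>k. norm (\<kappa> * norm (xs k)) \<le> M" 
    using convergent_imp_Bseq[OF convergentI[OF xs_lim]] by (rule BseqE)
  have "norm (m k) \<le> M" for k
    using m(3)[of k] order_trans[OF abs_ge_self M[rule_format, of k, unfolded real_norm_def]] by linarith
  then have "bounded (range m)" by (auto intro: boundedI)
  then obtain \<mu> r where r: "strict_mono r" "(m \<circ> r) \<longlonglongrightarrow> \<mu>"
    using bounded_imp_convergent_subsequence by blast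
  have "norm \<mu> \<le> \<kappa> * norm xbs"
    by (rule LIMSEQ_le[OF tendsto_norm[OF r(2)] LIMSEQ_subseq_LIMSEQ[OF xs_lim r(1)]]) (use m(3) in auto)
  moreover have sm: "strict_mono (\<lambda>k. r k + N)" using r(1) by (auto simp: strict_mono_def)
  moreover have "critical_sequence G DG B U K zb \<Gamma> \<kappa> xbs us0 v0 (t \<circ> (\<lambda>k. r k + N)) (v \<circ> (\<lambda>k. r k + N)) (us \<circ> (\<lambda>k. r k + N)) (m \<circ> r) \<mu>"
  proof
    show "(t \<circ> (\<lambda>k. r k + N)) \<longlonglongrightarrow> 0" "(v \<circ> (\<lambda>k. r k + N)) \<longlonglongrightarrow> v0" "(us \<circ> (\<lambda>k. r k + N)) \<longlonglongrightarrow> us0"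
      using LIMSEQ_subseq_LIMSEQ[OF _ sm] t v us by auto
    show "G (zb + (t \<circ> (\<lambda>k. r k + N)) k *\<^sub>R (v \<circ> (\<lambda>k. r k + N)) k) \<in> K" for k
      using nor'[of "r k"] feasible_iff[OF zU[of "r k"]] by (simp add: z_def reg_normal_cone_def)
  qed (use t zU m r(2) in \<open>auto simp: z_def xs_def\<close>)
  ultimately show thesis using that by blast
qed

lemma graph_derivative_imp_rel:
  assumes alt: "dual_factorization \<or> polyhedron K"
    and tan: "(v0, us0) \<in> tangent_cone normal_graph (zb, xbs)"
  obtains m where "graph_derivative_rel xbs v0 us0 m"
proof -
  obtain t ws where t: "\<And>k. t k > 0" "t \<longlonglongrightarrow> 0" and ws: "ws \<longlonglongrightarrow> (v0, us0)"
    and nor: "\<And>k::nat. (zb, xbs) + t k *\<^sub>R ws k \<in> normal_graph"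
    using tan unfolding tangent_cone_def by blast
  have 1: "(\<lambda>k. fst (ws k)) \<longlonglongrightarrow> v0" "(\<lambda>k. snd (ws k)) \<longlonglongrightarrow> us0"
    using tendsto_fst[OF ws] tendsto_snd[OF ws] by auto
  have 2: "(zb + t k *\<^sub>R fst (ws k), xbs + t k *\<^sub>R snd (ws k)) \<in> normal_graph" for k
  proof -
    have "(zb, xbs) + t k *\<^sub>R ws k = (zb + t k *\<^sub>R fst (ws k), xbs + t k *\<^sub>R snd (ws k))"
      by (simp add: prod_eq_iff)
    then show ?thesis using nor[of k] by simp
  qed
  obtain r m \<mu> where r: "strict_mono r" and cs:
    "critical_sequence G DG B U K zb \<Gamma> \<kappa> xbs us0 v0 (t \<circ> r) ((\<lambda>k. fst (ws k)) \<circ> r) ((\<lambda>k. snd (ws k)) \<circ> r) m \<mu>"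
    using critical_subsequence[OF t 1 2] by blast
  interpret S: critical_sequence G DG B U K zb \<Gamma> \<kappa> xbs us0 v0 "t \<circ> r" "(\<lambda>k. fst (ws k)) \<circ> r" "(\<lambda>k. snd (ws k)) \<circ> r" m \<mu>
    by (rule cs)
  have max: "m' \<bullet> B v0 v0 \<le> \<mu> \<bullet> B v0 v0" if m': "m' \<in> polar_cone K" "Ad m' = Ad \<mu>" for m'
  proof -
    have "Ad (m' - \<mu>) = 0" using m'(2) by (simp add: linear_diff[OF linear_adjoint_blinfun])
    then have "(m' - \<mu>) \<bullet> A y = 0" for y by (metis adjoint_blinfun_inner inner_zero_left)
    then have "(\<lambda>k. (1 / (t \<circ> r) k) * ((m' - \<mu>) \<bullet> A (((\<lambda>k. fst (ws k)) \<circ> r) k))) \<longlonglongrightarrow> 0" by simp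
    from S.limit_conditions(1)[OF alt m'(1) _ this] have "0 + (1/2) * ((m' - \<mu>) \<bullet> B v0 v0) \<le> 0"
      using m'(2) S.snd_Ad_mu by simp
    then show ?thesis by (simp add: inner_diff_left)
  qed
  obtain w where w: "snd w = us0 - snd (adjoint (blinfun_apply (B v0)) \<mu>)" "w \<bullet> v0 = 0"
        "\<forall>y. A y \<in> K \<longrightarrow> \<mu> \<bullet> A y = 0 \<longrightarrow> w \<bullet> y \<le> 0" using S.limit_conditions(2)[OF alt] by blast
  have "graph_derivative_rel xbs v0 us0 \<mu>"
    unfolding graph_derivative_rel_def
    using S.mu_polar S.A_v0 S.mu_v0 S.snd_Ad_mu max w by (intro conjI ballI impI exI[of _ w]) simp_all
  then show thesis by (rule that)
qed

text \<open>A second-order perturbation of the parameter that turns the maximality of \<^term>\<open>m\<close> over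
  a single fibre \<open>Ad m' = Ad m\<close> into maximality over the larger set of all multipliers
  representing \<^term>\<open>xbs\<close> (a Lagrange multiplier of a linear program).\<close>
lemma maximizing_perturbation:
  assumes alt: "dual_factorization \<or> polyhedron K"
    and m: "m \<in> polar_cone K" and mx: "snd (Ad m) = xbs"
    and max: "\<And>m'. m' \<in> polar_cone K \<Longrightarrow> Ad m' = Ad m \<Longrightarrow> m' \<bullet> b \<le> m \<bullet> b"
  obtains r where "\<And>m'. m' \<in> polar_cone K \<Longrightarrow> snd (Ad m') = xbs \<Longrightarrow> (m' - m) \<bullet> (b + A (r, 0)) \<le> 0"
  using alt
proof
  assume dual_factorization
  then obtain L where L: "\<And>m. m \<in> polar_cone K \<Longrightarrow> Ad m = L (snd (Ad m))"
    unfolding dual_factorization_def by blast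
  show thesis
  \<comment> \<open>All multipliers of \<open>xbs\<close> lie in the fibre
    \<open>Ad m' = Ad m\<close>, over which \<open>m\<close> is maximal by assumption.\<close>
  proof (rule that[of 0])
    fix m' assume m': "m' \<in> polar_cone K" "snd (Ad m') = xbs"
    then have "Ad m' = Ad m" using L[OF m] L[OF m'(1)] mx by simp
    from max[OF m'(1) this] show "(m' - m) \<bullet> (b + A (0, 0)) \<le> 0"
      by (simp add: inner_diff_left zero_prod_def[symmetric] blinfun.zero_right)
  qed
next
  assume poly: "polyhedron K"
  define T where "T = {n + c *\<^sub>R m | n c. n \<in> polar_cone K}"
  have T: "polyhedron T" "convex_cone T" unfolding T_def
    by (rule polyhedral_cone_add_line[OF polyhedron_polar_cone[OF poly cone_K] convex_cone_polar])+
  have lin: "linear (\<lambda>n. snd (Ad n))" "linear (\<lambda>n. fst (Ad n))"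
    using linear_compose[OF linear_adjoint_blinfun linear_snd] 
      linear_compose[OF linear_adjoint_blinfun linear_fst] by (simp_all add: o_def)
  define E where "E = {n. snd (Ad n) = 0}"
  have E: "subspace E" unfolding E_def by (rule linear_subspace_kernel[OF lin(1)])
  \<comment> \<open>\<open>D\<close> consists, up to scaling, of the directions from
    \<open>m\<close> into the polar cone that keep the x-part; \<open>f\<close> records the change
    of the p-part and of the objective along them.\<close>
  define D where "D = T \<inter> E"
  have D: "polyhedron D" "convex_cone D"
    unfolding D_def using T subspace_imp_affine[OF E] affine_imp_polyhedron subspace_imp_convex_cone[OF E]
    by (auto simp: convex_cone_iff)
  define f where "f = (\<lambda>n. (fst (Ad n), n \<bullet> b))"
  have f: "linear f" unfolding f_def
    using lin(2) by (auto simp: linear_iff inner_add_left)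
  have Q: "closed (f ` D)" "convex_cone (f ` D)"
    using polyhedron_imp_closed[OF polyhedron_linear_image_cone[OF D f]] convex_cone_linear_image[of D f] D f by auto
  have "(0, 1) \<notin> f ` D"
  proof
    assume "(0, 1) \<in> f ` D"
    then obtain n c where n: "n \<in> polar_cone K" "snd (Ad (n + c *\<^sub>R m)) = 0" "fst (Ad (n + c *\<^sub>R m)) = 0" "(n + c *\<^sub>R m) \<bullet> b = 1"
      by (auto simp: D_def T_def E_def f_def)
    \<comment> \<open>Large enough that moving from \<open>m\<close> by \<open>1 / s\<close> times
      the direction stays in the polar cone.\<close>
    define s where "s = \<bar>c\<bar> + 1"
    have s: "s > 0" "c + s \<ge> 0" by (auto simp: s_def)
    define m' where "m' = (1 / s) *\<^sub>R (n + (c + s) *\<^sub>R m)"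
    have m'K: "m' \<in> polar_cone K" unfolding m'_def
      using s n(1) m convex_cone_scaleR[OF convex_cone_polar, of _ _ K] convex_cone_add[OF convex_cone_polar, of _ K] by simp
    have m'eq: "m' = m + (1 / s) *\<^sub>R (n + c *\<^sub>R m)" using s by (simp add: m'_def algebra_simps)
    have "Ad (n + c *\<^sub>R m) = 0" using n(2,3) by (simp add: prod_eq_iff)
    then have "Ad m' = Ad m" unfolding m'eq
      by (simp only: linear_add[OF linear_adjoint_blinfun] linear_scale[OF linear_adjoint_blinfun]) simp
    from max[OF m'K this] have "(1 / s) * ((n + c *\<^sub>R m) \<bullet> b) \<le> 0" unfolding m'eq by (simp add: inner_add_left)
    then show False using n(4) s by simp
  qed
  \<comment> \<open>No direction improves the objective while fixing \<open>Ad\<close>. Separating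
    \<open>(0, 1)\<close> from the closed cone of recorded changes yields a price vector
    \<open>y\<close>; dividing it by the price \<open>\<beta>\<close> of the objective gives
    \<open>r\<close>.\<close>
  then have "(0, 1) \<notin> polar_cone (polar_cone (f ` D))" using bipolar[OF Q] by simp
  then obtain y where y: "y \<in> polar_cone (f ` D)" "(0, 1) \<bullet> y > 0" by (force simp: polar_cone_def)
  define \<beta> where "\<beta> = snd y"
  have \<beta>: "\<beta> > 0" using y(2) by (simp add: \<beta>_def inner_prod_def)
  show thesis
  proof (rule that[of "(1 / \<beta>) *\<^sub>R fst y"])
    fix m' assume m': "m' \<in> polar_cone K" "snd (Ad m') = xbs"
    have "m' - m = m' + (-1) *\<^sub>R m" by simp
    then have "m' - m \<in> T" unfolding T_def using m'(1) by blast
    moreover have "m' - m \<in> E" using m' mx by (simp add: E_def linear_diff[OF linear_adjoint_blinfun])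
    ultimately have "f (m' - m) \<in> f ` D" by (simp add: D_def)
    from polar_coneD[OF y(1) this] have 1: "fst (Ad (m' - m)) \<bullet> fst y + \<beta> * ((m' - m) \<bullet> b) \<le> 0"
      by (simp add: f_def inner_prod_def \<beta>_def inner_commute)
    have "(m' - m) \<bullet> A ((1 / \<beta>) *\<^sub>R fst y, 0) = (1 / \<beta>) * (fst (Ad (m' - m)) \<bullet> fst y)"
      unfolding adjoint_blinfun_inner[symmetric] by (simp add: inner_prod_def)
    then have "\<beta> * ((m' - m) \<bullet> (b + A ((1 / \<beta>) *\<^sub>R fst y, 0))) = fst (Ad (m' - m)) \<bullet> fst y + \<beta> * ((m' - m) \<bullet> b)"
      using \<beta> by (simp add: inner_add_right distrib_left)
    with 1 have "\<beta> * ((m' - m) \<bullet> (b + A ((1 / \<beta>) *\<^sub>R fst y, 0))) \<le> \<beta> * 0" by simp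
    then show "(m' - m) \<bullet> (b + A ((1 / \<beta>) *\<^sub>R fst y, 0)) \<le> 0"
      unfolding mult_le_cancel_left_pos[OF \<beta>] .
  qed
qed


section \<open>Quadratic bounds and the auxiliary minimization problem\<close>

lemma B_bilinear: "bounded_linear B"
  using derDG by (rule has_derivative_bounded_linear)

lemma B_symmetric: "B v w = B w v"
  by (rule second_derivative_symmetric[OF open_U zb_U derG derDG])

lemma B_bound:
  obtains \<beta> where "\<beta> > 0" "\<And>d. norm (B d d) \<le> \<beta> * (norm d)\<^sup>2"
proof -
  obtain \<beta> where \<beta>: "\<beta> > 0" "\<And>d. norm (B d) \<le> norm d * \<beta>"
    using bounded_linear.pos_bounded[OF B_bilinear] by blast
  have "norm (B d d) \<le> \<beta> * (norm d)\<^sup>2" for d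
  proof -
    have "norm (B d d) \<le> norm (B d) * norm d" by (rule norm_blinfun)
    also have "\<dots> \<le> norm d * \<beta> * norm d" by (intro mult_right_mono \<beta>) simp
    finally show ?thesis by (simp add: power2_eq_square mult_ac)
  qed
  then show thesis using that \<beta>(1) by blast
qed

lemma linearization_bound:
  obtains M \<delta> where "M > 0" "\<delta> > 0" "\<And>w. norm w < \<delta> \<Longrightarrow> zb + w \<in> U"
    "\<And>w. norm w < \<delta> \<Longrightarrow> norm (G (zb + w) - A w) \<le> M * (norm w)\<^sup>2"
proof -
  obtain \<delta> where d: "\<delta> > 0" "\<And>w. norm w < \<delta> \<Longrightarrow> zb + w \<in> U"
    "\<And>w. norm w < \<delta> \<Longrightarrow> norm (G (zb + w) - G zb - A w - (1/2) *\<^sub>R B w w) \<le> 1 * (norm w)\<^sup>2"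
    using second_order_taylor[OF open_U zb_U derG derDG zero_less_one] by blast
  obtain \<beta> where \<beta>: "\<beta> > 0" "\<And>d. norm (B d d) \<le> \<beta> * (norm d)\<^sup>2" using B_bound by blast
  have "norm (G (zb + w) - A w) \<le> (\<beta> + 1) * (norm w)\<^sup>2" if "norm w < \<delta>" for w
  proof -
    have "norm (G (zb + w) - A w) \<le> norm (G (zb + w) - G zb - A w - (1/2) *\<^sub>R B w w) + norm ((1/2) *\<^sub>R B w w)"
      using norm_triangle_ineq[of "G (zb + w) - G zb - A w - (1/2) *\<^sub>R B w w" "(1/2) *\<^sub>R B w w"] G_zb by simp
    also have "norm ((1/2) *\<^sub>R B w w) \<le> \<beta> * (norm w)\<^sup>2"
      using \<beta>(2)[of w] norm_ge_zero[of "B w w"] by (simp del: norm_ge_zero)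
    also have "norm (G (zb + w) - G zb - A w - (1/2) *\<^sub>R B w w) \<le> 1 * (norm w)\<^sup>2" using d(3)[OF that] .
    finally show ?thesis by (simp add: algebra_simps)
  qed
  then show thesis using that[of "\<beta> + 1" \<delta>] d \<beta>(1) by auto
qed

lemma snd_Ad_inner_split: "m \<bullet> A (p, x) = m \<bullet> A (p, 0) + snd (Ad m) \<bullet> x"
proof -
  have "A (p, x) = A (p, 0) + A (0, x)" by (simp add: blinfun.add_right[symmetric])
  then show ?thesis by (simp add: snd_adjoint_inner inner_add_right)
qed

text \<open>Minimizing a strongly convex function over the feasible set of the perturbed parameter.
  The multiplier \<^term>\<open>m\<close> controls the linear term, so minimizers stay \<open>O(t)\<close>-close.\<close>
lemma localized_minimizer:
  assumes m: "m \<in> polar_cone K" and mx: "snd (Ad m) = xbs"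
    and AvK: "A (q, u) \<in> K" and mAv: "m \<bullet> A (q, u) = 0"
  obtains \<rho>0 c where "\<And>\<rho>. \<rho> \<ge> \<rho>0 \<Longrightarrow> \<exists>T>0. \<forall>t. 0 < t \<and> t < T \<longrightarrow>
     (\<exists>y. norm y \<le> c \<rho> * t \<and>
        (zb + (t *\<^sub>R q + (t\<^sup>2 / 2) *\<^sub>R r, t *\<^sub>R u + y), xbs + t *\<^sub>R us - \<rho> *\<^sub>R y) \<in> normal_graph)"
proof -
  obtain pb xb where zb: "zb = (pb, xb)" by (cases zb)
  obtain M \<delta> where M: "M > 0" "\<delta> > 0" "\<And>w. norm w < \<delta> \<Longrightarrow> zb + w \<in> U"
    "\<And>w. norm w < \<delta> \<Longrightarrow> norm (G (zb + w) - A w) \<le> M * (norm w)\<^sup>2"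
    using linearization_bound by blast
  \<comment> \<open>\<open>c2 * t\<close> bounds the displacement of the reference point and
    \<open>c1 * t\<^sup>2\<close> its x-distance to a feasible point; \<open>a\<close> and
    \<open>c3\<close> enter through \<open>xbs \<bullet> y \<le> c3 * t\<^sup>2 + 2 * a * (norm
    y)\<^sup>2\<close>. For \<open>\<rho> \<ge> 4 * a + 2\<close> the coefficient
    \<open>\<rho> / 2 - 2 * a\<close> is at least 1, and completing the square against
    \<open>t * (us \<bullet> y)\<close> produces \<open>c\<close>.\<close>
  define c2 where "c2 = norm q + norm r + norm u"
  have c2: "c2 \<ge> 0" by (simp add: c2_def)
  define c1 where "c1 = \<kappa> * (M * c2\<^sup>2 + norm (A (r, 0))) + 1"
  have c1: "c1 > 0" using kappa_nonneg M(1) by (simp add: c1_def add_nonneg_pos)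
  define a where "a = norm m * M"
  have a: "a \<ge> 0" using M(1) by (simp add: a_def)
  define c3 where "c3 = 2 * a * c2\<^sup>2 + norm m * norm (A (r, 0))"
  have c3: "c3 \<ge> 0" using a by (simp add: c3_def)
  define c5 where "c5 = (\<lambda>\<rho>. (norm xbs + norm us) * c1 + \<rho> / 2 * c1\<^sup>2 + c3)"
  define c where "c = (\<lambda>\<rho>. sqrt (2 * c5 \<rho> + (norm us)\<^sup>2))"
  have "\<exists>T>0. \<forall>t. 0 < t \<and> t < T \<longrightarrow>
     (\<exists>y. norm y \<le> c \<rho> * t \<and>
        (zb + (t *\<^sub>R q + (t\<^sup>2 / 2) *\<^sub>R r, t *\<^sub>R u + y), xbs + t *\<^sub>R us - \<rho> *\<^sub>R y) \<in> normal_graph)"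
    if \<rho>: "\<rho> \<ge> 4 * a + 2" for \<rho>
  proof -
    have \<rho>0: "\<rho> > 0" using \<rho> a by linarith
    have c5: "c5 \<rho> \<ge> 0" using c1 c3 \<rho>0 by (simp add: c5_def)
    have c0: "c \<rho> \<ge> 0" by (simp add: c_def c5)
    define T where "T = min 1 (\<delta> / (4 * (c2 + c1 + c \<rho> + 1)))"
    have Tpos: "T > 0" using M(2) c2 c1 c0 by (simp add: T_def)
    have "\<exists>y. norm y \<le> c \<rho> * t \<and>
        (zb + (t *\<^sub>R q + (t\<^sup>2 / 2) *\<^sub>R r, t *\<^sub>R u + y), xbs + t *\<^sub>R us - \<rho> *\<^sub>R y) \<in> normal_graph"
      if t: "0 < t" "t < T" for t
    proof -
      have t1: "t < 1" using t by (simp add: T_def)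
      have tt: "t\<^sup>2 \<le> t" using t t1 by (simp add: power2_eq_square mult_left_le)
      have tsum: "4 * (t * (c2 + c1 + c \<rho> + 1)) < \<delta>"
      proof -
        have p: "4 * (c2 + c1 + c \<rho> + 1) > 0" using c2 c1 c0 by simp
        have "t < \<delta> / (4 * (c2 + c1 + c \<rho> + 1))" using t by (simp add: T_def)
        then show ?thesis using p by (simp only: pos_less_divide_eq[OF p])
      qed
      have small: "4 * (t * c2 + t * c1 + t * c \<rho>) < \<delta>"
        using tsum t by (simp add: distrib_left)
      have tc: "0 \<le> t * c2" "0 \<le> t * c1" "0 \<le> t * c \<rho>" using t c2 c1 c0 by auto
      define dq where "dq = t *\<^sub>R q + (t\<^sup>2 / 2) *\<^sub>R r"
      define p where "p = pb + dq"
      define xc where "xc = xb + t *\<^sub>R u"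
      have ndq: "norm dq \<le> t * (norm q + norm r)"
      proof -
        have "norm dq \<le> t * norm q + (t\<^sup>2 / 2) * norm r"
          unfolding dq_def by (rule order_trans[OF norm_triangle_ineq]) (use t in simp)
        moreover have "(t\<^sup>2 / 2) * norm r \<le> t * norm r" using tt t by (intro mult_right_mono) auto
        ultimately show ?thesis by (simp add: distrib_left)
      qed
      have nw: "norm (dq, t *\<^sub>R u + y) \<le> t * c2 + norm y" for y
      proof -
        have "norm (dq, t *\<^sub>R u + y) \<le> norm dq + norm (t *\<^sub>R u + y)" by (rule norm_Pair_le)
        also have "norm (t *\<^sub>R u + y) \<le> t * norm u + norm y"
          by (rule order_trans[OF norm_triangle_ineq]) (use t in simp)
        finally show ?thesis using ndq by (simp add: c2_def distrib_left)
      qed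
      have zw: "zb + (dq, t *\<^sub>R u + y) = (p, xc + y)" for y by (simp add: zb p_def xc_def)
      have inU: "(p, xc + y) \<in> U" if "norm y < 3 * \<delta> / 4" for y
      proof -
        have "norm (dq, t *\<^sub>R u + y) < \<delta>" using nw[of y] that small tc M(2) by argo
        from M(3)[OF this] show ?thesis by (simp only: zw)
      qed
      have Aw: "A (dq, t *\<^sub>R u) = t *\<^sub>R A (q, u) + (t\<^sup>2 / 2) *\<^sub>R A (r, 0)"
        unfolding blinfun.scaleR_right[symmetric] blinfun.add_right[symmetric] by (simp add: dq_def)
      \<comment> \<open>As \<open>A (q, u) \<in> K\<close>, the reference point violates the
        constraint by \<open>O(t^2)\<close> only; Robinson stability then yields the nearby
        competitor \<open>xf\<close>.\<close>
      have "norm (G (p, xc) - t *\<^sub>R A (q, u)) \<le> (M * c2\<^sup>2 + norm (A (r, 0))) * t\<^sup>2"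
      proof -
        have n: "norm (dq, t *\<^sub>R u) \<le> t * c2" using nw[of 0] by simp
        then have "norm (dq, t *\<^sub>R u) < \<delta>" using small tc M(2) by argo
        from M(4)[OF this] zw[of 0] have "norm (G (p, xc) - A (dq, t *\<^sub>R u)) \<le> M * (norm (dq, t *\<^sub>R u))\<^sup>2" by simp
        also have "\<dots> \<le> M * (t * c2)\<^sup>2" using n M(1) by (intro mult_left_mono power_mono) auto
        finally have 1: "norm (G (p, xc) - A (dq, t *\<^sub>R u)) \<le> M * c2\<^sup>2 * t\<^sup>2" by (simp add: power_mult_distrib mult_ac)
        have "norm (G (p, xc) - t *\<^sub>R A (q, u)) \<le> norm (G (p, xc) - A (dq, t *\<^sub>R u)) + norm ((t\<^sup>2 / 2) *\<^sub>R A (r, 0))"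
          using norm_triangle_ineq[of "G (p, xc) - A (dq, t *\<^sub>R u)" "(t\<^sup>2 / 2) *\<^sub>R A (r, 0)"] by (simp add: Aw)
        also have "norm ((t\<^sup>2 / 2) *\<^sub>R A (r, 0)) \<le> norm (A (r, 0)) * t\<^sup>2"
          by (simp add: mult.commute[of _ "norm (A (r, 0))"] mult_left_mono)
        finally show ?thesis using 1 by (simp add: distrib_right)
      qed
      moreover have "t *\<^sub>R A (q, u) \<in> K" using AvK t convex_cone_scaleR[OF cone_K] by simp
      moreover have xcU: "(p, xc) \<in> U" using inU[of 0] M(2) by simp
      ultimately have "infdist xc (\<Gamma> p) \<le> \<kappa> * ((M * c2\<^sup>2 + norm (A (r, 0))) * t\<^sup>2)"
        using robinson[OF xcU] kappa_nonneg by (metis fst_conv mult_left_mono order_trans snd_conv)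
      moreover obtain xf where xf: "xf \<in> \<Gamma> p" "dist xc xf < infdist xc (\<Gamma> p) + t\<^sup>2"
        using infdist_approx[of "\<Gamma> p" "t\<^sup>2" xc] robinson_nonempty[OF xcU] t by auto
      ultimately have "norm (xf - xc) \<le> \<kappa> * (M * c2\<^sup>2 + norm (A (r, 0))) * t\<^sup>2 + t\<^sup>2"
        by (simp add: dist_norm norm_minus_commute)
      then have xfd: "norm (xf - xc) \<le> c1 * t\<^sup>2" by (simp add: c1_def distrib_right)
      have xft: "norm (xf - xc) \<le> c1 * t" using xfd tt c1 by (meson mult_left_mono less_imp_le order_trans)
      \<comment> \<open>The ball provides compactness; it leaves stationarity intact because the
        minimizer turns out to lie in its interior.\<close>
      define S where "S = cball xc (\<delta> / 2) \<inter> \<Gamma> p"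
      have S_eq: "S = cball xc (\<delta> / 2) \<inter> (\<lambda>x. G (p, x)) -` K"
      proof -
        have "x \<in> \<Gamma> p \<longleftrightarrow> G (p, x) \<in> K" if "x \<in> cball xc (\<delta> / 2)" for x
        proof -
          have "norm (x - xc) < 3 * \<delta> / 4" using that M(2) by (simp add: dist_norm norm_minus_commute)
          from inU[OF this] feasible_iff[of "(p, x)"] show ?thesis by simp
        qed
        then show ?thesis unfolding S_def by blast
      qed
      have "continuous_on (cball xc (\<delta> / 2)) (\<lambda>x. G (p, x))"
      proof (rule continuous_at_imp_continuous_on, rule ballI)
        fix x assume "x \<in> cball xc (\<delta> / 2)"
        then have "norm (x - xc) < 3 * \<delta> / 4" using M(2) by (simp add: dist_norm norm_minus_commute)
        from inU[OF this] have "isCont G (p, x)" using derG has_derivative_continuous by fastforce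
        then show "isCont (\<lambda>x. G (p, x)) x"
          by (rule isCont_o2[rotated]) (intro continuous_intros)
      qed
      then have "compact S" unfolding S_eq
        by (intro compact_eq_bounded_closed[THEN iffD2] conjI continuous_closed_preimage closed_K closed_cball)
           (auto intro: bounded_Int)
      moreover have xfS: "xf \<in> S" unfolding S_def
        using xf(1) xft small tc by (auto simp: dist_norm norm_minus_commute mult.commute)
      \<comment> \<open>The coefficients are chosen so that stationarity at \<open>xc + y\<close>
        makes \<open>xbs + t *\<^sub>R us - \<rho> *\<^sub>R y\<close> a normal.\<close>
      moreover define \<phi> where "\<phi> = (\<lambda>x. \<rho> / 2 * (norm (x - xc))\<^sup>2 - (xbs + t *\<^sub>R us) \<bullet> (x - xc))"
      have "continuous_on S \<phi>" unfolding \<phi>_def by (intro continuous_intros)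
      ultimately obtain x where x: "x \<in> S" "\<And>x'. x' \<in> S \<Longrightarrow> \<phi> x \<le> \<phi> x'"
        using continuous_attains_inf[of S \<phi>] by blast
      define y where "y = x - xc"
      have ny: "norm y \<le> \<delta> / 2" using x(1) by (simp add: S_def y_def dist_norm norm_minus_commute)
      have yU: "(p, xc + y) \<in> U" using inU ny M(2) by simp
      have GyK: "G (p, xc + y) \<in> K" using x(1) by (simp add: S_eq y_def)
      define W where "W = (dq, t *\<^sub>R u + y)"
      have nW: "norm W \<le> t * c2 + norm y" unfolding W_def by (rule nw)
      have "norm W < \<delta>" using nW ny small tc M(2) by argo
      from M(4)[OF this] have GW: "norm (G (p, xc + y) - A W) \<le> M * (norm W)\<^sup>2"
        using zw[of y] by (simp add: W_def)
      have W2: "(norm W)\<^sup>2 \<le> 2 * c2\<^sup>2 * t\<^sup>2 + 2 * (norm y)\<^sup>2"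
      proof -
        have "(norm W)\<^sup>2 \<le> (t * c2 + norm y)\<^sup>2" using nW by (intro power_mono) auto
        also have "\<dots> \<le> 2 * (t * c2)\<^sup>2 + 2 * (norm y)\<^sup>2"
          using zero_le_power2[of "t * c2 - norm y"] by (simp add: power2_sum power2_diff)
        finally show ?thesis by (simp add: power_mult_distrib mult_ac)
      qed
      \<comment> \<open>Feasible points satisfy \<open>m \<bullet> G \<le> 0\<close>. Since
        \<open>snd (Ad m) = xbs\<close>, this bounds the linear term \<open>xbs \<bullet> y\<close>
        by quadratic quantities, which is what keeps \<open>y\<close> of order
        \<open>t\<close>.\<close>
      have "m \<bullet> A W \<le> a * (norm W)\<^sup>2"
      proof -
        have "m \<bullet> (A W - G (p, xc + y)) \<le> norm m * norm (A W - G (p, xc + y))" by (rule norm_cauchy_schwarz)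
        also have "\<dots> \<le> norm m * (M * (norm W)\<^sup>2)" using GW by (intro mult_left_mono) (auto simp: norm_minus_commute)
        finally show ?thesis using polar_coneD[OF m GyK] by (simp add: inner_diff_right a_def mult.assoc)
      qed
      also have "\<dots> \<le> a * (2 * c2\<^sup>2 * t\<^sup>2 + 2 * (norm y)\<^sup>2)" using W2 a by (rule mult_left_mono)
      finally have mAW: "m \<bullet> A W \<le> 2 * a * c2\<^sup>2 * t\<^sup>2 + 2 * a * (norm y)\<^sup>2" by (simp add: algebra_simps)
      have "W = (dq, t *\<^sub>R u) + (0, y)" by (simp add: W_def)
      then have "m \<bullet> A W = m \<bullet> A (dq, t *\<^sub>R u) + m \<bullet> A (0, y)" by (simp only: blinfun.add_right inner_add_right)
      also have "\<dots> = t\<^sup>2 / 2 * (m \<bullet> A (r, 0)) + xbs \<bullet> y"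
        using mAv mx snd_adjoint_inner[of A m y] by (simp add: Aw inner_add_right)
      finally have eqW: "m \<bullet> A W = t\<^sup>2 / 2 * (m \<bullet> A (r, 0)) + xbs \<bullet> y" .
      have "- (m \<bullet> A (r, 0)) \<le> norm m * norm (A (r, 0))"
        using Cauchy_Schwarz_ineq2[of m "A (r, 0)"] by linarith
      then have "- (t\<^sup>2 / 2 * (m \<bullet> A (r, 0))) \<le> t\<^sup>2 / 2 * (norm m * norm (A (r, 0)))"
        using mult_left_mono[of "- (m \<bullet> A (r, 0))" "norm m * norm (A (r, 0))" "t\<^sup>2 / 2"] by simp
      also have "\<dots> \<le> norm m * norm (A (r, 0)) * t\<^sup>2" by (simp add: mult_ac mult_right_mono)
      finally have xy: "xbs \<bullet> y \<le> c3 * t\<^sup>2 + 2 * a * (norm y)\<^sup>2"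
        using mAW eqW by (simp add: c3_def distrib_right)
      have "\<phi> xf \<le> ((norm xbs + norm us) * c1 + \<rho> / 2 * c1\<^sup>2) * t\<^sup>2"
      proof -
        have "- ((xbs + t *\<^sub>R us) \<bullet> (xf - xc)) \<le> norm (xbs + t *\<^sub>R us) * norm (xf - xc)"
          using Cauchy_Schwarz_ineq2[of "xbs + t *\<^sub>R us" "xf - xc"] by linarith
        also have "\<dots> \<le> (norm xbs + norm us) * (c1 * t\<^sup>2)"
        proof (intro mult_mono xfd)
          show "norm (xbs + t *\<^sub>R us) \<le> norm xbs + norm us"
            by (rule order_trans[OF norm_triangle_ineq]) (use t t1 in \<open>simp add: mult_left_le_one_le\<close>)
        qed auto
        finally have 1: "- ((xbs + t *\<^sub>R us) \<bullet> (xf - xc)) \<le> (norm xbs + norm us) * (c1 * t\<^sup>2)" .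
        have "(norm (xf - xc))\<^sup>2 \<le> (c1 * t)\<^sup>2" using xft by (intro power_mono) auto
        then have "\<rho> / 2 * (norm (xf - xc))\<^sup>2 \<le> \<rho> / 2 * (c1 * t)\<^sup>2" using \<rho>0 by (intro mult_left_mono) auto
        then show ?thesis using 1 by (simp add: \<phi>_def power_mult_distrib algebra_simps)
      qed
      with x(2)[OF xfS] have "\<phi> x \<le> ((norm xbs + norm us) * c1 + \<rho> / 2 * c1\<^sup>2) * t\<^sup>2" by linarith
      then have "\<rho> / 2 * (norm y)\<^sup>2 - xbs \<bullet> y - t * (us \<bullet> y) \<le> ((norm xbs + norm us) * c1 + \<rho> / 2 * c1\<^sup>2) * t\<^sup>2"
        by (simp add: \<phi>_def y_def[symmetric] inner_add_left)
      then have "\<rho> / 2 * (norm y)\<^sup>2 \<le> c5 \<rho> * t\<^sup>2 + 2 * a * (norm y)\<^sup>2 + t * (us \<bullet> y)"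
        using xy by (simp add: c5_def distrib_right)
      moreover have "(2 * a + 1) * (norm y)\<^sup>2 \<le> \<rho> / 2 * (norm y)\<^sup>2"
        using \<rho> by (intro mult_right_mono) auto
      moreover have "t * (us \<bullet> y) \<le> (t * norm us) * norm y"
        using mult_left_mono[OF norm_cauchy_schwarz[of us y], of t] t by (simp add: mult.assoc)
      moreover have "2 * ((t * norm us) * norm y) \<le> (t * norm us)\<^sup>2 + (norm y)\<^sup>2"
        using zero_le_power2[of "t * norm us - norm y"] by (simp add: power2_diff)
      ultimately have "(norm y)\<^sup>2 \<le> 2 * (c5 \<rho> * t\<^sup>2) + (t * norm us)\<^sup>2"
        by (simp add: distrib_right)
      also have "\<dots> = (c \<rho> * t)\<^sup>2"
      proof -
        have "(c \<rho>)\<^sup>2 = 2 * c5 \<rho> + (norm us)\<^sup>2" using c5 by (simp add: c_def)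
        then show ?thesis by algebra
      qed
      finally have ycb: "norm y \<le> c \<rho> * t" by (rule power2_le_imp_le) (use c0 t in simp)
      have xGp: "x \<in> \<Gamma> p" using x(1) by (simp add: S_def)
      have "xbs + t *\<^sub>R us - \<rho> *\<^sub>R y \<in> reg_normal_cone (\<Gamma> p) x"
        unfolding reg_normal_cone_def
      proof (intro CollectI conjI allI impI xGp)
        fix \<epsilon> :: real assume eps: "\<epsilon> > 0"
        have yd: "norm y < \<delta> / 2" using ycb small tc M(2) by (simp add: mult.commute) 
        \<comment> \<open>Within this radius the remainder
          \<open>\<rho> / 2 * (norm (x' - x))\<^sup>2\<close> is at most
          \<open>\<epsilon> * norm (x' - x)\<close>, and \<open>x'\<close> stays in the
          ball.\<close>
        define \<delta>' where "\<delta>' = min (2 * \<epsilon> / \<rho>) (\<delta> / 2 - norm y)"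
        have "\<delta>' > 0" using eps \<rho>0 yd by (simp add: \<delta>'_def)
        moreover have "(xbs + t *\<^sub>R us - \<rho> *\<^sub>R y) \<bullet> (x' - x) \<le> \<epsilon> * norm (x' - x)"
          if x': "x' \<in> \<Gamma> p" "norm (x' - x) < \<delta>'" for x'
        proof -
          have "norm (x' - xc) \<le> norm (x' - x) + norm y"
            using norm_triangle_ineq[of "x' - x" y] by (simp add: y_def)
          then have "x' \<in> S" using x' by (simp add: S_def \<delta>'_def dist_norm norm_minus_commute)
          from x(2)[OF this] have le: "\<phi> x \<le> \<phi> x'" .
          have split: "x' - xc = (x' - x) + y" by (simp add: y_def)
          have sq: "(norm (x' - xc))\<^sup>2 = (norm (x' - x))\<^sup>2 + 2 * (y \<bullet> (x' - x)) + (norm y)\<^sup>2"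
            unfolding split power2_norm_eq_inner inner_add_left inner_add_right by (simp add: inner_commute)
          have "(xbs + t *\<^sub>R us) \<bullet> (x' - xc) = (xbs + t *\<^sub>R us) \<bullet> (x' - x) + (xbs + t *\<^sub>R us) \<bullet> y"
            unfolding split by (rule inner_add_right)
          then have "\<phi> x' - \<phi> x = \<rho> / 2 * (norm (x' - x))\<^sup>2 - (xbs + t *\<^sub>R us - \<rho> *\<^sub>R y) \<bullet> (x' - x)"
            unfolding \<phi>_def sq y_def[symmetric] inner_diff_left inner_scaleR_left by (simp add: field_simps)
          with le have "(xbs + t *\<^sub>R us - \<rho> *\<^sub>R y) \<bullet> (x' - x) \<le> (\<rho> / 2 * norm (x' - x)) * norm (x' - x)"
            by (simp add: power2_eq_square)
          also have "\<dots> \<le> \<epsilon> * norm (x' - x)"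
          proof (rule mult_right_mono)
            have "norm (x' - x) \<le> 2 * \<epsilon> / \<rho>" using x'(2) by (simp add: \<delta>'_def)
            then show "\<rho> / 2 * norm (x' - x) \<le> \<epsilon>" using \<rho>0 by (simp add: field_simps)
          qed simp
          finally show ?thesis .
        qed
        ultimately show "\<exists>\<delta>>0. \<forall>z\<in>\<Gamma> p. norm (z - x) < \<delta> \<longrightarrow> (xbs + t *\<^sub>R us - \<rho> *\<^sub>R y) \<bullet> (z - x) \<le> \<epsilon> * norm (z - x)"
          by blast
      qed
      then have "(zb + (t *\<^sub>R q + (t\<^sup>2 / 2) *\<^sub>R r, t *\<^sub>R u + y), xbs + t *\<^sub>R us - \<rho> *\<^sub>R y) \<in> normal_graph"
        using zw[of y] by (simp add: dq_def[symmetric] y_def)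
      then show ?thesis using ycb by blast
    qed
    then show ?thesis using Tpos by blast
  qed
  then show thesis by (rule that)
qed

end

lemma null_sequence_below:
  assumes "0 < (T::real)"
  obtains t :: "nat \<Rightarrow> real" where "\<And>n. 0 < t n" "\<And>n. t n < T" "t \<longlonglongrightarrow> 0"
proof (rule that[of "\<lambda>n. T / real (n + 2)"])
  show "0 < T / real (n + 2)" for n using assms by simp
  show "T / real (n + 2) < T" for n
  proof -
    have "T * 1 < T * real (n + 2)" using assms by (intro mult_strict_left_mono) auto
    then show ?thesis by (simp add: pos_divide_less_eq)
  qed
  show "(\<lambda>n. T / real (n + 2)) \<longlonglongrightarrow> 0"
    by (rule LIMSEQ_ignore_initial_segment[OF lim_const_over_n])
qed

section \<open>Converse inclusion and the tangent cone of the feasible set\<close>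

context reduced_system
begin

lemma rel_imp_graph_derivative:
  assumes alt: "dual_factorization \<or> polyhedron K"
    and rel: "graph_derivative_rel xbs v us m"
  shows "(v, us) \<in> tangent_cone normal_graph (zb, xbs)"
proof -
  obtain q u where v: "v = (q, u)" by (cases v)
  have m: "m \<in> polar_cone K" and AvK: "A v \<in> K" and mAv: "m \<bullet> A v = 0" and mx: "snd (Ad m) = xbs"
    and max: "\<And>m'. m' \<in> polar_cone K \<Longrightarrow> Ad m' = Ad m \<Longrightarrow> m' \<bullet> B v v \<le> m \<bullet> B v v"
    using rel unfolding graph_derivative_rel_def by blast+
  obtain w where w: "w \<bullet> v = 0" "\<And>y. A y \<in> K \<Longrightarrow> m \<bullet> A y = 0 \<Longrightarrow> w \<bullet> y \<le> 0"
     "us = snd (adjoint (blinfun_apply (B v)) m) + snd w"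
    using rel unfolding graph_derivative_rel_def by blast
  obtain r where r: "\<And>m'. m' \<in> polar_cone K \<Longrightarrow> snd (Ad m') = xbs \<Longrightarrow> (m' - m) \<bullet> (B v v + A (r, 0)) \<le> 0"
    using maximizing_perturbation[OF alt m mx max] by blast
  obtain \<rho>0 c where lm: "\<And>\<rho>. \<rho> \<ge> \<rho>0 \<Longrightarrow> \<exists>T>0. \<forall>t. 0 < t \<and> t < T \<longrightarrow>
     (\<exists>y. norm y \<le> c \<rho> * t \<and>
        (zb + (t *\<^sub>R q + (t\<^sup>2 / 2) *\<^sub>R r, t *\<^sub>R u + y), xbs + t *\<^sub>R us - \<rho> *\<^sub>R y) \<in> normal_graph)"
    using localized_minimizer[OF m mx, of q u r us] AvK mAv unfolding v by blast
  obtain \<beta> where \<beta>: "\<beta> > 0" "\<And>d. norm (B d d) \<le> \<beta> * (norm d)\<^sup>2" using B_bound by blast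
  \<comment> \<open>\<open>\<rho>\<close> has to beat the curvature bound \<open>\<beta>\<close>
    weighted with both multipliers; for the still unknown \<open>\<mu>\<close> its norm bound is
    available in advance.\<close>
  define \<rho> where "\<rho> = max \<rho>0 (\<beta> * (norm m + \<kappa> * norm xbs) + 1)"
  obtain T where T: "T > 0" and Ty: "\<And>t. 0 < t \<Longrightarrow> t < T \<Longrightarrow> \<exists>y. norm y \<le> c \<rho> * t \<and>
        (zb + (t *\<^sub>R q + (t\<^sup>2 / 2) *\<^sub>R r, t *\<^sub>R u + y), xbs + t *\<^sub>R us - \<rho> *\<^sub>R y) \<in> normal_graph"
    using lm[of \<rho>] by (auto simp: \<rho>_def)
  obtain \<tau> :: "nat \<Rightarrow> real" where \<tau>: "\<And>n. 0 < \<tau> n" "\<And>n. \<tau> n < T" and \<tau>0: "\<tau> \<longlonglongrightarrow> 0"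
    using null_sequence_below[OF T] by blast
  have "\<forall>n. \<exists>y. norm y \<le> c \<rho> * \<tau> n \<and>
     (zb + (\<tau> n *\<^sub>R q + ((\<tau> n)\<^sup>2 / 2) *\<^sub>R r, \<tau> n *\<^sub>R u + y), xbs + \<tau> n *\<^sub>R us - \<rho> *\<^sub>R y) \<in> normal_graph"
    by (intro allI Ty \<tau>)
  from choice[OF this] obtain y where y: "\<And>n. norm (y n) \<le> c \<rho> * \<tau> n"
     "\<And>n. (zb + (\<tau> n *\<^sub>R q + ((\<tau> n)\<^sup>2 / 2) *\<^sub>R r, \<tau> n *\<^sub>R u + y n), xbs + \<tau> n *\<^sub>R us - \<rho> *\<^sub>R y n) \<in> normal_graph"
    by blast
  define Y where "Y = (\<lambda>n. (1 / \<tau> n) *\<^sub>R y n)"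
  have "norm (Y n) \<le> c \<rho>" for n
    using y(1)[of n] \<tau>(1)[of n] by (simp add: Y_def pos_divide_le_eq)
  then have "bounded (range Y)" by (auto intro: boundedI)
  then obtain yh s where s: "strict_mono s" "(Y \<circ> s) \<longlonglongrightarrow> yh"
    using bounded_imp_convergent_subsequence by blast
  define t where "t = \<tau> \<circ> s"
  \<comment> \<open>Division by \<open>t\<close> turns the second-order shift of the parameter into
    \<open>(t n / 2) *\<^sub>R r\<close>: invisible in the limit direction, but present in the
    second-order inequality.\<close>
  define vn where "vn = (\<lambda>n. (q + (t n / 2) *\<^sub>R r, u + Y (s n)))"
  define un where "un = (\<lambda>n. us - \<rho> *\<^sub>R Y (s n))"
  define v' where "v' = (q, u + yh)"
  have t: "t n > 0" for n using \<tau> by (simp add: t_def)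
  have t0: "t \<longlonglongrightarrow> 0" unfolding t_def by (rule LIMSEQ_subseq_LIMSEQ[OF \<tau>0 s(1)])
  have Ys: "(\<lambda>n. Y (s n)) \<longlonglongrightarrow> yh" using s(2) by (simp add: o_def)
  have "vn \<longlonglongrightarrow> (q + (0 / 2) *\<^sub>R r, u + yh)" unfolding vn_def by (intro tendsto_intros t0 Ys) auto
  then have vn: "vn \<longlonglongrightarrow> v'" by (simp add: v'_def)
  have un: "un \<longlonglongrightarrow> us - \<rho> *\<^sub>R yh" unfolding un_def by (intro tendsto_intros Ys)
  have nor: "(zb + t n *\<^sub>R vn n, xbs + t n *\<^sub>R un n) \<in> normal_graph" for n
  proof -
    have ty: "t n *\<^sub>R Y (s n) = y (s n)" using t[of n] by (simp add: Y_def t_def)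
    have "zb + t n *\<^sub>R vn n = zb + (t n *\<^sub>R q + ((t n)\<^sup>2 / 2) *\<^sub>R r, t n *\<^sub>R u + y (s n))"
      by (simp add: vn_def scaleR_add_right ty power2_eq_square)
    moreover have "xbs + t n *\<^sub>R un n = xbs + t n *\<^sub>R us - \<rho> *\<^sub>R y (s n)"
      by (simp add: un_def scaleR_diff_right ty[symmetric] mult.commute)
    moreover have "t n = \<tau> (s n)" by (simp add: t_def)
    ultimately show ?thesis using y(2)[of "s n"] by (simp only:)
  qed
  obtain s2 m2 \<mu> where s2: "strict_mono s2" and n\<mu>: "norm \<mu> \<le> \<kappa> * norm xbs"
    and cs: "critical_sequence G DG B U K zb \<Gamma> \<kappa> xbs (us - \<rho> *\<^sub>R yh) v' (t \<circ> s2) (vn \<circ> s2) (un \<circ> s2) m2 \<mu>"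
    using critical_subsequence[OF t t0 vn un nor] by blast
  interpret S: critical_sequence G DG B U K zb \<Gamma> \<kappa> xbs "us - \<rho> *\<^sub>R yh" v' "t \<circ> s2" "vn \<circ> s2" "un \<circ> s2" m2 \<mu>
    by (rule cs)
  obtain w' where w': "snd w' = us - \<rho> *\<^sub>R yh - snd (adjoint (blinfun_apply (B v')) \<mu>)" "w' \<bullet> v' = 0"
     "\<And>y. A y \<in> K \<Longrightarrow> \<mu> \<bullet> A y = 0 \<Longrightarrow> w' \<bullet> y \<le> 0" using S.limit_conditions(2)[OF alt] by blast
  have mAv': "m \<bullet> A v' = xbs \<bullet> yh" and \<mu>Av: "\<mu> \<bullet> A v = - (xbs \<bullet> yh)"
  proof -
    show "m \<bullet> A v' = xbs \<bullet> yh" using mAv unfolding v v'_def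
      using snd_Ad_inner_split[of m q u] snd_Ad_inner_split[of m q "u + yh"] mx by (simp add: inner_add_right)
    show "\<mu> \<bullet> A v = - (xbs \<bullet> yh)" using S.mu_v0 unfolding v v'_def
      using snd_Ad_inner_split[of \<mu> q u] snd_Ad_inner_split[of \<mu> q "u + yh"] S.snd_Ad_mu by (simp add: inner_add_right)
  qed
  \<comment> \<open>Each multiplier is tested at the direction belonging to the other one; polarity
    yields both signs of \<open>xbs \<bullet> yh\<close>.\<close>
  have xy: "xbs \<bullet> yh = 0"
    using polar_coneD[OF m S.A_v0] polar_coneD[OF S.mu_polar AvK] mAv' \<mu>Av by simp
  \<comment> \<open>So \<open>m\<close> and \<open>\<mu>\<close> agree along all directions with
    p-part \<open>q\<close>, and only \<open>r\<close> contributes to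
    \<open>(m - \<mu>) \<bullet> A (vn n)\<close>.\<close>
  have diffA: "(m - \<mu>) \<bullet> A (q, x) = 0" for x
    using mAv \<mu>Av xy mx S.snd_Ad_mu snd_Ad_inner_split[of m q u] snd_Ad_inner_split[of \<mu> q u] 
      snd_Ad_inner_split[of m q x] snd_Ad_inner_split[of \<mu> q x] by (simp add: v inner_diff_left)
  have le1: "(m - \<mu>) \<bullet> (B v' v' + A (r, 0)) \<le> 0"
  proof -
    have quot: "1 / t n * ((m - \<mu>) \<bullet> A (vn n)) = (1/2) * ((m - \<mu>) \<bullet> A (r, 0))" for n
    proof -
      have "vn n = (q, u + Y (s n)) + (t n / 2) *\<^sub>R (r, 0)" by (simp add: vn_def)
      then have "A (vn n) = A (q, u + Y (s n)) + (t n / 2) *\<^sub>R A (r, 0)"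
        by (simp only: blinfun.add_right blinfun.scaleR_right)
      then show ?thesis using t[of n] by (simp add: inner_add_right diffA)
    qed
    have "(\<lambda>k. 1 / (t \<circ> s2) k * ((m - \<mu>) \<bullet> A ((vn \<circ> s2) k))) \<longlonglongrightarrow> (1/2) * ((m - \<mu>) \<bullet> A (r, 0))"
      by (simp only: comp_apply quot tendsto_const)
    from S.limit_conditions(1)[OF alt m mx this] show ?thesis by (simp add: inner_add_right)
  qed
  have le2: "(\<mu> - m) \<bullet> (B v v + A (r, 0)) \<le> 0" by (rule r[OF S.mu_polar S.snd_Ad_mu])
  define d where "d = (0::'p, yh)"
  have v'd: "v' = v + d" by (simp add: v'_def v d_def)
  interpret B: bounded_linear B by (rule B_bilinear)
  have Bexp: "B v' v' = B v v + 2 *\<^sub>R B v d + B d d" 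
    unfolding v'd B.add blinfun.add_left blinfun.add_right B_symmetric[of d v] by (simp add: scaleR_2)
  \<comment> \<open>Adding \<open>le1\<close> and \<open>le2\<close> cancels the terms with
    \<open>r\<close> and gives the cross term a sign, up to a quadratic term.\<close>
  have ge: "2 * ((\<mu> - m) \<bullet> B v d) + (\<mu> - m) \<bullet> B d d \<ge> 0"
    using le1 le2 unfolding Bexp by (simp add: inner_add_right inner_diff_left)
  \<comment> \<open>Monotonicity of normals: \<open>v'\<close> lies in the critical cone to which
    \<open>w\<close> is normal at \<open>v\<close>, and \<open>v\<close> in the one to which
    \<open>w'\<close> is normal at \<open>v'\<close>.\<close>
  have wd: "w \<bullet> v' \<le> 0" "w' \<bullet> v \<le> 0"
    using w(2)[OF S.A_v0] w'(3)[OF AvK] mAv' \<mu>Av xy by auto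
  have "w' \<bullet> d - w \<bullet> d \<ge> 0"
  proof -
    have "w' \<bullet> v + w' \<bullet> d = 0" using w'(2) by (simp add: v'd inner_add_right)
    moreover have "w \<bullet> d \<le> 0" using wd(1) w(1) by (simp add: v'd inner_add_right)
    ultimately show ?thesis using wd(2) by linarith
  qed
  then have "snd w' \<bullet> yh - snd w \<bullet> yh \<ge> 0" by (simp add: d_def inner_prod_def)
  moreover have "snd w' \<bullet> yh = us \<bullet> yh - \<rho> * (yh \<bullet> yh) - \<mu> \<bullet> B v' d"
    unfolding w'(1) d_def by (simp add: inner_diff_left snd_adjoint_inner)
  moreover have "snd w \<bullet> yh = us \<bullet> yh - m \<bullet> B v d"
    using arg_cong[OF w(3), of "\<lambda>x. x \<bullet> yh"] unfolding d_def by (simp add: inner_add_left snd_adjoint_inner)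
  moreover have "\<mu> \<bullet> B v' d = \<mu> \<bullet> B v d + \<mu> \<bullet> B d d"
    unfolding v'd by (simp add: B.add blinfun.add_left inner_add_right)
  ultimately have "\<rho> * (yh \<bullet> yh) \<le> - ((\<mu> - m) \<bullet> B v d) - \<mu> \<bullet> B d d" by (simp add: inner_diff_left)
  then have "\<rho> * (yh \<bullet> yh) \<le> - ((\<mu> + m) \<bullet> B d d) / 2" using ge by (simp add: inner_diff_left inner_add_left)
  also have "\<dots> \<le> (norm \<mu> + norm m) * norm (B d d)"
  proof -
    have "\<bar>(\<mu> + m) \<bullet> B d d\<bar> \<le> norm (\<mu> + m) * norm (B d d)" by (rule Cauchy_Schwarz_ineq2)
    also have "\<dots> \<le> (norm \<mu> + norm m) * norm (B d d)" by (intro mult_right_mono norm_triangle_ineq) simp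
    finally show ?thesis by linarith
  qed
  also have "\<dots> \<le> (\<kappa> * norm xbs + norm m) * (\<beta> * (norm d)\<^sup>2)"
    using n\<mu> \<beta> kappa_nonneg by (intro mult_mono) auto
  also have "norm d = norm yh" by (simp add: d_def norm_Pair0)
  finally have up: "\<rho> * (norm yh)\<^sup>2 \<le> (\<beta> * (norm m + \<kappa> * norm xbs)) * (norm yh)\<^sup>2"
    by (simp add: power2_norm_eq_inner algebra_simps)
  have "(\<beta> * (norm m + \<kappa> * norm xbs) + 1) * (norm yh)\<^sup>2 \<le> \<rho> * (norm yh)\<^sup>2"
    by (intro mult_right_mono) (auto simp: \<rho>_def)
  from order_trans[OF this up] have "(norm yh)\<^sup>2 \<le> 0"
    unfolding distrib_right[of _ 1] mult_1_left by (simp only: add_le_same_cancel1)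
  then have yh: "yh = 0" by simp
  show ?thesis
    unfolding tangent_cone_def
  proof (rule CollectI, intro exI[of _ t] exI[of _ "\<lambda>n. (vn n, un n)"] conjI allI)
    show "t n > 0" for n by (rule t)
    show "t \<longlonglongrightarrow> 0" by (rule t0)
    show "(\<lambda>n. (vn n, un n)) \<longlonglongrightarrow> (v, us)"
      using tendsto_Pair[OF vn un] by (simp add: yh v'_def v)
    show "(zb, xbs) + t n *\<^sub>R (vn n, un n) \<in> normal_graph" for n using nor[of n] by simp
  qed
qed

lemma tangent_cone_normal_graph:
  assumes alt: "dual_factorization \<or> polyhedron K"
  shows "tangent_cone normal_graph (zb, xbs) = {(v, us). \<exists>m. graph_derivative_rel xbs v us m}"
proof (intro set_eqI iffI)
  fix p assume p: "p \<in> tangent_cone normal_graph (zb, xbs)"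
  then have "(fst p, snd p) \<in> tangent_cone normal_graph (zb, xbs)" by simp
  then obtain m where "graph_derivative_rel xbs (fst p) (snd p) m" by (rule graph_derivative_imp_rel[OF alt])
  then show "p \<in> {(v, us). \<exists>m. graph_derivative_rel xbs v us m}" by (auto simp: case_prod_beta)
next
  fix p assume "p \<in> {(v, us). \<exists>m. graph_derivative_rel xbs v us m}"
  then obtain m where "graph_derivative_rel xbs (fst p) (snd p) m" by (auto simp: case_prod_beta)
  from rel_imp_graph_derivative[OF alt this] show "p \<in> tangent_cone normal_graph (zb, xbs)" by simp
qed

text \<open>Robinson stability acts as an Abadie-type qualification: a linearized direction violates
  the constraint by \<open>O(t^2)\<close>, so an x-correction of that order restores feasibility
  without changing the limit direction.\<close>

lemma tangent_cone_feasible: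
  assumes F: "\<And>z. z \<in> F \<longleftrightarrow> snd z \<in> \<Gamma> (fst z)"
  shows "tangent_cone F zb = {v. A v \<in> K}"
proof (intro set_eqI iffI)
  fix v0 assume "v0 \<in> tangent_cone F zb"
  then obtain t v where t: "\<And>k. t k > 0" "t \<longlonglongrightarrow> 0" and v: "v \<longlonglongrightarrow> v0" and inF: "\<And>k::nat. zb + t k *\<^sub>R v k \<in> F"
    unfolding tangent_cone_def by blast
  have q: "(\<lambda>k. (1 / t k) *\<^sub>R G (zb + t k *\<^sub>R v k)) \<longlonglongrightarrow> A v0"
    using has_derivative_difference_quotient[OF derG[OF zb_U] t v] by (simp add: G_zb)
  have "(\<lambda>k. zb + t k *\<^sub>R v k) \<longlonglongrightarrow> zb + 0 *\<^sub>R v0" by (intro tendsto_intros t v)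
  then have "\<forall>\<^sub>F k in sequentially. zb + t k *\<^sub>R v k \<in> U"
    using topological_tendstoD[OF _ open_U] zb_U by simp
  then have "\<forall>\<^sub>F k in sequentially. (1 / t k) *\<^sub>R G (zb + t k *\<^sub>R v k) \<in> K"
  proof eventually_elim
    case (elim k)
    have "G (zb + t k *\<^sub>R v k) \<in> K" using inF[of k] F feasible_iff[OF elim] by blast
    then show ?case using t(1)[of k] by (intro convex_cone_scaleR[OF cone_K]) auto
  qed
  then have "A v0 \<in> K" using Lim_in_closed_set[OF closed_K _ _ q] by simp
  then show "v0 \<in> {v. A v \<in> K}" by simp
next
  fix v assume "v \<in> {v. A v \<in> K}"
  then have AvK: "A v \<in> K" by simp
  obtain q u where v: "v = (q, u)" by (cases v)
  obtain M \<delta> where M: "M > 0" "\<delta> > 0" "\<And>w. norm w < \<delta> \<Longrightarrow> zb + w \<in> U"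
    "\<And>w. norm w < \<delta> \<Longrightarrow> norm (G (zb + w) - A w) \<le> M * (norm w)\<^sup>2"
    using linearization_bound by blast
  define T where "T = \<delta> / (norm v + 1)"
  have T: "T > 0" using M(2) by (simp add: T_def add_nonneg_pos)
  obtain t :: "nat \<Rightarrow> real" where t: "\<And>n. 0 < t n" "\<And>n. t n < T" and t0: "t \<longlonglongrightarrow> 0"
    using null_sequence_below[OF T] by blast
  define c where "c = \<kappa> * (M * (norm v)\<^sup>2) + 1"
  have "\<exists>y. zb + t n *\<^sub>R (q, u + y) \<in> F \<and> norm y \<le> c * t n" for n
  proof -
    have "t n * norm v \<le> t n * (norm v + 1)" using t[of n] by simp
    also have "\<dots> < \<delta>" using t(2)[of n] by (simp add: T_def pos_less_divide_eq add_nonneg_pos)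
    finally have small: "norm (t n *\<^sub>R v) < \<delta>" using t(1)[of n] by simp
    define z where "z = zb + t n *\<^sub>R v"
    have zU: "z \<in> U" using M(3)[OF small] by (simp add: z_def)
    have "t n *\<^sub>R A v \<in> K" using AvK t(1)[of n] convex_cone_scaleR[OF cone_K] by simp
    from robinson[OF zU this] have "infdist (snd z) (\<Gamma> (fst z)) \<le> \<kappa> * norm (G z - A (t n *\<^sub>R v))"
      by (simp add: blinfun.scaleR_right)
    also have "\<dots> \<le> \<kappa> * (M * (norm (t n *\<^sub>R v))\<^sup>2)"
      using M(4)[OF small] kappa_nonneg by (intro mult_left_mono) (auto simp: z_def)
    finally have "infdist (snd z) (\<Gamma> (fst z)) \<le> \<kappa> * (M * (norm v)\<^sup>2) * (t n)\<^sup>2"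
      by (simp add: power_mult_distrib mult_ac)
    moreover obtain x where x: "x \<in> \<Gamma> (fst z)" "dist (snd z) x < infdist (snd z) (\<Gamma> (fst z)) + (t n)\<^sup>2"
      using infdist_approx[OF robinson_nonempty[OF zU], of "(t n)\<^sup>2"] t(1)[of n] by auto
    ultimately have d: "norm (x - snd z) \<le> c * (t n)\<^sup>2"
      by (simp add: dist_norm norm_minus_commute c_def distrib_right)
    define y where "y = (1 / t n) *\<^sub>R (x - snd z)"
    have "zb + t n *\<^sub>R (q, u + y) = (fst z, x)"
      using t(1)[of n] by (simp add: y_def z_def v prod_eq_iff scaleR_add_right)
    moreover have "norm y \<le> c * t n"
    proof -
      have "norm y = norm (x - snd z) / t n" using t(1)[of n] by (simp add: y_def)
      then show ?thesis using d t(1)[of n] by (simp add: pos_divide_le_eq power2_eq_square mult.assoc)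
    qed
    ultimately show ?thesis using x(1) F by (intro exI[of _ y]) simp
  qed
  then obtain y where y: "\<And>n. zb + t n *\<^sub>R (q, u + y n) \<in> F" "\<And>n. norm (y n) \<le> c * t n" by metis
  have "(\<lambda>n. c * t n) \<longlonglongrightarrow> c * 0" by (intro tendsto_intros t0)
  then have "y \<longlonglongrightarrow> 0" using Lim_null_comparison[of y "\<lambda>n. c * t n" sequentially] y(2) by simp
  then have "(\<lambda>n. (q, u + y n)) \<longlonglongrightarrow> (q, u + 0)" by (intro tendsto_intros)
  then show "v \<in> tangent_cone F zb"
    unfolding tangent_cone_def v using t(1) t0 y(1)
    by (intro CollectI exI[of _ t] exI[of _ "\<lambda>n. (q, u + y n)"]) simp
qed

end

section \<open>Back to the original data\<close>

text \<open>On a convex cone the limit condition is tested along segments from \<open>v\<close>: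
  adding multiples of \<open>y \<in> T\<close> gives \<open>z \<bullet> y \<le> 0\<close>, and
  shrinking \<open>v\<close> gives \<open>z \<bullet> v \<ge> 0\<close>.\<close>

lemma reg_normal_cone_convex_cone:
  assumes T: "convex_cone T"
  shows "reg_normal_cone T v = {z. v \<in> T \<and> z \<bullet> v = 0 \<and> (\<forall>y\<in>T. z \<bullet> y \<le> 0)}"
proof (intro set_eqI iffI)
  fix z assume z: "z \<in> reg_normal_cone T v"
  then have vT: "v \<in> T" by (simp add: reg_normal_cone_def)
  have dir: "z \<bullet> d \<le> 0" if d: "\<And>s. 0 < s \<Longrightarrow> s \<le> 1 \<Longrightarrow> v + s *\<^sub>R d \<in> T" for d
  proof -
    have "z \<bullet> d \<le> 0 + \<epsilon>" if e: "\<epsilon> > 0" for \<epsilon>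
    proof -
      define \<eta> where "\<eta> = \<epsilon> / (norm d + 1)"
      have \<eta>: "\<eta> > 0" using e by (simp add: \<eta>_def add_nonneg_pos)
      obtain \<delta> where \<delta>: "\<delta> > 0" "\<And>y. y \<in> T \<Longrightarrow> norm (y - v) < \<delta> \<Longrightarrow> z \<bullet> (y - v) \<le> \<eta> * norm (y - v)"
        using z \<eta> unfolding reg_normal_cone_def by blast
      define s where "s = min 1 (\<delta> / (2 * (norm d + 1)))"
      have nd: "norm d + 1 > 0" by (simp add: add_nonneg_pos)
      have s: "s > 0" "s \<le> 1" using \<delta>(1) nd by (auto simp: s_def)
      have "s * norm d \<le> s * (norm d + 1)" using s by simp
      also have "\<dots> \<le> \<delta> / (2 * (norm d + 1)) * (norm d + 1)"
        using nd by (intro mult_right_mono) (auto simp: s_def)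
      also have "\<dots> < \<delta>"
      proof -
        have "\<delta> / (2 * x) * x < \<delta>" if "x > 0" for x using that \<delta>(1) by simp
        from this[OF nd] show ?thesis .
      qed
      finally have "norm (v + s *\<^sub>R d - v) < \<delta>" using s by simp
      from \<delta>(2)[OF d[OF s] this] have "s * (z \<bullet> d) \<le> s * (\<eta> * norm d)"
        using s by (simp add: mult.left_commute)
      then have "z \<bullet> d \<le> \<eta> * norm d" using s by simp
      also have "\<dots> \<le> \<eta> * (norm d + 1)" using \<eta> by simp
      also have "\<dots> = \<epsilon>" using nd by (simp add: \<eta>_def)
      finally show ?thesis by simp
    qed
    then show ?thesis by (rule field_le_epsilon)
  qed
  have le: "z \<bullet> y \<le> 0" if "y \<in> T" for y
    using that vT by (intro dir convex_cone_add[OF T] convex_cone_scaleR[OF T]) auto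
  have "v + s *\<^sub>R (- v) \<in> T" if "0 < s" "s \<le> 1" for s
  proof -
    have "v + s *\<^sub>R (- v) = (1 - s) *\<^sub>R v" by (simp add: scaleR_diff_left)
    then show ?thesis using that vT convex_cone_scaleR[OF T, of "1 - s"] by simp
  qed
  then have "z \<bullet> (- v) \<le> 0" by (rule dir)
  then show "z \<in> {z. v \<in> T \<and> z \<bullet> v = 0 \<and> (\<forall>y\<in>T. z \<bullet> y \<le> 0)}" using le vT by fastforce
next
  fix z assume "z \<in> {z. v \<in> T \<and> z \<bullet> v = 0 \<and> (\<forall>y\<in>T. z \<bullet> y \<le> 0)}"
  then have z: "v \<in> T" "z \<bullet> v = 0" "\<And>y. y \<in> T \<Longrightarrow> z \<bullet> y \<le> 0" by auto
  have "z \<bullet> (y - v) \<le> \<epsilon> * norm (y - v)" if "y \<in> T" "\<epsilon> > 0" for y \<epsilon>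
  proof -
    have "z \<bullet> (y - v) \<le> 0" using z(2) z(3)[OF that(1)] by (simp add: inner_diff_right)
    also have "0 \<le> \<epsilon> * norm (y - v)" using that by simp
    finally show ?thesis .
  qed
  then show "z \<in> reg_normal_cone T v"
    unfolding reg_normal_cone_def using z(1) by (auto intro!: exI[of _ 1])
qed

lemma inv_adj_adjoint:
  fixes T :: "'y::euclidean_space \<Rightarrow>\<^sub>L 'e::euclidean_space"
  assumes "surj (blinfun_apply T)"
  shows "inv_adj T (adjoint (blinfun_apply T) m) = m"
  unfolding inv_adj_def
proof (rule the_equality)
  fix n assume n: "adjoint (blinfun_apply T) n = adjoint (blinfun_apply T) m"
  have "n \<bullet> y = m \<bullet> y" for y
  proof -
    obtain x where "y = T x" using assms by (metis surjD)
    then show ?thesis using n by (metis adjoint_blinfun_inner)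
  qed
  then show "n = m" using vector_eq_rdot by blast
qed simp

lemma reduced_system_compose:
  fixes g :: "'p::euclidean_space \<times> 'x::euclidean_space \<Rightarrow> 'y::euclidean_space"
    and h :: "'y \<Rightarrow> 'e::euclidean_space"
  assumes U: "open U" "(pb, xb) \<in> U"
    and g1: "\<And>z. z \<in> U \<Longrightarrow> (g has_derivative blinfun_apply (Dg z)) (at z)"
    and g2: "(Dg has_derivative blinfun_apply D2g) (at (pb, xb))"
    and K: "closed K" "convex_cone K"
    and V: "open V" "g (pb, xb) \<in> V"
    and h1: "\<And>y. y \<in> V \<Longrightarrow> (h has_derivative blinfun_apply (Dh y)) (at y)"
    and h2: "(Dh has_derivative blinfun_apply D2h) (at (g (pb, xb)))"
    and h0: "h (g (pb, xb)) = 0" and surj: "surj (blinfun_apply (Dh (g (pb, xb))))"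
    and CV: "C \<inter> V = {y \<in> V. h y \<in> K}"
    and RS: "robinson_stable g C pb xb"
  obtains W \<kappa> where "reduced_system (\<lambda>z. h (g z)) (\<lambda>z. Dh (g z) o\<^sub>L Dg z)
     (\<lambda>v. (Dh (g (pb, xb)) o\<^sub>L D2g v) + (D2h (Dg (pb, xb) v) o\<^sub>L Dg (pb, xb))) W K (pb, xb) (Gamma g C) \<kappa>"
proof -
  have contg: "isCont g (pb, xb)" using g1[OF U(2)] has_derivative_continuous by blast
  have contDh: "isCont Dh (g (pb, xb))" using h2 has_derivative_continuous by blast
  have K0: "0 \<in> K" using convex_cone_contains_0[OF K(2)] .
  obtain \<kappa> W where W: "\<kappa> \<ge> 0" "open W" "(pb, xb) \<in> W" "g ` W \<subseteq> V"
    "\<And>z k. z \<in> W \<Longrightarrow> k \<in> K \<Longrightarrow> Gamma g C (fst z) \<noteq> {} \<and> 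
        infdist (snd z) (Gamma g C (fst z)) \<le> \<kappa> * norm (h (g z) - k)"
    using robinson_stable_reduced[OF RS contg V h1 contDh surj h0 K0 CV] by metis
  have "reduced_system (\<lambda>z. h (g z)) (\<lambda>z. Dh (g z) o\<^sub>L Dg z)
     (\<lambda>v. (Dh (g (pb, xb)) o\<^sub>L D2g v) + (D2h (Dg (pb, xb) v) o\<^sub>L Dg (pb, xb))) (U \<inter> W) K (pb, xb) (Gamma g C) \<kappa>"
  proof
    show "open (U \<inter> W)" "(pb, xb) \<in> U \<inter> W" using U W by auto
    show "((\<lambda>z. h (g z)) has_derivative blinfun_apply (Dh (g z) o\<^sub>L Dg z)) (at z)" if z: "z \<in> U \<inter> W" for z
    proof -
      have "g z \<in> V" using W(4) z by blast
      from has_derivative_compose[OF g1 h1[OF this]] z show ?thesis by (auto simp: o_def blinfun_compose.rep_eq)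
    qed
    have "((\<lambda>z. Dh (g z)) has_derivative (\<lambda>v. D2h (Dg (pb, xb) v))) (at (pb, xb))"
      by (rule has_derivative_compose[OF g1[OF U(2)] h2])
    from bounded_bilinear.FDERIV[OF bounded_bilinear_blinfun_compose this g2]
    show "((\<lambda>z. Dh (g z) o\<^sub>L Dg z) has_derivative
      (\<lambda>v. (Dh (g (pb, xb)) o\<^sub>L D2g v) + (D2h (Dg (pb, xb) v) o\<^sub>L Dg (pb, xb)))) (at (pb, xb))" .
    show "snd z \<in> Gamma g C (fst z) \<longleftrightarrow> h (g z) \<in> K" if "z \<in> U \<inter> W" for z
      using that W(4) CV by (auto simp: Gamma_def)
    show "Gamma g C (fst z) \<noteq> {}" if "z \<in> U \<inter> W" for z
      using W(5)[of z 0] that K0 by auto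
    show "infdist (snd z) (Gamma g C (fst z)) \<le> \<kappa> * norm (h (g z) - k)" if "z \<in> U \<inter> W" "k \<in> K" for z k
      using W(5)[of z k] that by auto
  qed (use h0 K W in auto)
  then show thesis by (rule that)
qed

text \<open>The nontrivial inclusion is the multiplier rule for the parameter-free constraint
  system \<open>y \<in> C\<close>, viewed as one with a dummy parameter.\<close>
lemma reg_normal_cone_submersion:
  fixes h :: "'y::euclidean_space \<Rightarrow> 'e::euclidean_space"
  assumes K: "closed K" "convex_cone K"
    and V: "open V" "y0 \<in> V"
    and h1: "\<And>y. y \<in> V \<Longrightarrow> (h has_derivative blinfun_apply (Dh y)) (at y)"
    and h2: "(Dh has_derivative blinfun_apply D2h) (at y0)"
    and h0: "h y0 = 0" and surj: "surj (blinfun_apply (Dh y0))"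
    and CV: "C \<inter> V = {y \<in> V. h y \<in> K}"
  shows "reg_normal_cone C y0 = adjoint (blinfun_apply (Dh y0)) ` polar_cone K"
proof (intro set_eqI iffI)
  fix l assume l: "l \<in> reg_normal_cone C y0"
  define S where "S = (Blinfun snd :: (real \<times> 'y) \<Rightarrow>\<^sub>L 'y)"
  have S: "blinfun_apply S = snd" unfolding S_def by (simp add: bounded_linear_Blinfun_apply bounded_linear_snd)
  have Gam: "Gamma snd C p = C" for p :: real by (simp add: Gamma_def)
  \<comment> \<open>With the projection as constraint map every slice is \<open>C\<close> itself, so
    constant 1 works.\<close>
  have RS: "robinson_stable snd C (0::real) y0"
    unfolding robinson_stable_def Gam by (intro exI[of _ 1] exI[of _ UNIV] conjI) auto
  have d1: "(snd has_derivative blinfun_apply S) (at z)" for z :: "real \<times> 'y"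
    unfolding S by (rule bounded_linear_imp_has_derivative[OF bounded_linear_snd])
  have d2: "((\<lambda>z. S) has_derivative blinfun_apply 0) (at (0::real, y0))"
    by (simp add: zero_blinfun.rep_eq)
  have V2: "snd (0::real, y0) \<in> V" and h0': "h (snd (0::real, y0)) = 0"
    and h2': "(Dh has_derivative blinfun_apply D2h) (at (snd (0::real, y0)))"
    and surj': "surj (blinfun_apply (Dh (snd (0::real, y0))))"
    using V(2) h0 h2 surj by simp_all
  obtain W \<kappa> where "reduced_system (\<lambda>z. h (snd z)) (\<lambda>z. Dh (snd z) o\<^sub>L S)
     (\<lambda>v. (Dh (snd (0::real, y0)) o\<^sub>L (0::(real \<times> 'y) \<Rightarrow>\<^sub>L (real \<times> 'y) \<Rightarrow>\<^sub>L 'y) v) + (D2h (S v) o\<^sub>L S)) W K (0, y0) (Gamma snd C) \<kappa>"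
    by (rule reduced_system_compose[OF open_UNIV UNIV_I d1 d2 K V(1) V2 h1 h2' h0' surj' CV RS])
  then interpret R: reduced_system "\<lambda>z. h (snd z)" "\<lambda>z. Dh (snd z) o\<^sub>L S"
     "\<lambda>v. (Dh (snd (0::real, y0)) o\<^sub>L (0::(real \<times> 'y) \<Rightarrow>\<^sub>L (real \<times> 'y) \<Rightarrow>\<^sub>L 'y) v) + (D2h (S v) o\<^sub>L S)" W K "(0, y0)" "Gamma snd C" \<kappa> .
  obtain m where m: "m \<in> polar_cone K" "snd (adjoint (blinfun_apply (Dh (snd (0::real, y0)) o\<^sub>L S)) m) = l"
    using R.normal_multiplier[OF R.zb_U, of l] l by (auto simp: Gam)
  have "l \<bullet> u = adjoint (blinfun_apply (Dh y0)) m \<bullet> u" for u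
    unfolding m(2)[symmetric] snd_adjoint_inner adjoint_blinfun_inner by (simp add: S)
  then have "l = adjoint (blinfun_apply (Dh y0)) m" using vector_eq_rdot by blast
  then show "l \<in> adjoint (blinfun_apply (Dh y0)) ` polar_cone K" using m(1) by blast
next
  fix l assume "l \<in> adjoint (blinfun_apply (Dh y0)) ` polar_cone K"
  then obtain m where m: "m \<in> polar_cone K" "l = adjoint (blinfun_apply (Dh y0)) m" by blast
  have "y0 \<in> C \<inter> V" unfolding CV using V(2) h0 convex_cone_contains_0[OF K(2)] by simp
  then have "y0 \<in> C" by simp
  moreover have "\<exists>\<delta>>0. \<forall>y\<in>C. norm (y - y0) < \<delta> \<longrightarrow> l \<bullet> (y - y0) \<le> \<epsilon> * norm (y - y0)" if e: "\<epsilon> > 0" for \<epsilon>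
  proof -
    \<comment> \<open>The summand 1 keeps the quotient meaningful for \<open>m = 0\<close>.\<close>
    have nm: "norm m + 1 > 0" by (simp add: add_nonneg_pos)
    then have "\<epsilon> / (norm m + 1) > 0" using e by simp
    from has_derivative_atE[OF h1[OF V(2)] this] obtain \<delta>1 where \<delta>1: "\<delta>1 > 0"
      "\<And>w. norm w < \<delta>1 \<Longrightarrow> norm (h (y0 + w) - h y0 - Dh y0 w) \<le> \<epsilon> / (norm m + 1) * norm w" by blast
    obtain \<delta>2 where \<delta>2: "\<delta>2 > 0" "ball y0 \<delta>2 \<subseteq> V" using V open_contains_ball by blast
    have "l \<bullet> (y - y0) \<le> \<epsilon> * norm (y - y0)" if y: "y \<in> C" "norm (y - y0) < min \<delta>1 \<delta>2" for y
    proof -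
      have "y \<in> V" using \<delta>2(2) y(2) by (auto simp: dist_norm norm_minus_commute)
      then have hy: "h y \<in> K" using CV y(1) by blast
      have D: "norm (Dh y0 (y - y0) - h y) \<le> \<epsilon> / (norm m + 1) * norm (y - y0)"
        using \<delta>1(2)[of "y - y0"] y(2) h0 by (simp add: norm_minus_commute)
      have "l \<bullet> (y - y0) = m \<bullet> Dh y0 (y - y0)" unfolding m(2) by (rule adjoint_blinfun_inner)
      also have "\<dots> \<le> m \<bullet> (Dh y0 (y - y0) - h y)" using polar_coneD[OF m(1) hy] by (simp add: inner_diff_right)
      also have "\<dots> \<le> norm m * norm (Dh y0 (y - y0) - h y)" by (rule norm_cauchy_schwarz)
      also have "\<dots> \<le> (norm m + 1) * (\<epsilon> / (norm m + 1) * norm (y - y0))"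
        using D by (intro mult_mono) auto
      also have "\<dots> = \<epsilon> * norm (y - y0)" using nm by simp
      finally show ?thesis .
    qed
    then show ?thesis using \<delta>1(1) \<delta>2(1) by (intro exI[of _ "min \<delta>1 \<delta>2"]) auto
  qed
  ultimately show "l \<in> reg_normal_cone C y0" unfolding reg_normal_cone_def by blast
qed

section \<open>Multipliers of the original and of the reduced system\<close>

lemma adjoint_blinfun_compose:
  fixes T :: "'y::euclidean_space \<Rightarrow>\<^sub>L 'e::euclidean_space" and S :: "'z::euclidean_space \<Rightarrow>\<^sub>L 'y"
  shows "adjoint (blinfun_apply S) (adjoint (blinfun_apply T) m) = adjoint (blinfun_apply (T o\<^sub>L S)) m"
proof -
  have "adjoint (blinfun_apply S) (adjoint (blinfun_apply T) m) \<bullet> x = adjoint (blinfun_apply (T o\<^sub>L S)) m \<bullet> x" for x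
    by (simp add: adjoint_blinfun_inner)
  then show ?thesis using vector_eq_rdot by blast
qed

lemma adjoint_dx_inner:
  fixes T :: "('p::euclidean_space \<times> 'x::euclidean_space) \<Rightarrow>\<^sub>L 'y::euclidean_space"
  shows "adjoint (dx T) l \<bullet> u = l \<bullet> T (0, u)"
proof -
  have "bounded_linear (\<lambda>u::'x. (0::'p, u))"
    by (intro bounded_linear_Pair bounded_linear_zero bounded_linear_ident)
  from bounded_linear_compose[OF blinfun.bounded_linear_right[of T] this]
  have "linear (dx T)" unfolding dx_def by (rule bounded_linear.linear)
  then show ?thesis by (simp add: adjoint_clauses dx_def)
qed

text \<open>The second derivative of the composition has one summand with the Hessian of
  \<open>g\<close> and one with that of \<open>h\<close>. Paired with \<open>m\<close>, the first
  carries the adjoint image of \<open>m\<close> as multiplier, and the second carries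
  \<open>m\<close> itself, recovered by \<open>inv_adj\<close>.\<close>

lemma multiplier_terms:
  fixes Dg0 :: "('p::euclidean_space \<times> 'x::euclidean_space) \<Rightarrow>\<^sub>L 'y::euclidean_space"
    and D2g0 :: "('p \<times> 'x) \<Rightarrow>\<^sub>L ('p \<times> 'x) \<Rightarrow>\<^sub>L 'y"
    and Dh0 :: "'y \<Rightarrow>\<^sub>L 'e::euclidean_space" and D2h0 :: "'y \<Rightarrow>\<^sub>L 'y \<Rightarrow>\<^sub>L 'e"
  assumes surj: "surj (blinfun_apply Dh0)"
    and B: "B v = (Dh0 o\<^sub>L D2g0 v) + (D2h0 (Dg0 v) o\<^sub>L Dg0)"
  shows "mult_obj Dg0 D2g0 Dh0 D2h0 v (adjoint (blinfun_apply Dh0) m) = m \<bullet> B v v"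
    and "grad_adj D2g0 (adjoint (blinfun_apply Dh0) m) v + H_op Dg0 Dh0 D2h0 (adjoint (blinfun_apply Dh0) m) v
       = snd (adjoint (blinfun_apply (B v)) m)"
proof -
  show "mult_obj Dg0 D2g0 Dh0 D2h0 v (adjoint (blinfun_apply Dh0) m) = m \<bullet> B v v"
    by (simp add: mult_obj_def inv_adj_adjoint[OF surj] adjoint_blinfun_inner B blinfun.add_left inner_add_right)
  have "(grad_adj D2g0 (adjoint (blinfun_apply Dh0) m) v + H_op Dg0 Dh0 D2h0 (adjoint (blinfun_apply Dh0) m) v) \<bullet> u
       = snd (adjoint (blinfun_apply (B v)) m) \<bullet> u" for u
    by (simp add: grad_adj_def H_op_def inv_adj_adjoint[OF surj] inner_add_left adjoint_dx_inner
       adjoint_blinfun_inner snd_adjoint_inner B blinfun.add_left inner_add_right)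
  then show "grad_adj D2g0 (adjoint (blinfun_apply Dh0) m) v + H_op Dg0 Dh0 D2h0 (adjoint (blinfun_apply Dh0) m) v
       = snd (adjoint (blinfun_apply (B v)) m)" using vector_eq_rdot by blast
qed

theorem theorem5p3:
  fixes g :: "'p::euclidean_space \<times> 'x::euclidean_space \<Rightarrow> 'y::euclidean_space"
    and Dg :: "'p \<times> 'x \<Rightarrow> ('p \<times> 'x) \<Rightarrow>\<^sub>L 'y"
    and D2g :: "'p \<times> 'x \<Rightarrow> ('p \<times> 'x) \<Rightarrow>\<^sub>L (('p \<times> 'x) \<Rightarrow>\<^sub>L 'y)"
    and U :: "('p \<times> 'x) set"
    and C :: "'y set"
    and h :: "'y \<Rightarrow> 'e::euclidean_space"
    and Dh :: "'y \<Rightarrow> 'y \<Rightarrow>\<^sub>L 'e"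
    and D2h :: "'y \<Rightarrow> 'y \<Rightarrow>\<^sub>L ('y \<Rightarrow>\<^sub>L 'e)"
    and V :: "'y set"
    and K :: "'e set"
    and pb :: 'p and xb :: 'x and xbs :: 'x
  assumes g_C2: "open U" "(pb, xb) \<in> U"
      "\<forall>z\<in>U. (g has_derivative blinfun_apply (Dg z)) (at z)"
      "\<forall>z\<in>U. (Dg has_derivative blinfun_apply (D2g z)) (at z)"
      "continuous_on U D2g"
    and C_closed: "closed C"
    and K_cone: "closed K" "convex K" "cone K"
    and h_C2: "open V" "g (pb, xb) \<in> V"
      "\<forall>y\<in>V. (h has_derivative blinfun_apply (Dh y)) (at y)"
      "\<forall>y\<in>V. (Dh has_derivative blinfun_apply (D2h y)) (at y)"
      "continuous_on V D2h"
    and reduc: "h (g (pb, xb)) = 0" "surj (blinfun_apply (Dh (g (pb, xb))))"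
      "C \<inter> V = {y \<in> V. h y \<in> K}"
    and feas: "xb \<in> Gamma g C pb"
    and xbs_normal: "xbs \<in> reg_normal_cone (Gamma g C pb) xb"
    and RS: "robinson_stable g C pb xb"
    and alt: "char_subspace (Dh (g (pb, xb)) o\<^sub>L Dg (pb, xb)) K = UNIV \<or> polyhedron K"
  shows "tangent_cone (graph (Psi g C)) ((pb, xb), xbs) =
      {((q, u), us). \<exists>zs \<in> reg_normal_cone (tangent_cone (gphGamma g C) (pb, xb)) (q, u).
         snd zs = xbs \<and>
         (\<exists>lam \<in> Lambda_crit C (g (pb, xb)) (Dg (pb, xb)) (D2g (pb, xb))
                    (Dh (g (pb, xb))) (D2h (g (pb, xb))) zs (q, u).
            us \<in> (\<lambda>w. grad_adj (D2g (pb, xb)) lam (q, u)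
                       + H_op (Dg (pb, xb)) (Dh (g (pb, xb))) (D2h (g (pb, xb))) lam (q, u) + w)
                  ` (snd ` reg_normal_cone (critical_cone (gphGamma g C) (pb, xb) zs) (q, u)))}
    \<and> (\<forall>v. graphical_derivative (Psi g C) (pb, xb) xbs v =
      (\<Union>zs \<in> {zs \<in> reg_normal_cone (tangent_cone (gphGamma g C) (pb, xb)) v. snd zs = xbs}.
        \<Union>lam \<in> Lambda_crit C (g (pb, xb)) (Dg (pb, xb)) (D2g (pb, xb))
                    (Dh (g (pb, xb))) (D2h (g (pb, xb))) zs v.
          (\<lambda>w. grad_adj (D2g (pb, xb)) lam v
                + H_op (Dg (pb, xb)) (Dh (g (pb, xb))) (D2h (g (pb, xb))) lam v + w)
            ` (snd ` reg_normal_cone (critical_cone (gphGamma g C) (pb, xb) zs) v)))"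
proof -
  let ?z = "(pb, xb)"
  let ?y = "g ?z"
  let ?F = "gphGamma g C"
  define Ad where "Ad = adjoint (blinfun_apply (Dh ?y o\<^sub>L Dg ?z))"
  define Bv where "Bv = (\<lambda>v. (Dh ?y o\<^sub>L D2g ?z v) + (D2h ?y (Dg ?z v) o\<^sub>L Dg ?z))"
  define A where "A = Dh ?y o\<^sub>L Dg ?z"
  have AdA: "adjoint (blinfun_apply A) = Ad" by (simp add: A_def Ad_def)
  have "?y \<in> C \<inter> V" using feas h_C2(2) by (simp add: Gamma_def)
  \<comment> \<open>\<open>convex_cone\<close> includes nonemptiness, which comes from the
    feasibility of the base point.\<close>
  then have "0 \<in> K" unfolding reduc(3) using reduc(1) by simp
  then have ccK: "convex_cone K" using K_cone
    by (auto simp: convex_cone_def conic_def cone_def)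
  have g1: "\<And>z. z \<in> U \<Longrightarrow> (g has_derivative blinfun_apply (Dg z)) (at z)"
    and g2: "(Dg has_derivative blinfun_apply (D2g ?z)) (at ?z)"
    and h1: "\<And>y. y \<in> V \<Longrightarrow> (h has_derivative blinfun_apply (Dh y)) (at y)"
    and h2: "(Dh has_derivative blinfun_apply (D2h ?y)) (at ?y)"
    using g_C2 h_C2 by blast+
  obtain W \<kappa> where RSys: "reduced_system (\<lambda>z. h (g z)) (\<lambda>z. Dh (g z) o\<^sub>L Dg z) Bv W K ?z (Gamma g C) \<kappa>"
    by (rule reduced_system_compose[OF g_C2(1,2) g1 g2 K_cone(1) ccK h_C2(1,2) h1 h2 reduc(1,2,3) RS, folded Bv_def])
  interpret R: reduced_system "\<lambda>z. h (g z)" "\<lambda>z. Dh (g z) o\<^sub>L Dg z" Bv W K ?z "Gamma g C" \<kappa>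
    by (rule RSys)
  have alt': "R.dual_factorization \<or> polyhedron K"
    using alt
  proof
    assume "char_subspace (Dh ?y o\<^sub>L Dg ?z) K = UNIV"
    from char_subspace_UNIV_adjoint[OF this] show ?thesis unfolding R.dual_factorization_def by metis
  qed simp
  have gr: "graph (Psi g C) = R.normal_graph" by (auto simp: graph_def Psi_def)
  have tan: "tangent_cone ?F ?z = {v. A v \<in> K}"
    unfolding A_def by (rule R.tangent_cone_feasible) (simp add: gphGamma_def Gamma_def)
  \<comment> \<open>\<open>z = 0\<close> covers the tangent cone, other \<open>z\<close> the
    critical cones.\<close>
  have ccT: "convex_cone {v. A v \<in> K \<and> z \<bullet> v = 0}" for z
    using ccK by (auto simp: convex_cone_iff blinfun.add_right blinfun.scaleR_right inner_add_right blinfun.zero_right)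
  have NT: "reg_normal_cone (tangent_cone ?F ?z) v = {z. A v \<in> K \<and> z \<bullet> v = 0 \<and> (\<forall>y. A y \<in> K \<longrightarrow> z \<bullet> y \<le> 0)}" for v
    using reg_normal_cone_convex_cone[OF ccT[of 0], of v] unfolding tan by simp
  have crit: "critical_cone ?F ?z z = {v. A v \<in> K \<and> z \<bullet> v = 0}" for z
    unfolding critical_cone_def tan by auto
  have NC: "reg_normal_cone (critical_cone ?F ?z z) v =
     {w. (A v \<in> K \<and> z \<bullet> v = 0) \<and> w \<bullet> v = 0 \<and> (\<forall>y. A y \<in> K \<and> z \<bullet> y = 0 \<longrightarrow> w \<bullet> y \<le> 0)}" for z v
    unfolding crit reg_normal_cone_convex_cone[OF ccT] by simp
  have NCy: "reg_normal_cone C ?y = adjoint (blinfun_apply (Dh ?y)) ` polar_cone K"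
    by (rule reg_normal_cone_submersion[OF K_cone(1) ccK h_C2(1,2) h1 h2 reduc])
  have Bv: "Bv v = (Dh ?y o\<^sub>L D2g ?z v) + (D2h ?y (Dg ?z v) o\<^sub>L Dg ?z)" for v by (simp add: Bv_def)
  note terms = multiplier_terms[where B = Bv, OF reduc(2) Bv]
  have Lset: "Lambda_set C ?y (Dg ?z) zs = adjoint (blinfun_apply (Dh ?y)) ` {m \<in> polar_cone K. Ad m = zs}" for zs
    unfolding Lambda_set_def NCy Ad_def by (auto simp: adjoint_blinfun_compose)
  \<comment> \<open>Every normal to \<open>C\<close> is the image of a polar element, so maximizing
    over \<open>\<lambda>\<close> is maximizing \<open>m \<bullet> Bv v v\<close> over a fibre of
    \<open>Ad\<close>.\<close>
  have Lam: "Lambda_crit C ?y (Dg ?z) (D2g ?z) (Dh ?y) (D2h ?y) zs v =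
     {adjoint (blinfun_apply (Dh ?y)) m | m. m \<in> polar_cone K \<and> Ad m = zs \<and>
        (\<forall>m'\<in>polar_cone K. Ad m' = zs \<longrightarrow> m' \<bullet> Bv v v \<le> m \<bullet> Bv v v)}" for zs v
    unfolding Lambda_crit_def Lset by (auto simp: terms(1))
  \<comment> \<open>Both directions rest on \<open>zs = Ad m\<close>: then
    \<open>zs \<bullet> y = m \<bullet> A y\<close>, and nonpositivity of \<open>zs\<close> on the
    tangent cone follows from \<open>m \<in> polar_cone K\<close>.\<close>
  have main: "(\<exists>zs \<in> reg_normal_cone (tangent_cone ?F ?z) v. snd zs = xbs \<and>
         (\<exists>lam \<in> Lambda_crit C ?y (Dg ?z) (D2g ?z) (Dh ?y) (D2h ?y) zs v.
            us \<in> (\<lambda>w. grad_adj (D2g ?z) lam v + H_op (Dg ?z) (Dh ?y) (D2h ?y) lam v + w)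
                  ` (snd ` reg_normal_cone (critical_cone ?F ?z zs) v)))
      \<longleftrightarrow> (\<exists>m. R.graph_derivative_rel xbs v us m)" (is "?L \<longleftrightarrow> ?R") for v us
  proof
    assume ?L
    then obtain zs m w where zs: "A v \<in> K" "zs \<bullet> v = 0" "snd zs = xbs"
      and m: "m \<in> polar_cone K" "Ad m = zs" "\<forall>m'\<in>polar_cone K. Ad m' = zs \<longrightarrow> m' \<bullet> Bv v v \<le> m \<bullet> Bv v v"
      and w: "w \<bullet> v = 0" "\<And>y. A y \<in> K \<Longrightarrow> zs \<bullet> y = 0 \<Longrightarrow> w \<bullet> y \<le> 0"
      and us: "us = snd (adjoint (blinfun_apply (Bv v)) m) + snd w"
      unfolding NT NC Lam by (auto simp: terms(2))
    have inner: "m \<bullet> A y = zs \<bullet> y" for y unfolding m(2)[symmetric] Ad_def A_def by (simp add: adjoint_blinfun_inner)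
    have "R.graph_derivative_rel xbs v us m"
      unfolding R.graph_derivative_rel_def A_def[symmetric] AdA
      using zs m w us by (intro conjI exI[of _ w]) (simp_all add: inner)
    then show ?R by blast
  next
    assume ?R
    then obtain m w where m: "m \<in> polar_cone K" "A v \<in> K" "m \<bullet> A v = 0" "snd (Ad m) = xbs"
       "\<forall>m'\<in>polar_cone K. Ad m' = Ad m \<longrightarrow> m' \<bullet> Bv v v \<le> m \<bullet> Bv v v"
      and w: "w \<bullet> v = 0" "\<And>y. A y \<in> K \<Longrightarrow> m \<bullet> A y = 0 \<Longrightarrow> w \<bullet> y \<le> 0"
        "us = snd (adjoint (blinfun_apply (Bv v)) m) + snd w"
      unfolding R.graph_derivative_rel_def A_def Ad_def by blast
    have inner: "Ad m \<bullet> y = m \<bullet> A y" for y unfolding Ad_def A_def by (rule adjoint_blinfun_inner)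
    show ?L
    proof (intro bexI[of _ "Ad m"] conjI bexI[of _ "adjoint (blinfun_apply (Dh ?y)) m"])
      show "Ad m \<in> reg_normal_cone (tangent_cone ?F ?z) v"
        unfolding NT using m polar_coneD[OF m(1)] by (auto simp: inner)
      show "adjoint (blinfun_apply (Dh ?y)) m \<in> Lambda_crit C ?y (Dg ?z) (D2g ?z) (Dh ?y) (D2h ?y) (Ad m) v"
        unfolding Lam using m by blast
      have "w \<in> reg_normal_cone (critical_cone ?F ?z (Ad m)) v"
        unfolding NC using m w by (auto simp: inner)
      then show "us \<in> (\<lambda>w. grad_adj (D2g ?z) (adjoint (blinfun_apply (Dh ?y)) m) v 
             + H_op (Dg ?z) (Dh ?y) (D2h ?y) (adjoint (blinfun_apply (Dh ?y)) m) v + w)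
                  ` (snd ` reg_normal_cone (critical_cone ?F ?z (Ad m)) v)"
        unfolding terms(2) w(3) by blast
    qed (rule m)
  qed
  have T: "tangent_cone (graph (Psi g C)) (?z, xbs) = {(v, us). \<exists>m. R.graph_derivative_rel xbs v us m}"
    unfolding gr by (rule R.tangent_cone_normal_graph[OF alt'])
  show ?thesis
  proof (intro conjI allI)
    show "graphical_derivative (Psi g C) ?z xbs v =
      (\<Union>zs \<in> {zs \<in> reg_normal_cone (tangent_cone ?F ?z) v. snd zs = xbs}.
        \<Union>lam \<in> Lambda_crit C ?y (Dg ?z) (D2g ?z) (Dh ?y) (D2h ?y) zs v.
          (\<lambda>w. grad_adj (D2g ?z) lam v + H_op (Dg ?z) (Dh ?y) (D2h ?y) lam v + w)
            ` (snd ` reg_normal_cone (critical_cone ?F ?z zs) v))" (is "_ = ?S") for v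
    proof (rule set_eqI)
      fix us
      have "us \<in> graphical_derivative (Psi g C) ?z xbs v \<longleftrightarrow> (\<exists>m. R.graph_derivative_rel xbs v us m)"
        unfolding graphical_derivative_def T by simp
      also have "\<dots> \<longleftrightarrow> us \<in> ?S" unfolding main[symmetric] by (simp only: UN_iff Bex_def mem_Collect_eq conj_assoc)
      finally show "us \<in> graphical_derivative (Psi g C) ?z xbs v \<longleftrightarrow> us \<in> ?S" .
    qed
  qed (simp only: T main, auto)
qed

end
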